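(* Let $p$ be a prime, $h$ a positive integer, $q=p^h$, and $m$ a positive integer with $p\nmid m(m-1)$. Let $a,b\in\mathbb{F}_q$ with $b\neq 0$ and $b\neq a^m$, and let $F_{a,b}(x)=x^m-tx+ta-b\in\mathbb{F}_q(t)[x]$. Then $$\mathrm{Gal}(F_{a,b}(x)\mid\mathbb{F}_q(t))=\mathrm{Gal}(F_{a,b}(x)\mid\overline{\mathbb{F}}_q(t))=\mathcal{S}_m.$$
   Context: $t$ is transcendental over $\mathbb{F}_q$; $\overline{\mathbb{F}}_q$ is an algebraic closure of $\mathbb{F}_q$; $\mathcal{S}_m$ is the symmetric group on $m$ letters, acting on the roots of $F_{a,b}$. *)

theory Defs
  imports
    "HOL-Algebra.Algebraic_Closure_Type"
    "HOL-Algebra.Generated_Fields"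
    "HOL-Algebra.Sym_Groups"
    "HOL-Algebra.Bij"
begin

text \<open>
  All fields in sight are subfields of one algebraically closed field, given as a type
  \<open>'a :: alg_closed_field\<close> and viewed as a ring record \<open>\<Omega>\<close>. Every polynomial splits there, so the
  Galois groups of one polynomial over different base fields act on the same set of roots.
\<close>

abbreviation ambient_field :: "'a::alg_closed_field ring"  (\<open>\<Omega>\<close>) where
  "\<Omega> \<equiv> ring_of_type_algebra"

abbreviation subfield_ring :: "'a::alg_closed_field set \<Rightarrow> 'a ring" where
  "subfield_ring L \<equiv> \<Omega>\<lparr>carrier := L\<rparr>"

definition simple_field_ext :: "'a::alg_closed_field set \<Rightarrow> 'a \<Rightarrow> 'a set"  (\<open>_'\<langle>_'\<rangle>\<close> [1000, 0] 1000) where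
  "K\<langle>x\<rangle> = generate_field \<Omega> (insert x K)"

definition root_set :: "'a::alg_closed_field poly \<Rightarrow> 'a set" where
  "root_set f = {x. poly f x = 0}"

text \<open>In the following, \<open>K\<close> is a subfield of \<open>\<Omega>\<close> and the coefficients of \<open>f\<close> lie in \<open>K\<close>.\<close>

definition splitting_field :: "'a::alg_closed_field set \<Rightarrow> 'a poly \<Rightarrow> 'a set" where
  "splitting_field K f = generate_field \<Omega> (K \<union> root_set f)"

text \<open>
  As usual for \<^const>\<open>Bij\<close>, automorphisms of \<open>L\<close> are represented by functions that take the value
  \<^const>\<open>undefined\<close> outside \<open>L\<close>.
\<close>

definition Gal :: "'a::alg_closed_field poly \<Rightarrow> 'a set \<Rightarrow> ('a \<Rightarrow> 'a) monoid" where
  "Gal f K = (let L = splitting_field K f in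
     (BijGroup L)\<lparr>carrier := {\<sigma> \<in> Bij L. \<sigma> \<in> ring_iso (subfield_ring L) (subfield_ring L) \<and>
                                    (\<forall>x\<in>K. \<sigma> x = x)}\<rparr>)"

text \<open>The same group as a group of permutations of the roots of \<open>f\<close>.\<close>

definition Gal_on_roots :: "'a::alg_closed_field poly \<Rightarrow> 'a set \<Rightarrow> ('a \<Rightarrow> 'a) monoid" where
  "Gal_on_roots f K =
     (BijGroup (root_set f))\<lparr>carrier := (\<lambda>\<sigma>. restrict \<sigma> (root_set f)) ` carrier (Gal f K)\<rparr>"

definition F_poly :: "nat \<Rightarrow> 'a::alg_closed_field \<Rightarrow> 'a \<Rightarrow> 'a \<Rightarrow> 'a poly" where
  "F_poly m t a b = Polynomial.monom 1 m - Polynomial.monom t 1 + [:t * a - b:]"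

end

theory Submission
  imports Defs
begin

text \<open>
  Let \<open>k\<close> be the algebraic closure of the finite field, \<open>K = k(t)\<close> and \<open>L\<close> the splitting field of \<open>F\<close>
  over \<open>K\<close>. A root \<open>x\<close> of \<open>F\<close> satisfies \<open>t = (x\<^sup>m - b) / (x - a)\<close>, so \<open>K(x) = k(x)\<close> is a rational
  function field and any two roots are conjugate. Over \<open>k(x)\<close>, the cofactor \<open>F / (X - x)\<close> is
  irreducible by Eisenstein's criterion at the place \<open>x = a\<close>, written in terms of \<open>1 / (X - a)\<close>; hence
  the group is doubly transitive. If \<open>c\<close> is a double root of the specialization of \<open>F\<close> at \<open>t = t0\<close>,
  then all other roots of the specialization are simple and \<open>c\<close> is not a triple root, because
  \<open>m (m - 1) \<noteq> 0\<close> in \<open>k\<close>. An element of the inertia group of a place of \<open>L\<close> above \<open>t0\<close> is therefore the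
  identity or a transposition, and the place is ramified because \<open>t - t0\<close> is, up to units, the square
  of \<open>x - c\<close> there. A doubly transitive group that contains a transposition is the full symmetric group.

  Places are replaced throughout by ring homomorphisms from subrings of \<open>\<Omega>\<close> into \<open>\<Omega>\<close>, and extension
  of such homomorphisms to one more algebraic element serves both for constructing places and for
  constructing automorphisms.
\<close>

subsection \<open>Subrings, subfields and homomorphisms\<close>

text \<open>The choice of \<open>x = a\<close> comes from the behaviour at t = infinity. Since b
  \<noteq> a^m, exactly one root of \<open>F\<close> tends to \<open>a\<close>, with t having a
  simple pole there, and the other m - 1 roots grow like the (m-1)-th roots of t. So if
  \<open>x\<close> is the root near \<open>a\<close> and \<open>y\<close> another one, then 1/(y -
  a)^(m-1) is (x - a) times a unit: an Eisenstein relation of degree m - 1 over k(x). The other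
  hypotheses serve the double root \<open>c\<close>. It exists because m - 1 is nonzero in
  \<open>k\<close>, and b \<noteq> 0 keeps it away from 0, where the second derivative m (m-1)
  c^(m-2) could vanish. Working over the algebraic closure makes \<open>c\<close> and
  \<open>t0\<close> constants and the residue field equal to \<open>k\<close>, so that inertia is
  visible on the reductions of the roots. The ring generated by \<open>t\<close> and the roots is
  not shown to be integrally closed, so there is no valuation on \<open>L\<close>. Orders of
  vanishing are compared with \<open>t - t0\<close> only, and norms carry the comparison down to
  k(t), where fractions can be reduced by hand.\<close>

definition subring_set :: "'a::comm_ring_1 set \<Rightarrow> bool" where
  "subring_set R \<longleftrightarrow> 1 \<in> R \<and> (\<forall>x\<in>R. \<forall>y\<in>R. x - y \<in> R \<and> x * y \<in> R)"

definition subfield_set :: "'a::field set \<Rightarrow> bool" where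
  "subfield_set K \<longleftrightarrow> subring_set K \<and> (\<forall>x\<in>K. inverse x \<in> K)"

text \<open>There is no codomain condition, and values outside \<open>R\<close> are arbitrary: an
  extension of a homomorphism is any function that agrees with it on \<open>R\<close>.\<close>

definition hom_on :: "'a::comm_ring_1 set \<Rightarrow> ('a \<Rightarrow> 'a) \<Rightarrow> bool" where
  "hom_on R \<phi> \<longleftrightarrow> \<phi> 1 = 1 \<and> (\<forall>x\<in>R. \<forall>y\<in>R. \<phi> (x + y) = \<phi> x + \<phi> y \<and> \<phi> (x * y) = \<phi> x * \<phi> y)"

definition polys :: "'a::comm_ring_1 set \<Rightarrow> 'a poly set" where
  "polys R = {p. \<forall>i. coeff p i \<in> R}"

definition adjoin :: "'a::comm_ring_1 set \<Rightarrow> 'a \<Rightarrow> 'a set" where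
  "adjoin R x = (\<lambda>p. poly p x) ` polys R"

text \<open>The head of the list is adjoined last, so that induction on the list peels off the top
  step of the tower.\<close>

definition adjoin_list :: "'a::comm_ring_1 set \<Rightarrow> 'a list \<Rightarrow> 'a set" where
  "adjoin_list R xs = foldr (\<lambda>x S. adjoin S x) xs R"

lemma adjoin_list_simps [simp]:
  "adjoin_list R [] = R" "adjoin_list R (x # xs) = adjoin (adjoin_list R xs) x"
  by (simp_all add: adjoin_list_def)

context
  fixes R :: "'a::comm_ring_1 set"
  assumes R: "subring_set R"
begin

lemma subring_one: "1 \<in> R"
  and subring_diff: "x \<in> R \<Longrightarrow> y \<in> R \<Longrightarrow> x - y \<in> R"
  and subring_mult: "x \<in> R \<Longrightarrow> y \<in> R \<Longrightarrow> x * y \<in> R"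
  using R by (auto simp: subring_set_def)

lemma subring_zero: "0 \<in> R"
  using subring_diff[OF subring_one subring_one] by simp

lemma subring_uminus: "x \<in> R \<Longrightarrow> - x \<in> R"
  using subring_diff[OF subring_zero] by force

lemma subring_add: "x \<in> R \<Longrightarrow> y \<in> R \<Longrightarrow> x + y \<in> R"
  using subring_diff[of x "- y"] subring_uminus by simp

lemma subring_power: "x \<in> R \<Longrightarrow> x ^ n \<in> R"
  by (induction n) (auto intro: subring_one subring_mult)

lemma subring_of_nat: "of_nat n \<in> R"
  by (induction n) (auto intro: subring_zero subring_one subring_add)

lemma subring_sum: "(\<And>i. i \<in> A \<Longrightarrow> f i \<in> R) \<Longrightarrow> sum f A \<in> R"
  by (induction A rule: infinite_finite_induct) (auto intro: subring_zero subring_add)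

lemma subring_prod: "(\<And>i. i \<in> A \<Longrightarrow> f i \<in> R) \<Longrightarrow> prod f A \<in> R"
  by (induction A rule: infinite_finite_induct) (auto intro: subring_one subring_mult)

lemmas subring_closed = subring_one subring_zero subring_diff subring_mult subring_uminus
  subring_add subring_power subring_of_nat

lemma polys_0: "0 \<in> polys R"
  by (simp add: polys_def subring_zero)

lemma polys_pCons_iff: "pCons c p \<in> polys R \<longleftrightarrow> c \<in> R \<and> p \<in> polys R"
  by (auto simp: polys_def coeff_pCons split: nat.splits)

lemma polys_1: "1 \<in> polys R"
  by (simp add: polys_pCons_iff polys_0 subring_one flip: pCons_one)

lemma polys_add: "p \<in> polys R \<Longrightarrow> q \<in> polys R \<Longrightarrow> p + q \<in> polys R"
  by (simp add: polys_def subring_add)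

lemma polys_diff: "p \<in> polys R \<Longrightarrow> q \<in> polys R \<Longrightarrow> p - q \<in> polys R"
  by (simp add: polys_def subring_diff)

lemma polys_smult: "c \<in> R \<Longrightarrow> p \<in> polys R \<Longrightarrow> smult c p \<in> polys R"
  by (simp add: polys_def subring_mult)

lemma polys_mult: "p \<in> polys R \<Longrightarrow> q \<in> polys R \<Longrightarrow> p * q \<in> polys R"
  by (simp add: polys_def coeff_mult subring_sum subring_mult)

lemma polys_monom: "c \<in> R \<Longrightarrow> monom c n \<in> polys R"
  by (simp add: polys_def subring_zero)

lemma polys_reflect: "p \<in> polys R \<Longrightarrow> reflect_poly p \<in> polys R"
  by (simp add: polys_def coeff_reflect_poly subring_zero)

lemma poly_closed: "p \<in> polys R \<Longrightarrow> x \<in> R \<Longrightarrow> poly p x \<in> R"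
  by (induction p) (auto simp: polys_pCons_iff subring_zero subring_add subring_mult)

lemma polys_synthetic_div: "p \<in> polys R \<Longrightarrow> c \<in> R \<Longrightarrow> synthetic_div p c \<in> polys R"
  by (induction p) (auto simp: polys_pCons_iff polys_0 poly_closed)

lemmas polys_closed = polys_0 polys_1 polys_add polys_diff polys_smult polys_mult polys_monom

lemma subring_adjoin: "subring_set (adjoin R x)"
  unfolding subring_set_def
proof (intro conjI ballI)
  show "1 \<in> adjoin R x"
    unfolding adjoin_def by (rule image_eqI[of _ _ 1]) (auto intro: polys_1)
next
  fix u v assume "u \<in> adjoin R x" "v \<in> adjoin R x"
  then obtain p q where "p \<in> polys R" "q \<in> polys R" "u = poly p x" "v = poly q x"
    by (auto simp: adjoin_def)
  thus "u - v \<in> adjoin R x" "u * v \<in> adjoin R x"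
    using polys_diff[of p q] polys_mult[of p q] by (auto simp: adjoin_def simp flip: poly_diff poly_mult)
qed

lemma adjoin_superset: "R \<subseteq> adjoin R x"
proof
  fix c assume "c \<in> R"
  thus "c \<in> adjoin R x"
    unfolding adjoin_def by (intro image_eqI[of _ _ "[:c:]"]) (auto simp: polys_pCons_iff polys_0)
qed

lemma adjoin_self: "x \<in> adjoin R x"
  unfolding adjoin_def
  by (rule image_eqI[of _ _ "[:0, 1:]"]) (auto simp: polys_pCons_iff polys_0 subring_zero subring_one)

context
  fixes \<phi>
  assumes \<phi>: "hom_on R \<phi>"
begin

lemma hom_one: "\<phi> 1 = 1"
  and hom_add: "x \<in> R \<Longrightarrow> y \<in> R \<Longrightarrow> \<phi> (x + y) = \<phi> x + \<phi> y"
  and hom_mult: "x \<in> R \<Longrightarrow> y \<in> R \<Longrightarrow> \<phi> (x * y) = \<phi> x * \<phi> y"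
  using \<phi> by (auto simp: hom_on_def)

lemma hom_zero: "\<phi> 0 = 0"
  using hom_add[OF subring_zero subring_zero] by simp

lemma hom_diff: "x \<in> R \<Longrightarrow> y \<in> R \<Longrightarrow> \<phi> (x - y) = \<phi> x - \<phi> y"
  using hom_add[of "x - y" y] subring_diff by simp

lemma hom_uminus: "x \<in> R \<Longrightarrow> \<phi> (- x) = - \<phi> x"
  using hom_diff[OF subring_zero] hom_zero by force

lemma hom_power: "x \<in> R \<Longrightarrow> \<phi> (x ^ n) = \<phi> x ^ n"
  by (induction n) (auto simp: hom_one hom_mult subring_power)

lemma hom_sum: "(\<And>i. i \<in> A \<Longrightarrow> f i \<in> R) \<Longrightarrow> \<phi> (sum f A) = (\<Sum>i\<in>A. \<phi> (f i))"
  by (induction A rule: infinite_finite_induct) (auto simp: hom_zero hom_add subring_sum)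

lemma hom_prod: "(\<And>i. i \<in> A \<Longrightarrow> f i \<in> R) \<Longrightarrow> \<phi> (prod f A) = (\<Prod>i\<in>A. \<phi> (f i))"
  by (induction A rule: infinite_finite_induct) (auto simp: hom_one hom_mult subring_prod)

lemmas hom_simps = hom_one hom_zero hom_add hom_mult hom_diff hom_uminus hom_power

lemma hom_coeff_map_poly: "coeff (map_poly \<phi> p) i = \<phi> (coeff p i)"
  by (simp add: coeff_map_poly hom_zero)

lemma hom_map_poly_pCons: "map_poly \<phi> (pCons c p) = pCons (\<phi> c) (map_poly \<phi> p)"
  by (rule map_poly_pCons) (simp add: hom_zero)

lemma hom_map_poly_add:
  "p \<in> polys R \<Longrightarrow> q \<in> polys R \<Longrightarrow> map_poly \<phi> (p + q) = map_poly \<phi> p + map_poly \<phi> q"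
  by (rule poly_eqI) (simp add: hom_coeff_map_poly hom_add polys_def)

lemma hom_map_poly_diff:
  "p \<in> polys R \<Longrightarrow> q \<in> polys R \<Longrightarrow> map_poly \<phi> (p - q) = map_poly \<phi> p - map_poly \<phi> q"
  by (rule poly_eqI) (simp add: hom_coeff_map_poly hom_diff polys_def)

lemma hom_map_poly_smult:
  "c \<in> R \<Longrightarrow> p \<in> polys R \<Longrightarrow> map_poly \<phi> (smult c p) = smult (\<phi> c) (map_poly \<phi> p)"
  by (rule poly_eqI) (simp add: hom_coeff_map_poly hom_mult polys_def)

lemma hom_map_poly_mult:
  "p \<in> polys R \<Longrightarrow> q \<in> polys R \<Longrightarrow> map_poly \<phi> (p * q) = map_poly \<phi> p * map_poly \<phi> q"
  by (rule poly_eqI)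
     (simp add: hom_coeff_map_poly hom_mult polys_def coeff_mult hom_sum subring_mult)

lemma hom_poly: "p \<in> polys R \<Longrightarrow> x \<in> R \<Longrightarrow> \<phi> (poly p x) = poly (map_poly \<phi> p) (\<phi> x)"
  by (induction p)
     (auto simp: polys_pCons_iff hom_zero hom_map_poly_pCons hom_add hom_mult subring_mult poly_closed)

lemma map_poly_image: "p \<in> polys R \<Longrightarrow> map_poly \<phi> p \<in> polys (\<phi> ` R)"
  by (auto simp: polys_def hom_coeff_map_poly)

lemma subring_image: "subring_set (\<phi> ` R)"
  unfolding subring_set_def
proof (intro conjI ballI)
  show "1 \<in> \<phi> ` R" using hom_one subring_one by (metis imageI)
next
  fix u v assume "u \<in> \<phi> ` R" "v \<in> \<phi> ` R"
  then obtain x y where "x \<in> R" "y \<in> R" "u = \<phi> x" "v = \<phi> y" by auto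
  thus "u - v \<in> \<phi> ` R" "u * v \<in> \<phi> ` R"
    using hom_diff[of x y] hom_mult[of x y] subring_diff[of x y] subring_mult[of x y]
    by (metis imageI)+
qed

end

end

lemma polys_mono: "R \<subseteq> S \<Longrightarrow> polys R \<subseteq> polys S"
  by (auto simp: polys_def)

lemma polys_lift_image:
  assumes "subring_set R" "hom_on R \<phi>" "q \<in> polys (\<phi> ` R)"
  obtains p where "p \<in> polys R" "map_poly \<phi> p = q"
proof -
  have "\<exists>p\<in>polys R. map_poly \<phi> p = q"
    using assms(3)
  proof (induction q)
    case 0
    show ?case by (rule bexI[of _ 0]) (auto simp: polys_0 assms)
  next
    case (pCons c q)
    have "c \<in> \<phi> ` R" "q \<in> polys (\<phi> ` R)"
      using pCons.prems polys_pCons_iff[OF subring_image[OF assms(1,2)]] by auto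
    with pCons.IH obtain x p where "x \<in> R" "p \<in> polys R" "c = \<phi> x" "map_poly \<phi> p = q" by auto
    thus ?case
      by (intro bexI[of _ "pCons x p"])
         (auto simp: polys_pCons_iff[OF assms(1)] hom_map_poly_pCons[OF assms(1,2)])
  qed
  thus ?thesis using that by blast
qed

lemma adjoin_least:
  assumes "subring_set S" "R \<subseteq> S" "x \<in> S"
  shows "adjoin R x \<subseteq> S"
  using polys_mono[OF assms(2)] poly_closed[OF assms(1)] assms(3) by (auto simp: adjoin_def)

lemma subring_adjoin_list: "subring_set R \<Longrightarrow> subring_set (adjoin_list R xs)"
  by (induction xs) (auto intro: subring_adjoin)

lemma adjoin_list_superset: "subring_set R \<Longrightarrow> R \<subseteq> adjoin_list R xs"
  by (induction xs) (auto dest: subsetD[OF adjoin_superset[OF subring_adjoin_list]])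

lemma adjoin_list_mem: "subring_set R \<Longrightarrow> set xs \<subseteq> adjoin_list R xs"
proof (induction xs)
  case (Cons x xs)
  thus ?case
    using adjoin_superset[OF subring_adjoin_list, of R xs x] adjoin_self[OF subring_adjoin_list, of R x xs]
    by auto
qed auto

lemma adjoin_list_least:
  assumes "subring_set S" "R \<subseteq> S" "set xs \<subseteq> S"
  shows "adjoin_list R xs \<subseteq> S"
  using assms by (induction xs) (auto dest: subsetD[OF adjoin_least])

lemma hom_on_id: "hom_on R (\<lambda>x. x)"
  by (auto simp: hom_on_def)

lemma hom_on_subset: "hom_on S \<phi> \<Longrightarrow> R \<subseteq> S \<Longrightarrow> hom_on R \<phi>"
  by (auto simp: hom_on_def)

lemma hom_on_cong:
  assumes "subring_set R" "\<And>x. x \<in> R \<Longrightarrow> \<phi> x = \<psi> x"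
  shows "hom_on R \<phi> \<longleftrightarrow> hom_on R \<psi>"
  using assms by (auto simp: hom_on_def subring_one subring_add subring_mult)

lemma hom_eq_on_adjoin:
  assumes R: "subring_set R" and "hom_on (adjoin R x) \<phi>" "hom_on (adjoin R x) \<psi>"
    and eq: "\<And>c. c \<in> R \<Longrightarrow> \<phi> c = \<psi> c" "\<phi> x = \<psi> x" and y: "y \<in> adjoin R x"
  shows "\<phi> y = \<psi> y"
proof -
  note S = subring_adjoin[OF R, of x]
  obtain p where p: "p \<in> polys R" "y = poly p x" using y by (auto simp: adjoin_def)
  have "map_poly \<phi> p = map_poly \<psi> p"
    using p(1) eq(1)
    by (intro poly_eqI) (simp add: polys_def hom_coeff_map_poly[OF S assms(2)] hom_coeff_map_poly[OF S assms(3)])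
  thus ?thesis
    using hom_poly[OF S assms(2), of p x] hom_poly[OF S assms(3), of p x] p eq(2)
      polys_mono[OF adjoin_superset[OF R, of x]] adjoin_self[OF R] by auto
qed

lemma hom_eq_on_adjoin_list:
  assumes R: "subring_set R" and "hom_on (adjoin_list R xs) \<phi>" "hom_on (adjoin_list R xs) \<psi>"
    and eq: "\<And>c. c \<in> R \<Longrightarrow> \<phi> c = \<psi> c" "\<And>x. x \<in> set xs \<Longrightarrow> \<phi> x = \<psi> x"
    and y: "y \<in> adjoin_list R xs"
  shows "\<phi> y = \<psi> y"
  using assms(2-)
proof (induction xs arbitrary: y)
  case (Cons x xs)
  note S = subring_adjoin_list[OF R, of xs]
  note sub = adjoin_superset[OF S, of x]
  show ?case
    by (rule hom_eq_on_adjoin[OF S])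
       (use Cons sub hom_on_subset[of _ _ "adjoin_list R xs"] in auto)
qed auto

text \<open>The hypothesis says that the kernel of evaluation at \<open>x\<close> is contained in
  the kernel of reducing coefficients by \<phi> and evaluating at \<open>y\<close>; the second map
  therefore factors through R[x].\<close>

lemma hom_extend_adjoin:
  assumes R: "subring_set R" and \<phi>: "hom_on R \<phi>"
    and rel: "\<And>p. p \<in> polys R \<Longrightarrow> poly p x = 0 \<Longrightarrow> poly (map_poly \<phi> p) y = 0"
  obtains \<psi> where "hom_on (adjoin R x) \<psi>" "\<And>c. c \<in> R \<Longrightarrow> \<psi> c = \<phi> c" "\<psi> x = y"
proof -
  \<comment> \<open>Any polynomial representing \<open>u\<close> will do: two choices differ by a
    relation of \<open>x\<close>, which \<open>rel\<close> sends to 0.\<close>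
  define \<psi> where "\<psi> u = poly (map_poly \<phi> (SOME p. p \<in> polys R \<and> poly p x = u)) y" for u
  have \<psi>: "\<psi> (poly p x) = poly (map_poly \<phi> p) y" if p: "p \<in> polys R" for p
  proof -
    define q where "q = (SOME q. q \<in> polys R \<and> poly q x = poly p x)"
    have q: "q \<in> polys R \<and> poly q x = poly p x"
      unfolding q_def by (rule someI[of _ p]) (use p in auto)
    have "poly (map_poly \<phi> (q - p)) y = 0"
      by (rule rel) (use p q polys_diff[OF R] in auto)
    thus ?thesis
      using p q by (simp add: hom_map_poly_diff[OF R \<phi>] \<psi>_def flip: q_def)
  qed
  show ?thesis
  proof
    show "hom_on (adjoin R x) \<psi>"
      unfolding hom_on_def
    proof (intro conjI ballI)
      show "\<psi> 1 = 1"
        using \<psi>[OF polys_1[OF R]] by (simp add: hom_one[OF R \<phi>])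
    next
      fix u v assume "u \<in> adjoin R x" "v \<in> adjoin R x"
      then obtain p q where pq: "p \<in> polys R" "q \<in> polys R" "u = poly p x" "v = poly q x"
        by (auto simp: adjoin_def)
      show "\<psi> (u + v) = \<psi> u + \<psi> v"
        using \<psi>[OF polys_add[OF R pq(1,2)]] \<psi>[OF pq(1)] \<psi>[OF pq(2)] pq
        by (simp add: hom_map_poly_add[OF R \<phi>])
      show "\<psi> (u * v) = \<psi> u * \<psi> v"
        using \<psi>[OF polys_mult[OF R pq(1,2)]] \<psi>[OF pq(1)] \<psi>[OF pq(2)] pq
        by (simp add: hom_map_poly_mult[OF R \<phi>])
    qed
    show "\<psi> c = \<phi> c" if "c \<in> R" for c
      using \<psi>[of "[:c:]"] that
      by (simp add: polys_pCons_iff[OF R] polys_0[OF R] hom_map_poly_pCons[OF R \<phi>])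
    show "\<psi> x = y"
      using \<psi>[of "[:0, 1:]"]
      by (simp add: polys_pCons_iff[OF R] polys_0[OF R] subring_closed[OF R]
          hom_map_poly_pCons[OF R \<phi>] hom_zero[OF R \<phi>] hom_one[OF R \<phi>])
  qed
qed

subsection \<open>Extension of homomorphisms\<close>

lemma subfieldD:
  assumes "subfield_set K"
  shows subfield_subring: "subring_set K" and subfield_inverse: "x \<in> K \<Longrightarrow> inverse x \<in> K"
  using assms by (auto simp: subfield_set_def)

lemma subfield_divide: "subfield_set K \<Longrightarrow> x \<in> K \<Longrightarrow> y \<in> K \<Longrightarrow> x / y \<in> K"
  by (simp add: divide_inverse subfieldD subring_mult)

text \<open>The usual cancellation of leading terms, carried out so that quotient and remainder keep
  their coefficients in \<open>K\<close>.\<close>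

lemma polys_division:
  assumes K: "subfield_set K" and g: "g \<in> polys K" "g \<noteq> 0" and f: "f \<in> polys K"
  obtains q r where "q \<in> polys K" "r \<in> polys K" "f = g * q + r" "r = 0 \<or> degree r < degree g"
proof -
  note R = subfield_subring[OF K]
  have "\<exists>q\<in>polys K. \<exists>r\<in>polys K. f = g * q + r \<and> (r = 0 \<or> degree r < degree g)"
    using f
  proof (induction "degree f" arbitrary: f rule: less_induct)
    case less
    show ?case
    proof (cases "f = 0 \<or> degree f < degree g")
      case True
      thus ?thesis using less.prems polys_0[OF R] by (intro bexI[of _ 0] bexI[of _ f]) auto
    next
      case False
      define h where "h = monom (lead_coeff f / lead_coeff g) (degree f - degree g)"
      have lc: "lead_coeff f / lead_coeff g \<in> K"
        using less.prems g subfield_divide[OF K] by (auto simp: polys_def)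
      have h: "h \<in> polys K"
        unfolding h_def by (rule polys_monom[OF R lc])
      have f': "f - g * h \<in> polys K"
        using less.prems h g by (simp add: polys_closed[OF R])
      have c: "coeff (f - g * h) (degree f) = 0"
        using False g by (simp add: h_def mult.commute[of g] coeff_monom_mult)
      have "degree (g * h) = degree f"
        using False g by (simp add: h_def degree_mult_eq degree_monom_eq)
      hence d: "degree (f - g * h) \<le> degree f"
        by (metis degree_diff_le order_refl)
      show ?thesis
      proof (cases "f - g * h = 0")
        case True
        thus ?thesis using h polys_0[OF R] by (intro bexI[of _ h] bexI[of _ 0]) auto
      next
        case False
        hence "degree (f - g * h) < degree f"
          using c d by (metis le_neq_implies_less leading_coeff_0_iff)
        from less.hyps[OF this f'] obtain q r where
          "q \<in> polys K" "r \<in> polys K" "f - g * h = g * q + r" "r = 0 \<or> degree r < degree g"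
          by blast
        thus ?thesis using h
          by (intro bexI[of _ "q + h"] bexI[of _ r]) (auto simp: algebra_simps polys_add[OF R])
      qed
    qed
  qed
  thus ?thesis using that by blast
qed

lemma polys_principal_ideal:
  assumes K: "subfield_set K" and J: "J \<subseteq> polys K" and f: "f \<in> J" "f \<noteq> 0"
    and diff: "\<And>p q. p \<in> J \<Longrightarrow> q \<in> J \<Longrightarrow> p - q \<in> J"
    and mult: "\<And>p q. p \<in> J \<Longrightarrow> q \<in> polys K \<Longrightarrow> p * q \<in> J"
  obtains d where "d \<in> J" "d \<noteq> 0" "\<And>h. h \<in> J \<Longrightarrow> \<exists>q\<in>polys K. h = d * q"
proof -
  obtain d where d: "d \<in> J \<and> d \<noteq> 0" "\<And>e. degree e < degree d \<Longrightarrow> \<not> (e \<in> J \<and> e \<noteq> 0)"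
    using exists_least_iff[of "\<lambda>n. \<exists>d. (d \<in> J \<and> d \<noteq> 0) \<and> degree d = n"] f by blast
  show ?thesis
  proof
    fix h assume h: "h \<in> J"
    obtain q r where qr: "q \<in> polys K" "r \<in> polys K" "h = d * q + r" "r = 0 \<or> degree r < degree d"
      using polys_division[OF K, of d h] d(1) h J by blast
    have "r \<in> J" using diff[OF h mult[OF _ qr(1)], of d] d(1) qr(3) by simp
    hence "r = 0" using d(2) qr(4) by blast
    thus "\<exists>q\<in>polys K. h = d * q" using qr by auto
  qed (use d in auto)
qed

text \<open>\<open>\<mu>\<close> is a generator of the vanishing ideal of \<open>x\<close> in K[X],
  not normalized to be monic; divisibility is the only property used later.\<close>

lemma minimal_polynomial_exists:
  assumes K: "subfield_set K" and f: "f \<in> polys K" "f \<noteq> 0" "poly f x = 0"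
  obtains \<mu> where "\<mu> \<in> polys K" "\<mu> \<noteq> 0" "poly \<mu> x = 0"
    "\<And>h. h \<in> polys K \<Longrightarrow> poly h x = 0 \<Longrightarrow> \<exists>q\<in>polys K. h = \<mu> * q"
proof -
  note R = subfield_subring[OF K]
  obtain d where "d \<in> {p \<in> polys K. poly p x = 0}" "d \<noteq> 0"
    "\<And>h. h \<in> {p \<in> polys K. poly p x = 0} \<Longrightarrow> \<exists>q\<in>polys K. h = d * q"
    using polys_principal_ideal[OF K, of "{p \<in> polys K. poly p x = 0}" f] f
      polys_diff[OF R] polys_mult[OF R] by auto
  thus ?thesis using that[of d] by auto
qed

text \<open>Bezout argument for a nonzero \<open>u = poly p x\<close>. Let \<open>d\<close> generate
  the ideal of \<open>p\<close> and \<open>\<mu>\<close>, and write \<open>\<mu> = d * e\<close>. As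
  \<open>d\<close> divides \<open>p\<close>, it does not vanish at \<open>x\<close>, so
  \<open>e\<close> does, and \<open>\<mu>\<close> divides \<open>e\<close>. Degrees force
  \<open>d\<close> to be constant, and evaluating \<open>d = a * p + b * \<mu>\<close> at
  \<open>x\<close> exhibits the inverse of \<open>u\<close>.\<close>

lemma subfield_adjoin:
  assumes K: "subfield_set K" and f: "f \<in> polys K" "f \<noteq> 0" "poly f x = 0"
  shows "subfield_set (adjoin K x)"
proof -
  note R = subfield_subring[OF K]
  obtain \<mu> where \<mu>: "\<mu> \<in> polys K" "\<mu> \<noteq> 0" "poly \<mu> x = 0"
    "\<And>h. h \<in> polys K \<Longrightarrow> poly h x = 0 \<Longrightarrow> \<exists>q\<in>polys K. h = \<mu> * q"
    using minimal_polynomial_exists[OF K f] by blast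
  have "inverse u \<in> adjoin K x" if u: "u \<in> adjoin K x" "u \<noteq> 0" for u
  proof -
    obtain p where p: "p \<in> polys K" "u = poly p x" using u by (auto simp: adjoin_def)
    define J where "J = {a * p + b * \<mu> |a b. a \<in> polys K \<and> b \<in> polys K}"
    have "\<mu> = 0 * p + 1 * \<mu>" by simp
    hence "\<mu> \<in> J" unfolding J_def using polys_0[OF R] polys_1[OF R] by blast
    moreover have "J \<subseteq> polys K"
      unfolding J_def using p \<mu> by (auto simp: polys_closed[OF R])
    moreover have "r - s \<in> J" if rs: "r \<in> J" "s \<in> J" for r s
    proof -
      obtain a b a' b' where "a \<in> polys K" "b \<in> polys K" "a' \<in> polys K" "b' \<in> polys K"
        "r = a * p + b * \<mu>" "s = a' * p + b' * \<mu>" using rs unfolding J_def by blast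
      moreover from this have "r - s = (a - a') * p + (b - b') * \<mu>" by (simp add: algebra_simps)
      ultimately show ?thesis unfolding J_def using polys_diff[OF R] by blast
    qed
    moreover have "r * s \<in> J" if rs: "r \<in> J" "s \<in> polys K" for r s
    proof -
      obtain a b where "a \<in> polys K" "b \<in> polys K" "r = a * p + b * \<mu>"
        using rs by (auto simp: J_def)
      moreover from this have "r * s = (a * s) * p + (b * s) * \<mu>" by (simp add: algebra_simps)
      ultimately show ?thesis unfolding J_def using polys_mult[OF R] rs by blast
    qed
    ultimately obtain d where d: "d \<in> J" "d \<noteq> 0" "\<And>h. h \<in> J \<Longrightarrow> \<exists>q\<in>polys K. h = d * q"
      using polys_principal_ideal[OF K, of J \<mu>] \<mu>(2) by blast
    obtain a b where ab: "a \<in> polys K" "d = a * p + b * \<mu>" using d(1) by (auto simp: J_def)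
    have "p = 1 * p + 0 * \<mu>" by simp
    hence "p \<in> J" unfolding J_def using polys_0[OF R] polys_1[OF R] by blast
    then obtain q where "p = d * q" using d(3) by blast
    hence dx: "poly d x \<noteq> 0" using u p by auto
    obtain e where e: "e \<in> polys K" "\<mu> = d * e" using d(3) \<open>\<mu> \<in> J\<close> by blast
    hence "poly e x = 0" using dx \<mu>(3) by simp
    then obtain e' where e': "e = \<mu> * e'" using \<mu>(4) e(1) by blast
    have "e \<noteq> 0" using e(2) \<mu>(2) by auto
    hence "e' \<noteq> 0" using e' by auto
    have "degree \<mu> = degree d + degree e"
      unfolding e(2) by (rule degree_mult_eq[OF d(2) \<open>e \<noteq> 0\<close>])
    moreover have "degree e = degree \<mu> + degree e'"
      unfolding e' by (rule degree_mult_eq[OF \<mu>(2) \<open>e' \<noteq> 0\<close>])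
    ultimately have "degree d = 0" by linarith
    then obtain c where c: "d = [:c:]" by (elim degree_eq_zeroE)
    have "c \<in> K" using d(1) \<open>J \<subseteq> polys K\<close> c polys_pCons_iff[OF R] by blast
    have "c \<noteq> 0" using d(2) c by auto
    have "c = poly a x * u" using arg_cong[OF ab(2), of "\<lambda>r. poly r x"] c \<mu>(3) p by simp
    hence "inverse u = poly (smult (inverse c) a) x"
      using \<open>c \<noteq> 0\<close> u(2) by (simp add: field_simps)
    thus ?thesis
      unfolding adjoin_def
      using polys_smult[OF R subfield_inverse[OF K \<open>c \<in> K\<close>] ab(1)] by (rule image_eqI)
  qed
  moreover have "0 \<in> adjoin K x" by (rule subring_zero[OF subring_adjoin[OF R]])
  ultimately show ?thesis
    unfolding subfield_set_def using subring_adjoin[OF R] by (metis inverse_zero)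
qed

lemma subfield_adjoin_list:
  assumes K: "subfield_set K"
    and alg: "\<And>x. x \<in> set xs \<Longrightarrow> \<exists>f\<in>polys K. f \<noteq> 0 \<and> poly f x = 0"
  shows "subfield_set (adjoin_list K xs)"
  using alg
proof (induction xs)
  case (Cons x xs)
  obtain f where f: "f \<in> polys K" "f \<noteq> 0" "poly f x = 0" using Cons.prems by auto
  have "f \<in> polys (adjoin_list K xs)"
    using polys_mono[OF adjoin_list_superset[OF subfield_subring[OF K]]] f by auto
  thus ?case using Cons f by (auto intro!: subfield_adjoin)
qed (use K in auto)

section \<open>Homomorphisms on subfields and their algebraic extension\<close>

lemma hom_subfield_eq_0_iff:
  assumes K: "subfield_set K" and \<phi>: "hom_on K \<phi>" and x: "x \<in> K"
  shows "\<phi> x = 0 \<longleftrightarrow> x = 0"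
proof
  note R = subfield_subring[OF K]
  assume "\<phi> x = 0"
  show "x = 0"
  proof (rule ccontr)
    assume "x \<noteq> 0"
    hence "\<phi> 1 = \<phi> x * \<phi> (inverse x)"
      using hom_mult[OF R \<phi> x subfield_inverse[OF K x]] by simp
    thus False using \<open>\<phi> x = 0\<close> hom_one[OF R \<phi>] by simp
  qed
qed (use hom_zero[OF subfield_subring[OF K] \<phi>] in simp)

lemma hom_subfield_inverse:
  assumes K: "subfield_set K" and \<phi>: "hom_on K \<phi>" and x: "x \<in> K"
  shows "\<phi> (inverse x) = inverse (\<phi> x)"
proof (cases "x = 0")
  case False
  note R = subfield_subring[OF K]
  have "\<phi> x * \<phi> (inverse x) = 1"
    using hom_mult[OF R \<phi> x subfield_inverse[OF K x]] False hom_one[OF R \<phi>] by simp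
  thus ?thesis by (metis inverse_unique)
qed (use hom_zero[OF subfield_subring[OF K] \<phi>] in simp)

lemma hom_subfield_divide:
  assumes K: "subfield_set K" and \<phi>: "hom_on K \<phi>" and "x \<in> K" "y \<in> K"
  shows "\<phi> (x / y) = \<phi> x / \<phi> y"
  using assms hom_mult[OF subfield_subring[OF K] \<phi> _ subfield_inverse[OF K]]
  by (simp add: divide_inverse hom_subfield_inverse[OF K])

lemma hom_subfield_inj_on:
  assumes K: "subfield_set K" and \<phi>: "hom_on K \<phi>"
  shows "inj_on \<phi> K"
proof (rule inj_onI)
  fix x y assume "x \<in> K" "y \<in> K" "\<phi> x = \<phi> y"
  thus "x = y"
    using hom_subfield_eq_0_iff[OF K \<phi>, of "x - y"] hom_diff[OF subfield_subring[OF K] \<phi>, of x y]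
      subring_diff[OF subfield_subring[OF K]] by simp
qed

lemma subfield_image:
  assumes K: "subfield_set K" and \<phi>: "hom_on K \<phi>"
  shows "subfield_set (\<phi> ` K)"
  unfolding subfield_set_def
proof (intro conjI ballI)
  show "subring_set (\<phi> ` K)" by (rule subring_image[OF subfield_subring[OF K] \<phi>])
  fix u assume "u \<in> \<phi> ` K"
  then obtain x where "x \<in> K" "u = \<phi> x" by auto
  thus "inverse u \<in> \<phi> ` K"
    using hom_subfield_inverse[OF K \<phi>] subfield_inverse[OF K] by (metis imageI)
qed

text \<open>Successive pseudo-division, from the top and from the bottom, replaces the resultant of \<open>f\<close>
  and \<open>g\<close>: it would be a nonzero constant modulo \<open>\<phi>\<close> that vanishes.\<close>

lemma no_common_root_of_unit_reduction:
  fixes R :: "'a::field set"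
  assumes R: "subring_set R" and \<phi>: "hom_on R \<phi>"
  shows "\<lbrakk>f \<in> polys R; g \<in> polys R; \<phi> (lead_coeff f) \<noteq> 0; map_poly \<phi> g = [:c:]; c \<noteq> 0;
    poly f x = 0; poly g x = 0\<rbrakk> \<Longrightarrow> False"
proof (induction "degree f + degree g" arbitrary: f g c rule: less_induct)
  case less
  have f: "coeff f i \<in> R" and g: "coeff g i \<in> R" for i
    using less.prems by (auto simp: polys_def)
  have \<phi>g: "\<phi> (coeff g i) = coeff [:c:] i" for i
    using less.prems(4) hom_coeff_map_poly[OF R \<phi>, of g i] by simp
  have "f \<noteq> 0" using less.prems(3) hom_zero[OF R \<phi>] by auto
  have df: "degree f > 0"
  proof (rule ccontr)
    assume "\<not> degree f > 0"
    then obtain a where "f = [:a:]" by (metis degree_eq_zeroE neq0_conv)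
    thus False using less.prems(6) \<open>f \<noteq> 0\<close> by auto
  qed
  show False
  proof (cases "degree f \<le> degree g")
    case True
    define n where "n = degree g - degree f"
    define h where "h = smult (lead_coeff f) g - monom (lead_coeff g) n * f"
    have h: "h \<in> polys R"
      unfolding h_def using less.prems f g by (simp add: polys_closed[OF R])
    have lg: "\<phi> (lead_coeff g) = 0" using \<phi>g df True by (auto simp: coeff_pCons split: nat.splits)
    \<comment> \<open>Since \<open>degree g \<ge> degree f > 0\<close>, the leading coefficient of
      \<open>g\<close> is not its constant term and reduces to 0. Hence the subtraction only
      rescales the constant reduction of \<open>g\<close>.\<close>
    have "map_poly \<phi> (monom (lead_coeff g) n) = 0"
      using lg by (simp add: map_poly_monom hom_zero[OF R \<phi>])
    hence "map_poly \<phi> h = smult (\<phi> (lead_coeff f)) [:c:]"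
      unfolding h_def using less.prems f g
      by (simp add: hom_map_poly_diff[OF R \<phi>] hom_map_poly_smult[OF R \<phi>] hom_map_poly_mult[OF R \<phi>]
          polys_closed[OF R])
    moreover have "coeff h (degree g) = 0"
      unfolding h_def n_def using True by (simp add: coeff_monom_mult)
    moreover have "degree h \<le> degree g"
      unfolding h_def
    proof (rule degree_diff_le)
      show "degree (monom (lead_coeff g) n * f) \<le> degree g"
        by (rule order_trans[OF degree_mult_le]) (use degree_monom_le[of "lead_coeff g" n] True in \<open>auto simp: n_def\<close>)
    qed simp
    ultimately have "degree h < degree g"
      using df True eq_zero_or_degree_less[of h "degree g"] by auto
    moreover have "poly h x = 0" unfolding h_def using less.prems by simp
    ultimately show False
      using less.hyps[of f h "\<phi> (lead_coeff f) * c"] \<open>map_poly \<phi> h = _\<close> less.prems h by simp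
  next
    case False
    have g0: "\<phi> (coeff g 0) = c" using \<phi>g[of 0] by simp
    hence "coeff g 0 \<noteq> 0" using less.prems(5) hom_zero[OF R \<phi>] by auto
    \<comment> \<open>This allows division by the variable once the constant term is cancelled: the
      quotient \<open>f'\<close> still vanishes at \<open>x\<close>, and its leading coefficient
      \<open>coeff g 0 * lead_coeff f\<close> still reduces to a nonzero value.\<close>
    hence "x \<noteq> 0" using less.prems(7) by (auto simp: poly_0_coeff_0)
    define h where "h = smult (coeff g 0) f - smult (coeff f 0) g"
    have h: "h \<in> polys R"
      unfolding h_def using less.prems f g by (simp add: polys_closed[OF R])
    have "coeff h 0 = 0" by (simp add: h_def)
    then obtain f' where f': "h = pCons 0 f'" by (cases h) auto
    have lh: "coeff h (degree f) = coeff g 0 * lead_coeff f"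
      using False by (simp add: h_def coeff_eq_0)
    have "degree h \<le> degree f"
      unfolding h_def using False by (intro degree_diff_le) auto
    hence dh: "degree h = degree f"
      using lh \<open>coeff g 0 \<noteq> 0\<close> \<open>f \<noteq> 0\<close> by (intro antisym[OF _ le_degree]) auto
    have "f' \<noteq> 0" using f' dh df by auto
    have "lead_coeff f' = lead_coeff h" using f' \<open>f' \<noteq> 0\<close> by simp
    hence "lead_coeff f' = coeff g 0 * lead_coeff f" using lh dh by simp
    hence "\<phi> (lead_coeff f') \<noteq> 0"
      using hom_mult[OF R \<phi> g f] g0 less.prems by simp
    moreover have "f' \<in> polys R" using h f' polys_pCons_iff[OF R] by simp
    moreover have "poly h x = 0" unfolding h_def using less.prems by simp
    hence "poly f' x = 0" using f' \<open>x \<noteq> 0\<close> by simp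
    moreover have "degree f' < degree f" using dh f' \<open>f' \<noteq> 0\<close> by simp
    ultimately show False using less.hyps[of f' g c] less.prems by simp
  qed
qed

text \<open>Extension of a place to one element integral at it. The reductions of all relations of
  \<open>x\<close> form an ideal over the residue field, which is principal. Its generator is not
  constant, since a relation with nonzero constant reduction is incompatible with \<open>f\<close>,
  whose leading coefficient survives reduction. Any root of the generator is an admissible
  value.\<close>

lemma exists_compatible_value:
  fixes R :: "'a::alg_closed_field set"
  assumes R: "subring_set R" and \<phi>: "hom_on R \<phi>" and \<kappa>: "subfield_set (\<phi> ` R)"
    and f: "f \<in> polys R" "\<phi> (lead_coeff f) \<noteq> 0" "poly f x = 0"
  obtains y where "\<And>p. p \<in> polys R \<Longrightarrow> poly p x = 0 \<Longrightarrow> poly (map_poly \<phi> p) y = 0"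
proof -
  define J where "J = map_poly \<phi> ` {p \<in> polys R. poly p x = 0}"
  have "coeff (map_poly \<phi> f) (degree f) \<noteq> 0"
    using f(2) by (simp add: hom_coeff_map_poly[OF R \<phi>])
  hence f0: "map_poly \<phi> f \<noteq> 0" by auto
  have fJ: "map_poly \<phi> f \<in> J" unfolding J_def using f by auto
  have "J \<subseteq> polys (\<phi> ` R)" unfolding J_def using map_poly_image[OF R \<phi>] by auto
  moreover have "p - q \<in> J" if pq: "p \<in> J" "q \<in> J" for p q
  proof -
    obtain p' q' where "p' \<in> polys R" "q' \<in> polys R" "poly p' x = 0" "poly q' x = 0"
      "p = map_poly \<phi> p'" "q = map_poly \<phi> q'" using pq by (auto simp: J_def)
    thus ?thesis unfolding J_def
      by (intro image_eqI[of _ _ "p' - q'"]) (auto simp: hom_map_poly_diff[OF R \<phi>] polys_diff[OF R])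
  qed
  moreover have "p * q \<in> J" if pq: "p \<in> J" "q \<in> polys (\<phi> ` R)" for p q
  proof -
    obtain p' where "p' \<in> polys R" "poly p' x = 0" "p = map_poly \<phi> p'" using pq by (auto simp: J_def)
    moreover obtain q' where "q' \<in> polys R" "map_poly \<phi> q' = q"
      using polys_lift_image[OF R \<phi> pq(2)] by blast
    ultimately show ?thesis unfolding J_def
      by (intro image_eqI[of _ _ "p' * q'"]) (auto simp: hom_map_poly_mult[OF R \<phi>] polys_mult[OF R])
  qed
  ultimately obtain d where d: "d \<in> J" "d \<noteq> 0" "\<And>h. h \<in> J \<Longrightarrow> \<exists>q\<in>polys (\<phi> ` R). h = d * q"
    using polys_principal_ideal[OF \<kappa> _ fJ f0] by blast
  have "degree d > 0"
  proof (rule ccontr)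
    assume "\<not> degree d > 0"
    then obtain c where c: "d = [:c:]" by (metis degree_eq_zeroE neq0_conv)
    obtain g where "g \<in> polys R" "poly g x = 0" "map_poly \<phi> g = [:c:]" using d(1) c by (auto simp: J_def)
    thus False using no_common_root_of_unit_reduction[OF R \<phi> f(1) _ f(2)] f(3) c d(2) by auto
  qed
  then obtain y where "poly d y = 0" using alg_closed_imp_poly_has_root by blast
  show ?thesis
  proof
    fix p assume "p \<in> polys R" "poly p x = 0"
    hence "map_poly \<phi> p \<in> J" by (auto simp: J_def)
    then obtain q where "map_poly \<phi> p = d * q" using d(3) by blast
    thus "poly (map_poly \<phi> p) y = 0" using \<open>poly d y = 0\<close> by simp
  qed
qed

lemma hom_image_adjoin:
  assumes R: "subring_set R" and \<psi>: "hom_on (adjoin R x) \<psi>"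
  shows "\<psi> ` adjoin R x = adjoin (\<psi> ` R) (\<psi> x)"
proof -
  note S = subring_adjoin[OF R, of x]
  note \<psi>R = hom_on_subset[OF \<psi> adjoin_superset[OF R]]
  have *: "\<psi> (poly p x) = poly (map_poly \<psi> p) (\<psi> x)" if "p \<in> polys R" for p
    using hom_poly[OF S \<psi> _ adjoin_self[OF R]] polys_mono[OF adjoin_superset[OF R]] that by blast
  show ?thesis
  proof
    show "\<psi> ` adjoin R x \<subseteq> adjoin (\<psi> ` R) (\<psi> x)"
      using * map_poly_image[OF R \<psi>R] by (auto simp: adjoin_def)
    show "adjoin (\<psi> ` R) (\<psi> x) \<subseteq> \<psi> ` adjoin R x"
    proof
      fix u assume "u \<in> adjoin (\<psi> ` R) (\<psi> x)"
      then obtain q where q: "q \<in> polys (\<psi> ` R)" "u = poly q (\<psi> x)" by (auto simp: adjoin_def)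
      then obtain p where "p \<in> polys R" "map_poly \<psi> p = q" using polys_lift_image[OF R \<psi>R] by blast
      thus "u \<in> \<psi> ` adjoin R x" using * q by (auto simp: adjoin_def intro!: image_eqI[of _ _ "poly p x"])
    qed
  qed
qed

text \<open>That the image stays a field is part of the conclusion because the next extension step
  needs it; it holds since each new value is a root of the reduction of \<open>f\<close> and so
  algebraic over the previous image.\<close>

lemma hom_extend_adjoin_list:
  fixes R :: "'a::alg_closed_field set"
  assumes R: "subring_set R" and \<phi>: "hom_on R \<phi>" and \<kappa>: "subfield_set (\<phi> ` R)"
    and alg: "\<And>x. x \<in> set xs \<Longrightarrow> \<exists>f\<in>polys R. \<phi> (lead_coeff f) \<noteq> 0 \<and> poly f x = 0"
  shows "\<exists>\<psi>. hom_on (adjoin_list R xs) \<psi> \<and> (\<forall>c\<in>R. \<psi> c = \<phi> c) \<and> subfield_set (\<psi> ` adjoin_list R xs)"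
  using alg
proof (induction xs)
  case Nil
  thus ?case using \<phi> \<kappa> by auto
next
  case (Cons x xs)
  define S where "S = adjoin_list R xs"
  have S: "subring_set S" and RS: "R \<subseteq> S"
    unfolding S_def using subring_adjoin_list[OF R] adjoin_list_superset[OF R] by auto
  obtain \<psi> where \<psi>: "hom_on S \<psi>" "\<And>c. c \<in> R \<Longrightarrow> \<psi> c = \<phi> c" "subfield_set (\<psi> ` S)"
    using Cons unfolding S_def by auto
  obtain f where f: "f \<in> polys R" "\<phi> (lead_coeff f) \<noteq> 0" "poly f x = 0" using Cons.prems by auto
  have f': "f \<in> polys S" using f polys_mono[OF RS] by auto
  have lf: "\<psi> (lead_coeff f) \<noteq> 0" using f \<psi>(2) by (auto simp: polys_def)
  obtain y where y: "\<And>p. p \<in> polys S \<Longrightarrow> poly p x = 0 \<Longrightarrow> poly (map_poly \<psi> p) y = 0"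
    using exists_compatible_value[OF S \<psi>(1,3) f' lf f(3)] by blast
  obtain \<chi> where \<chi>: "hom_on (adjoin S x) \<chi>" "\<And>c. c \<in> S \<Longrightarrow> \<chi> c = \<psi> c" "\<chi> x = y"
    using hom_extend_adjoin[OF S \<psi>(1) y] by blast
  have "coeff (map_poly \<psi> f) (degree f) \<noteq> 0"
    using lf by (simp add: hom_coeff_map_poly[OF S \<psi>(1)])
  hence "subfield_set (adjoin (\<psi> ` S) y)"
    using y[OF f' f(3)] map_poly_image[OF S \<psi>(1) f']
    by (intro subfield_adjoin[OF \<psi>(3), of "map_poly \<psi> f"]) auto
  moreover have "\<chi> ` S = \<psi> ` S" using \<chi>(2) by auto
  ultimately have "subfield_set (\<chi> ` adjoin S x)"
    using hom_image_adjoin[OF S \<chi>(1)] \<chi>(3) by simp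
  thus ?case using \<chi>(1,2) \<psi>(2) RS by (intro exI[of _ \<chi>]) (auto simp flip: S_def)
qed

text \<open>A homomorphism on a field is injective, so every nonzero leading coefficient survives
  and the extension of places applies.\<close>

lemma hom_extend_algebraic:
  fixes K :: "'a::alg_closed_field set"
  assumes K: "subfield_set K" and \<phi>: "hom_on K \<phi>"
    and alg: "\<And>x. x \<in> set xs \<Longrightarrow> \<exists>f\<in>polys K. f \<noteq> 0 \<and> poly f x = 0"
  shows "\<exists>\<psi>. hom_on (adjoin_list K xs) \<psi> \<and> (\<forall>c\<in>K. \<psi> c = \<phi> c)"
proof -
  have "\<exists>f\<in>polys K. \<phi> (lead_coeff f) \<noteq> 0 \<and> poly f x = 0" if "x \<in> set xs" for x
  proof -
    obtain f where "f \<in> polys K" "f \<noteq> 0" "poly f x = 0" using alg[OF \<open>x \<in> set xs\<close>] by auto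
    thus ?thesis
      using hom_subfield_eq_0_iff[OF K \<phi>, of "lead_coeff f"] by (intro bexI[of _ f]) (auto simp: polys_def)
  qed
  thus ?thesis
    using hom_extend_adjoin_list[OF subfield_subring[OF K] \<phi> subfield_image[OF K \<phi>]] by blast
qed

section \<open>Fraction fields inside the ambient field\<close>

definition fractions :: "'a::field set \<Rightarrow> 'a set" where
  "fractions R = {x / y |x y. x \<in> R \<and> y \<in> R \<and> y \<noteq> 0}"

lemma fractions_superset: "subring_set R \<Longrightarrow> R \<subseteq> fractions R"
  unfolding fractions_def using subring_one by force

lemma subfield_fractions:
  assumes R: "subring_set R"
  shows "subfield_set (fractions R)"
  unfolding subfield_set_def subring_set_def
proof (intro conjI ballI)
  show "1 \<in> fractions R" using fractions_superset[OF R] subring_one[OF R] by auto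
next
  fix u v assume "u \<in> fractions R" "v \<in> fractions R"
  then obtain x y x' y' where xy: "x \<in> R" "y \<in> R" "y \<noteq> 0" "u = x / y" "x' \<in> R" "y' \<in> R" "y' \<noteq> 0" "v = x' / y'"
    by (auto simp: fractions_def)
  have "u - v = (x * y' - x' * y) / (y * y')" using xy(3,7) unfolding xy(4,8) by (simp add: diff_frac_eq)
  moreover have "x * y' - x' * y \<in> R" "y * y' \<in> R" "y * y' \<noteq> 0" using xy by (auto simp: subring_closed[OF R])
  ultimately show "u - v \<in> fractions R" unfolding fractions_def by blast
  have "u * v = (x * x') / (y * y')" using xy by simp
  moreover have "x * x' \<in> R" "y * y' \<in> R" "y * y' \<noteq> 0" using xy by (auto simp: subring_closed[OF R])
  ultimately show "u * v \<in> fractions R" unfolding fractions_def by blast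
next
  fix u assume "u \<in> fractions R"
  then obtain x y where xy: "x \<in> R" "y \<in> R" "y \<noteq> 0" "u = x / y" by (auto simp: fractions_def)
  show "inverse u \<in> fractions R"
  proof (cases "x = 0")
    case True
    thus ?thesis using xy fractions_superset[OF R] by auto
  next
    case False
    moreover have "inverse u = y / x" using xy by simp
    ultimately show ?thesis unfolding fractions_def using xy by blast
  qed
qed

lemma fractions_least: "subfield_set K \<Longrightarrow> R \<subseteq> K \<Longrightarrow> fractions R \<subseteq> K"
  by (auto simp: fractions_def intro!: subfield_divide)

lemma hom_extend_fractions:
  assumes R: "subring_set R" and \<phi>: "hom_on R \<phi>" and inj: "\<And>x. x \<in> R \<Longrightarrow> \<phi> x = 0 \<Longrightarrow> x = 0"
  obtains \<psi> where "hom_on (fractions R) \<psi>" "\<And>x. x \<in> R \<Longrightarrow> \<psi> x = \<phi> x"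
proof -
  define \<psi> where "\<psi> u = (let z = (SOME z. fst z \<in> R \<and> snd z \<in> R \<and> snd z \<noteq> 0 \<and> u = fst z / snd z)
    in \<phi> (fst z) / \<phi> (snd z))" for u
  have \<psi>: "\<psi> (x / y) = \<phi> x / \<phi> y" if xy: "x \<in> R" "y \<in> R" "y \<noteq> 0" for x y
  proof -
    define z where "z = (SOME z. fst z \<in> R \<and> snd z \<in> R \<and> snd z \<noteq> 0 \<and> x / y = fst z / snd z)"
    have z: "fst z \<in> R \<and> snd z \<in> R \<and> snd z \<noteq> 0 \<and> x / y = fst z / snd z"
      unfolding z_def by (rule someI[of _ "(x, y)"]) (use xy in auto)
    hence "x * snd z = fst z * y" using xy by (simp add: field_simps)
    hence "\<phi> x * \<phi> (snd z) = \<phi> (fst z) * \<phi> y" using xy z by (metis hom_mult[OF R \<phi>])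
    moreover have "\<phi> y \<noteq> 0" "\<phi> (snd z) \<noteq> 0" using inj xy z by auto
    ultimately show ?thesis by (simp add: \<psi>_def Let_def field_simps flip: z_def)
  qed
  show ?thesis
  proof
    show "hom_on (fractions R) \<psi>"
      unfolding hom_on_def
    proof (intro conjI ballI)
      show "\<psi> 1 = 1" using \<psi>[of 1 1] subring_one[OF R] hom_one[OF R \<phi>] by simp
    next
      fix u v assume "u \<in> fractions R" "v \<in> fractions R"
      then obtain x y x' y' where xy: "x \<in> R" "y \<in> R" "y \<noteq> 0" "u = x / y" "x' \<in> R" "y' \<in> R" "y' \<noteq> 0" "v = x' / y'"
        by (auto simp: fractions_def)
      have nz: "\<phi> y \<noteq> 0" "\<phi> y' \<noteq> 0" using inj xy by auto
      have "u + v = (x * y' + x' * y) / (y * y')" using xy(3,7) unfolding xy(4,8) by (simp add: add_frac_eq)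
      hence "\<psi> (u + v) = \<psi> ((x * y' + x' * y) / (y * y'))" by simp
      also have "\<dots> = \<phi> (x * y' + x' * y) / \<phi> (y * y')"
        using xy by (intro \<psi>) (auto simp: subring_closed[OF R])
      also have "\<dots> = \<psi> u + \<psi> v"
        using xy(1,2,3,5,6,7) nz unfolding xy(4,8)
        by (simp add: hom_simps[OF R \<phi>] subring_closed[OF R] \<psi> add_frac_eq)
      finally show "\<psi> (u + v) = \<psi> u + \<psi> v" .
      have "\<psi> (u * v) = \<psi> ((x * x') / (y * y'))" using xy by simp
      also have "\<dots> = \<phi> (x * x') / \<phi> (y * y')"
        using xy by (intro \<psi>) (auto simp: subring_closed[OF R])
      also have "\<dots> = \<psi> u * \<psi> v"
        using xy by (simp add: hom_simps[OF R \<phi>] \<psi>)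
      finally show "\<psi> (u * v) = \<psi> u * \<psi> v" .
    qed
    show "\<psi> x = \<phi> x" if "x \<in> R" for x
      using \<psi>[of x 1] that subring_one[OF R] hom_one[OF R \<phi>] by simp
  qed
qed

subsection \<open>Automorphisms of splitting fields\<close>

text \<open>Only roots in the type itself are tested, which is separability in the usual sense over
  an algebraically closed type.\<close>

definition separable_poly :: "'a::field poly \<Rightarrow> bool" where
  "separable_poly p \<longleftrightarrow> p \<noteq> 0 \<and> (\<forall>x. poly p x = 0 \<longrightarrow> poly (pderiv p) x \<noteq> 0)"

lemma separable_poly_dvd:
  assumes "separable_poly p" "q dvd p"
  shows "separable_poly q"
proof -
  obtain r where r: "p = q * r" using assms(2) by auto
  show ?thesis
    using assms(1) unfolding r separable_poly_def by (auto simp: pderiv_mult)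
qed

text \<open>Roots are split off one at a time. If \<open>p = [:- a, 1:] * q\<close>, then the
  derivative of \<open>p\<close> at \<open>a\<close> equals \<open>poly q a\<close>, so
  \<open>a\<close> is not a root of \<open>q\<close> and the root sets add up without
  overlap.\<close>

lemma separable_poly_split:
  fixes p :: "'a::alg_closed_field poly"
  assumes "separable_poly p"
  shows "card {x. poly p x = 0} = degree p \<and>
    p = smult (lead_coeff p) (\<Prod>x\<in>{x. poly p x = 0}. [:- x, 1:])"
  using assms
proof (induction "degree p" arbitrary: p rule: less_induct)
  case less
  have "p \<noteq> 0" using less.prems by (simp add: separable_poly_def)
  show ?case
  proof (cases "degree p = 0")
    case True
    then obtain c where "p = [:c:]" by (elim degree_eq_zeroE)
    thus ?thesis using \<open>p \<noteq> 0\<close> by auto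
  next
    case False
    then obtain a where a: "poly p a = 0" using alg_closed_imp_poly_has_root by blast
    then obtain q where q: "p = [:- a, 1:] * q" using poly_eq_0_iff_dvd[of p a] by auto
    have "q \<noteq> 0" using q \<open>p \<noteq> 0\<close> by auto
    have qs: "separable_poly q" by (rule separable_poly_dvd[OF less.prems]) (unfold q, rule dvd_triv_right)
    have "poly (pderiv p) a = poly q a"
      by (simp only: q pderiv_mult) (simp add: pderiv_pCons)
    hence qa: "poly q a \<noteq> 0"
      using less.prems a by (auto simp: separable_poly_def)
    have deg: "degree p = Suc (degree q)"
      unfolding q using \<open>q \<noteq> 0\<close> by (subst degree_mult_eq) auto
    have fin: "finite {x. poly q x = 0}" using \<open>q \<noteq> 0\<close> by (rule poly_roots_finite)
    have roots: "{x. poly p x = 0} = insert a {x. poly q x = 0}" unfolding q by auto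
    have lc: "lead_coeff p = lead_coeff q" unfolding q lead_coeff_mult by simp
    from less.hyps[OF _ qs] deg have IH: "card {x. poly q x = 0} = degree q"
      "q = smult (lead_coeff q) (\<Prod>x\<in>{x. poly q x = 0}. [:- x, 1:])" by auto
    have "p = [:- a, 1:] * smult (lead_coeff q) (\<Prod>x\<in>{x. poly q x = 0}. [:- x, 1:])"
      using q IH(2) by simp
    also have "\<dots> = smult (lead_coeff p) (\<Prod>x\<in>{x. poly p x = 0}. [:- x, 1:])"
      unfolding roots lc using fin qa by simp
    finally show ?thesis
      unfolding roots using fin qa IH(1) deg by (auto simp: card_insert_if)
  qed
qed

text \<open>Injectivity is omitted, being automatic on a field. Extensionality makes equality of
  functions mean equality on \<open>L\<close>, as in \<open>Bij\<close>.\<close>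

definition gal :: "'a::comm_ring_1 set \<Rightarrow> 'a set \<Rightarrow> ('a \<Rightarrow> 'a) set" where
  "gal K L = {\<sigma> \<in> extensional L. hom_on L \<sigma> \<and> \<sigma> ` L = L \<and> (\<forall>x\<in>K. \<sigma> x = x)}"

lemma galD:
  assumes "\<sigma> \<in> gal K L"
  shows gal_hom: "hom_on L \<sigma>" and gal_image: "\<sigma> ` L = L" and gal_fix: "x \<in> K \<Longrightarrow> \<sigma> x = x"
    and gal_mem: "y \<in> L \<Longrightarrow> \<sigma> y \<in> L" and gal_ext: "\<sigma> \<in> extensional L"
  using assms by (auto simp: gal_def)

lemma gal_compose:
  assumes L: "subring_set L" and "K \<subseteq> L" and s: "\<sigma> \<in> gal K L" "\<tau> \<in> gal K L"
  shows "compose L \<sigma> \<tau> \<in> gal K L"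
proof -
  have "hom_on L (compose L \<sigma> \<tau>)"
    unfolding hom_on_def
    using gal_mem[OF s(2)] hom_simps[OF L gal_hom[OF s(1)]] hom_simps[OF L gal_hom[OF s(2)]]
    by (auto simp: compose_def subring_closed[OF L])
  moreover have "compose L \<sigma> \<tau> ` L = \<sigma> ` \<tau> ` L" by (auto simp: compose_def)
  moreover have "\<sigma> (\<tau> x) = x" if "x \<in> K" for x using gal_fix s that by metis
  ultimately show ?thesis
    using s \<open>K \<subseteq> L\<close> by (auto simp: gal_def compose_def)
qed

lemma gal_inverse:
  assumes L: "subfield_set L" and "K \<subseteq> L" and \<sigma>: "\<sigma> \<in> gal K L"
  obtains \<rho> where "\<rho> \<in> gal K L" "\<And>z. z \<in> L \<Longrightarrow> \<rho> (\<sigma> z) = z" "\<And>z. z \<in> L \<Longrightarrow> \<sigma> (\<rho> z) = z"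
proof
  note R = subfield_subring[OF L] and hom = gal_hom[OF \<sigma>]
  let ?\<rho> = "restrict (inv_into L \<sigma>) L"
  have inj: "inj_on \<sigma> L" by (rule hom_subfield_inj_on[OF L hom])
  show left: "?\<rho> (\<sigma> z) = z" if "z \<in> L" for z
    using that inj gal_mem[OF \<sigma>] by simp
  show right: "\<sigma> (?\<rho> z) = z" if "z \<in> L" for z
    using that gal_image[OF \<sigma>] by (simp add: f_inv_into_f)
  have preimage: "\<exists>y\<in>L. z = \<sigma> y" if "z \<in> L" for z using that gal_image[OF \<sigma>] by auto
  have "hom_on L ?\<rho>"
    unfolding hom_on_def
  proof (intro conjI ballI)
    show "?\<rho> 1 = 1" using left[OF subring_one[OF R]] hom_one[OF R hom] by simp
  next
    fix x y assume "x \<in> L" "y \<in> L"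
    then obtain u v where uv: "u \<in> L" "v \<in> L" "x = \<sigma> u" "y = \<sigma> v" using preimage by blast
    show "?\<rho> (x + y) = ?\<rho> x + ?\<rho> y"
      using left[OF subring_add[OF R uv(1,2)]] left[OF uv(1)] left[OF uv(2)] uv by (simp only: hom_add[OF R hom])
    show "?\<rho> (x * y) = ?\<rho> x * ?\<rho> y"
      using left[OF subring_mult[OF R uv(1,2)]] left[OF uv(1)] left[OF uv(2)] uv by (simp only: hom_mult[OF R hom])
  qed
  moreover have "?\<rho> ` L = L"
  proof
    show "?\<rho> ` L \<subseteq> L" using preimage left by fastforce
    show "L \<subseteq> ?\<rho> ` L" using left gal_mem[OF \<sigma>] by (metis image_eqI subsetI)
  qed
  moreover have "?\<rho> x = x" if "x \<in> K" for x
    using left[of x] gal_fix[OF \<sigma> that] that \<open>K \<subseteq> L\<close> by (metis subsetD)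
  ultimately show "?\<rho> \<in> gal K L" by (simp add: gal_def)
qed

lemma map_poly_fixed: "p \<in> polys R \<Longrightarrow> (\<And>x. x \<in> R \<Longrightarrow> \<phi> x = x) \<Longrightarrow> map_poly \<phi> p = p"
proof (rule map_poly_idI)
  fix c assume p: "p \<in> polys R" "\<And>x. x \<in> R \<Longrightarrow> \<phi> x = x" and "c \<in> set (coeffs p)"
  hence "c \<in> range (coeff p)" by (simp add: range_coeff)
  thus "\<phi> c = c" using p by (auto simp: polys_def)
qed

locale root_field =
  fixes K :: "'a::alg_closed_field set" and f :: "'a poly" and xs :: "'a list"
  assumes K: "subfield_set K" and f: "f \<in> polys K" "f \<noteq> 0" and xs: "set xs = {x. poly f x = 0}"
begin

definition L where "L = adjoin_list K xs"

lemma algebraic_sublist: "set ys \<subseteq> set xs \<Longrightarrow> x \<in> set ys \<Longrightarrow> \<exists>p\<in>polys K. p \<noteq> 0 \<and> poly p x = 0"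
  using f xs by auto

lemma subfield_L: "subfield_set L"
  unfolding L_def by (rule subfield_adjoin_list[OF K algebraic_sublist[OF subset_refl]])

lemma subring_L: "subring_set L"
  by (rule subfield_subring[OF subfield_L])

lemma K_subset_L: "K \<subseteq> L"
  unfolding L_def by (rule adjoin_list_superset[OF subfield_subring[OF K]])

lemma roots_subset_L: "{x. poly f x = 0} \<subseteq> L"
  unfolding L_def using adjoin_list_mem[OF subfield_subring[OF K]] xs by auto

lemma L_least: "subring_set S \<Longrightarrow> K \<subseteq> S \<Longrightarrow> {x. poly f x = 0} \<subseteq> S \<Longrightarrow> L \<subseteq> S"
  unfolding L_def by (rule adjoin_list_least) (auto simp: xs)

lemma hom_root:
  assumes "hom_on L \<sigma>" "\<And>c. c \<in> K \<Longrightarrow> \<sigma> c = c" "poly f x = 0"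
  shows "poly f (\<sigma> x) = 0"
proof -
  have "\<sigma> (poly f x) = poly (map_poly \<sigma> f) (\<sigma> x)"
    by (rule hom_poly[OF subring_L assms(1)]) (use polys_mono[OF K_subset_L] f(1) assms(3) roots_subset_L in auto)
  thus ?thesis
    using map_poly_fixed[OF f(1) assms(2)] assms(3) hom_zero[OF subring_L assms(1)] by simp
qed

text \<open>Normality of \<open>L\<close>: an injective map of the finite root set into itself is
  onto, and \<open>L\<close> is generated over \<open>K\<close> by the roots. Homomorphisms from
  \<open>L\<close> into the ambient field that fix \<open>K\<close> are therefore automorphisms of
  \<open>L\<close>.\<close>

lemma hom_onto:
  assumes \<sigma>: "hom_on L \<sigma>" "\<And>c. c \<in> K \<Longrightarrow> \<sigma> c = c"
  shows "\<sigma> ` L = L" and "bij_betw \<sigma> {x. poly f x = 0} {x. poly f x = 0}"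
proof -
  let ?X = "{x. poly f x = 0}"
  have fin: "finite ?X" using f(2) by (rule poly_roots_finite)
  have inj: "inj_on \<sigma> ?X"
    using hom_subfield_inj_on[OF subfield_L \<sigma>(1)] roots_subset_L by (rule inj_on_subset)
  have "\<sigma> ` ?X = ?X"
    using hom_root[OF \<sigma>] by (intro endo_inj_surj[OF fin _ inj]) auto
  thus "bij_betw \<sigma> ?X ?X" using inj by (simp add: bij_betw_def)
  have "subring_set {y \<in> L. \<sigma> y \<in> L}"
    unfolding subring_set_def
    by (auto simp: subring_closed[OF subring_L] hom_simps[OF subring_L \<sigma>(1)])
  hence "L \<subseteq> {y \<in> L. \<sigma> y \<in> L}"
    by (rule L_least) (use K_subset_L roots_subset_L \<sigma>(2) hom_root[OF \<sigma>] in auto)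
  moreover have "L \<subseteq> \<sigma> ` L"
  proof (rule L_least[OF subring_image[OF subring_L \<sigma>(1)]])
    show "K \<subseteq> \<sigma> ` L" using \<sigma>(2) K_subset_L by force
    show "?X \<subseteq> \<sigma> ` L" using \<open>\<sigma> ` ?X = ?X\<close> roots_subset_L by blast
  qed
  ultimately show "\<sigma> ` L = L" by auto
qed

lemma gal_identity: "restrict (\<lambda>x. x) L \<in> gal K L"
  using hom_on_cong[OF subring_L, of "restrict (\<lambda>x. x) L" "\<lambda>x. x"] hom_on_id K_subset_L
  by (auto simp: gal_def)

lemma gal_bij_roots: "\<sigma> \<in> gal K L \<Longrightarrow> bij_betw \<sigma> {x. poly f x = 0} {x. poly f x = 0}"
  by (rule hom_onto(2)) (auto dest: galD)

lemma gal_eqI: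
  assumes "\<sigma> \<in> gal K L" "\<tau> \<in> gal K L" "\<And>x. poly f x = 0 \<Longrightarrow> \<sigma> x = \<tau> x"
  shows "\<sigma> = \<tau>"
proof (rule extensionalityI[of _ L])
  fix y assume "y \<in> L"
  show "\<sigma> y = \<tau> y"
    by (rule hom_eq_on_adjoin_list[OF subfield_subring[OF K], of xs])
       (use assms galD[OF assms(1)] galD[OF assms(2)] \<open>y \<in> L\<close> xs in \<open>auto simp: L_def\<close>)
qed (use assms galD in auto)

text \<open>The roots are algebraic over \<open>E\<close>, so \<tau> extends to a ring containing
  \<open>L\<close>; \<open>hom_onto\<close> turns the restriction to \<open>L\<close> into an
  automorphism.\<close>

lemma gal_extend:
  assumes E: "subfield_set E" "K \<subseteq> E" "E \<subseteq> L" and \<tau>: "hom_on E \<tau>" "\<And>c. c \<in> K \<Longrightarrow> \<tau> c = c"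
  obtains \<sigma> where "\<sigma> \<in> gal K L" "\<And>c. c \<in> E \<Longrightarrow> \<sigma> c = \<tau> c"
proof -
  have "\<exists>p\<in>polys E. p \<noteq> 0 \<and> poly p x = 0" if "x \<in> set xs" for x
    using f polys_mono[OF E(2)] xs that by auto
  then obtain \<psi> where \<psi>: "hom_on (adjoin_list E xs) \<psi>" "\<And>c. c \<in> E \<Longrightarrow> \<psi> c = \<tau> c"
    using hom_extend_algebraic[OF E(1) \<tau>(1), of xs] by blast
  have "L \<subseteq> adjoin_list E xs"
    using adjoin_list_superset[OF subfield_subring[OF E(1)], of xs]
      adjoin_list_mem[OF subfield_subring[OF E(1)], of xs] E(2) xs
    by (intro L_least subring_adjoin_list subfield_subring[OF E(1)]) auto
  hence hom: "hom_on L (restrict \<psi> L)"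
    using hom_on_subset[OF \<psi>(1)] hom_on_cong[OF subring_L, of "restrict \<psi> L" \<psi>] by simp
  have fixed: "restrict \<psi> L c = c" if "c \<in> K" for c
    using that K_subset_L E(2) \<psi>(2) \<tau>(2) by auto
  have "restrict \<psi> L \<in> gal K L"
    unfolding gal_def using hom fixed hom_onto(1)[OF hom fixed] by auto
  thus ?thesis by (rule that) (use \<psi>(2) E(3) in auto)
qed

lemma finite_gal: "finite (gal K L)"
proof (rule finite_subset)
  let ?X = "{x. poly f x = 0}"
  have "finite ?X" using f(2) by (rule poly_roots_finite)
  thus "finite (the_inv_into (gal K L) (\<lambda>\<sigma>. restrict \<sigma> ?X) ` (?X \<rightarrow>\<^sub>E ?X))"
    by (intro finite_imageI finite_PiE) auto
  have inj: "inj_on (\<lambda>\<sigma>. restrict \<sigma> ?X) (gal K L)"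
  proof (rule inj_onI)
    fix \<sigma> \<tau> assume *: "\<sigma> \<in> gal K L" "\<tau> \<in> gal K L" "restrict \<sigma> ?X = restrict \<tau> ?X"
    have "\<sigma> x = \<tau> x" if "poly f x = 0" for x
      using fun_cong[OF *(3), of x] that by simp
    thus "\<sigma> = \<tau>" by (rule gal_eqI[OF *(1,2)])
  qed
  show "gal K L \<subseteq> the_inv_into (gal K L) (\<lambda>\<sigma>. restrict \<sigma> ?X) ` (?X \<rightarrow>\<^sub>E ?X)"
  proof
    fix \<sigma> assume "\<sigma> \<in> gal K L"
    thus "\<sigma> \<in> the_inv_into (gal K L) (\<lambda>\<sigma>. restrict \<sigma> ?X) ` (?X \<rightarrow>\<^sub>E ?X)"
      using the_inv_into_f_f[OF inj] bij_betw_apply[OF gal_bij_roots]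
      by (intro image_eqI[of _ _ "restrict \<sigma> ?X"]) auto
  qed
qed

text \<open>Adjoining the roots one at a time, an element fixed by all automorphisms is a polynomial
  of degree less than that of \<open>\<mu>\<close> taking the same value at all conjugates, hence a constant.\<close>

lemma gal_fixed_field_sublist:
  assumes sep: "separable_poly f" and fixed: "\<And>\<sigma>. \<sigma> \<in> gal K L \<Longrightarrow> \<sigma> y = y"
  shows "set ys \<subseteq> set xs \<Longrightarrow> y \<in> adjoin_list K ys \<Longrightarrow> y \<in> K"
proof (induction ys)
  case (Cons x ys)
  define E where "E = adjoin_list K ys"
  have sub: "set ys \<subseteq> set xs" and x: "poly f x = 0" using Cons.prems xs by auto
  note KR = subfield_subring[OF K]
  have E: "subfield_set E"
    unfolding E_def by (rule subfield_adjoin_list[OF K algebraic_sublist[OF sub]])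
  note ER = subfield_subring[OF E]
  have KE: "K \<subseteq> E" unfolding E_def by (rule adjoin_list_superset[OF KR])
  have EL: "E \<subseteq> L"
    unfolding E_def using sub xs roots_subset_L K_subset_L
    by (intro adjoin_list_least[OF subring_L]) auto
  have xL: "x \<in> L" using x roots_subset_L by auto
  have f': "f \<in> polys E" using f polys_mono[OF KE] by auto
  obtain \<mu> where \<mu>: "\<mu> \<in> polys E" "\<mu> \<noteq> 0" "poly \<mu> x = 0"
    "\<And>h. h \<in> polys E \<Longrightarrow> poly h x = 0 \<Longrightarrow> \<exists>q\<in>polys E. h = \<mu> * q"
    using minimal_polynomial_exists[OF E f' f(2) x] by blast
  obtain g where g: "g \<in> polys E" "y = poly g x"
    using Cons.prems by (auto simp: adjoin_def E_def)
  obtain q r where qr: "q \<in> polys E" "r \<in> polys E" "g = \<mu> * q + r" "r = 0 \<or> degree r < degree \<mu>"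
    using polys_division[OF E \<mu>(1,2) g(1)] by blast
  have yr: "y = poly r x" using g qr \<mu>(3) by simp
  \<comment> \<open>Sending \<open>x\<close> to the root \<open>z\<close> over \<open>E\<close>
    extends to an automorphism of \<open>L\<close>. It fixes \<open>y\<close> by assumption and the
    coefficients of \<open>r\<close> by construction.\<close>
  have conj: "poly r z = y" if z: "poly \<mu> z = 0" for z
  proof -
    have "poly (map_poly (\<lambda>c. c) p) z = 0" if "p \<in> polys E" "poly p x = 0" for p
      using \<mu>(4)[OF that] z by auto
    then obtain \<tau> where \<tau>: "hom_on (adjoin E x) \<tau>" "\<And>c. c \<in> E \<Longrightarrow> \<tau> c = c" "\<tau> x = z"
      using hom_extend_adjoin[OF ER hom_on_id] by blast
    obtain \<sigma> where \<sigma>: "\<sigma> \<in> gal K L" "\<And>c. c \<in> adjoin E x \<Longrightarrow> \<sigma> c = \<tau> c"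
    proof (rule gal_extend[OF _ _ _ \<tau>(1)])
      show "subfield_set (adjoin E x)" by (rule subfield_adjoin[OF E f' f(2) x])
      show "K \<subseteq> adjoin E x" using KE adjoin_superset[OF ER] by auto
      show "adjoin E x \<subseteq> L" by (rule adjoin_least[OF subring_L EL xL])
    qed (use KE \<tau>(2) in auto)
    have "\<tau> y = poly (map_poly \<tau> r) z"
      unfolding yr \<tau>(3)[symmetric]
      by (rule hom_poly[OF subring_adjoin[OF ER] \<tau>(1)])
         (use qr(2) polys_mono[OF adjoin_superset[OF ER]] adjoin_self[OF ER] in auto)
    moreover have "map_poly \<tau> r = r" by (rule map_poly_fixed[OF qr(2) \<tau>(2)])
    moreover have "y \<in> adjoin E x" using Cons.prems by (simp add: E_def)
    ultimately show ?thesis using fixed[OF \<sigma>(1)] \<sigma>(2) by simp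
  qed
  have "\<mu> dvd f" using \<mu>(4)[OF f' x] by auto
  hence card: "card {z. poly \<mu> z = 0} = degree \<mu>"
    using separable_poly_split separable_poly_dvd[OF sep] by blast
  have "r - [:y:] = 0"
  proof (rule ccontr)
    assume nz: "r - [:y:] \<noteq> 0"
    have "degree \<mu> \<le> card {z. poly (r - [:y:]) z = 0}"
      unfolding card[symmetric]
      by (rule card_mono[OF poly_roots_finite[OF nz]]) (use conj in auto)
    also have "\<dots> \<le> degree (r - [:y:])" by (rule card_poly_roots_bound[OF nz])
    also have "\<dots> \<le> degree r" using degree_diff_le[of r "degree r" "[:y:]"] by simp
    finally have "degree \<mu> = 0" using qr(4) by auto
    then obtain c where "\<mu> = [:c:]" by (elim degree_eq_zeroE)
    thus False using \<mu>(2,3) by auto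
  qed
  hence "y = coeff r 0" by simp
  hence "y \<in> E" using qr(2) by (auto simp: polys_def)
  thus ?case using Cons.IH[OF sub] by (simp add: E_def)
qed simp

lemma gal_fixed_field:
  assumes "separable_poly f" "y \<in> L" "\<And>\<sigma>. \<sigma> \<in> gal K L \<Longrightarrow> \<sigma> y = y"
  shows "y \<in> K"
  using gal_fixed_field_sublist[OF assms(1), of y xs] assms(2,3) by (simp add: L_def)

text \<open>Left composition with a group element permutes the factors of the norm. The lemma is the
  bridge from \<open>L\<close> to k(t), where orders of vanishing at \<open>t0\<close> can be read
  off.\<close>

lemma gal_norm_in_K:
  assumes sep: "separable_poly f" and w: "w \<in> L"
  shows "(\<Prod>\<sigma>\<in>gal K L. \<sigma> w) \<in> K"
proof (rule gal_fixed_field[OF sep])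
  show "(\<Prod>\<sigma>\<in>gal K L. \<sigma> w) \<in> L"
    using w by (intro subring_prod[OF subring_L]) (auto intro: galD)
  fix \<tau> assume \<tau>: "\<tau> \<in> gal K L"
  have "inj_on (compose L \<tau>) (gal K L)"
  proof (rule inj_onI)
    fix \<sigma> \<sigma>' assume s: "\<sigma> \<in> gal K L" "\<sigma>' \<in> gal K L" "compose L \<tau> \<sigma> = compose L \<tau> \<sigma>'"
    show "\<sigma> = \<sigma>'"
    proof (rule extensionalityI[of _ L])
      fix y assume y: "y \<in> L"
      have "\<tau> (\<sigma> y) = \<tau> (\<sigma>' y)" using fun_cong[OF s(3), of y] y by (simp add: compose_def)
      thus "\<sigma> y = \<sigma>' y"
        using hom_subfield_inj_on[OF subfield_L gal_hom[OF \<tau>]] gal_mem[OF s(1) y] gal_mem[OF s(2) y]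
        by (auto dest: inj_onD)
    qed (use s galD in auto)
  qed
  hence bij: "bij_betw (compose L \<tau>) (gal K L) (gal K L)"
    using gal_compose[OF subring_L K_subset_L \<tau>]
    by (auto simp: bij_betw_def intro!: endo_inj_surj[OF finite_gal])
  have "\<tau> (\<Prod>\<sigma>\<in>gal K L. \<sigma> w) = (\<Prod>\<sigma>\<in>gal K L. compose L \<tau> \<sigma> w)"
    using w by (subst hom_prod[OF subring_L gal_hom[OF \<tau>]]) (auto intro: galD simp: compose_def)
  also have "\<dots> = (\<Prod>\<sigma>\<in>gal K L. \<sigma> w)"
    by (rule prod.reindex_bij_betw[OF bij])
  finally show "\<tau> (\<Prod>\<sigma>\<in>gal K L. \<sigma> w) = (\<Prod>\<sigma>\<in>gal K L. \<sigma> w)" .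
qed

end

subsection \<open>Double transitivity\<close>

lemma polys_pcompose:
  assumes R: "subring_set R" and "p \<in> polys R" "q \<in> polys R"
  shows "pcompose p q \<in> polys R"
  using assms(2)
proof (induction p)
  case (pCons c p)
  hence "c \<in> R" "p \<in> polys R" using polys_pCons_iff[OF R] by auto
  thus ?case
    using pCons.IH assms(3) by (simp add: pcompose_pCons polys_closed[OF R] polys_pCons_iff[OF R])
qed (simp add: polys_0[OF R])

lemma polys_linear_factor:
  assumes R: "subring_set R" and p: "p \<in> polys R" and c: "c \<in> R" "poly p c = 0"
  obtains q where "q \<in> polys R" "p = [:- c, 1:] * q"
  using that[OF polys_synthetic_div[OF R p c(1)]] synthetic_div_correct'[of c p] c(2) by simp

lemma polys_common_denominator:
  assumes R: "subring_set R" and p: "p \<in> polys (fractions R)"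
  shows "\<exists>d\<in>R. d \<noteq> 0 \<and> smult d p \<in> polys R"
  using p
proof (induction p)
  case 0
  show ?case by (rule bexI[of _ 1]) (auto simp: polys_0[OF R] subring_one[OF R])
next
  case (pCons c p)
  have "c \<in> fractions R" "p \<in> polys (fractions R)"
    using pCons.prems polys_pCons_iff[OF subfield_subring[OF subfield_fractions[OF R]]] by auto
  with pCons.IH obtain d u v where *: "d \<in> R" "d \<noteq> 0" "smult d p \<in> polys R"
    "u \<in> R" "v \<in> R" "v \<noteq> 0" "c = u / v" by (auto simp: fractions_def)
  have "smult (v * d) (pCons c p) = pCons (d * u) (smult v (smult d p))" using * by simp
  also have "\<dots> \<in> polys R"
    using * by (simp only: polys_pCons_iff[OF R]) (auto simp: polys_smult[OF R] subring_mult[OF R] simp del: smult_smult)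
  finally show ?case using * by (intro bexI[of _ "v * d"]) (auto simp: subring_mult[OF R])
qed

text \<open>The lowest term of \<open>r\<close> that does not vanish under \<open>\<phi>\<close> cannot be cancelled by the others:
  after multiplication by a power of \<open>z\<close> all terms are divisible by \<open>\<pi>\<close>, and it is the only one
  whose quotient does not vanish under \<open>\<phi>\<close>.\<close>

lemma eisenstein_no_relation:
  fixes z :: "'a::field"
  assumes B: "subring_set B" and \<phi>: "hom_on B \<phi>"
    and mem: "\<pi> \<in> B" "z \<in> B" "w \<in> B" and "\<pi> \<noteq> 0" "\<phi> z = 0" "\<phi> w \<noteq> 0" and zn: "z ^ n = \<pi> * w"
    and r: "r \<in> polys B" "degree r < n" "poly r z = 0"
    and div: "\<And>i. \<phi> (coeff r i) = 0 \<Longrightarrow> \<exists>d\<in>B. coeff r i = \<pi> * d"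
    and nz: "\<phi> (coeff r j) \<noteq> 0"
  shows False
proof -
  define l where "l = (LEAST i. \<phi> (coeff r i) \<noteq> 0)"
  have l: "\<phi> (coeff r l) \<noteq> 0" unfolding l_def by (rule LeastI[of _ j]) (rule nz)
  have less: "\<phi> (coeff r i) = 0" if "i < l" for i
    using not_less_Least[OF that[unfolded l_def]] by simp
  have "coeff r l \<noteq> 0" using l hom_zero[OF B \<phi>] by auto
  hence ldeg: "l \<le> degree r" by (rule le_degree)
  have c: "coeff r i \<in> B" for i using r(1) by (simp add: polys_def)
  \<comment> \<open>For \<open>i < l\<close> the factor \<pi> comes from the coefficient, and the
    power of \<open>z\<close> left over is positive because \<open>l \<le> degree r < n\<close>. For
    \<open>i \<ge> l\<close> the factor comes from \<open>z ^ n\<close>, and a positive power of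
    \<open>z\<close> remains unless \<open>i = l\<close>.\<close>
  have "\<exists>T\<in>B. coeff r i * z ^ (i + n - l) = \<pi> * T \<and> \<phi> T = (if i = l then \<phi> (coeff r l) * \<phi> w else 0)" for i
  proof (cases "i < l")
    case True
    then obtain d where d: "d \<in> B" "coeff r i = \<pi> * d" using div less by blast
    have "i + n - l > 0" using ldeg r(2) by simp
    thus ?thesis using d True mem \<open>\<phi> z = 0\<close>
      by (intro bexI[of _ "d * z ^ (i + n - l)"])
         (auto simp: subring_closed[OF B] hom_simps[OF B \<phi>] zero_power)
  next
    case False
    hence "i + n - l = n + (i - l)" by simp
    hence "z ^ (i + n - l) = z ^ n * z ^ (i - l)" by (simp only: power_add)
    thus ?thesis using False mem c \<open>\<phi> z = 0\<close>
      by (intro bexI[of _ "coeff r i * w * z ^ (i - l)"])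
         (auto simp: subring_closed[OF B] hom_simps[OF B \<phi>] zero_power zn)
  qed
  hence "\<forall>i. \<exists>T. T \<in> B \<and> coeff r i * z ^ (i + n - l) = \<pi> * T \<and>
      \<phi> T = (if i = l then \<phi> (coeff r l) * \<phi> w else 0)"
    by blast
  from choice[OF this] obtain T where T: "T i \<in> B" "coeff r i * z ^ (i + n - l) = \<pi> * T i"
    "\<phi> (T i) = (if i = l then \<phi> (coeff r l) * \<phi> w else 0)" for i
    by blast
  have "0 = poly r z * z ^ (n - l)" using r(3) by simp
  also have "\<dots> = (\<Sum>i\<le>degree r. coeff r i * z ^ (i + n - l))"
    using ldeg r(2) by (auto simp: poly_altdef sum_distrib_right mult.assoc simp flip: power_add intro!: sum.cong)
  also have "\<dots> = \<pi> * (\<Sum>i\<le>degree r. T i)" by (simp add: T(2) sum_distrib_left)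
  finally have "(\<Sum>i\<le>degree r. T i) = 0" using \<open>\<pi> \<noteq> 0\<close> by simp
  hence "0 = \<phi> (\<Sum>i\<le>degree r. T i)" using hom_zero[OF B \<phi>] by simp
  also have "\<dots> = (\<Sum>i\<le>degree r. \<phi> (T i))" by (rule hom_sum[OF B \<phi> T(1)])
  also have "\<dots> = \<phi> (coeff r l) * \<phi> w" using ldeg by (simp add: T(3))
  finally show False using l \<open>\<phi> w \<noteq> 0\<close> by simp
qed

lemma subfield_fixed_points:
  assumes E: "subfield_set E" and \<psi>: "hom_on E \<psi>"
  shows "subfield_set {z \<in> E. \<psi> z = z}"
  using subfield_subring[OF E] E
  by (auto simp: subfield_set_def subring_set_def hom_simps[OF subfield_subring[OF E] \<psi>]
      hom_subfield_inverse[OF E \<psi>])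

text \<open>The constant field \<open>k\<close> stands for the algebraic closure of the finite
  field. The condition that the prime does not divide m (m - 1) appears here as the nonvanishing of
  \<open>m\<close> and \<open>m - 1\<close> in the ambient field.\<close>

locale trinomial =
  fixes k :: "'a::alg_closed_field set" and t a b :: 'a and m :: nat
  assumes k: "subfield_set k"
    and k_closed: "\<And>p. p \<in> polys k \<Longrightarrow> degree p > 0 \<Longrightarrow> \<exists>x\<in>k. poly p x = 0"
    and t_transcendental: "\<And>p. p \<in> polys k \<Longrightarrow> poly p t = 0 \<Longrightarrow> p = 0"
    and ab: "a \<in> k" "b \<in> k" "b \<noteq> 0" "b \<noteq> a ^ m"
    and m: "m \<ge> 2" "of_nat m \<noteq> (0 :: 'a)" "of_nat (m - 1) \<noteq> (0 :: 'a)"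
begin

abbreviation "F \<equiv> F_poly m t a b"

definition K where "K = fractions (adjoin k t)"

lemmas k_ring = subfield_subring[OF k]
lemmas k_simps = subring_closed[OF k_ring]
lemmas kt_ring = subring_adjoin[OF k_ring, of t]

text \<open>Being closed under one root per polynomial gives all of them, by dividing out roots in
  \<open>k\<close>. Elements outside \<open>k\<close> are thus transcendental over \<open>k\<close>,
  which is how the roots of \<open>F\<close> are treated.\<close>

lemma k_root_mem:
  assumes "p \<in> polys k" "p \<noteq> 0" "poly p x = 0"
  shows "x \<in> k"
  using assms
proof (induction "degree p" arbitrary: p rule: less_induct)
  case less
  have "degree p > 0"
  proof (rule ccontr)
    assume "\<not> degree p > 0"
    then obtain c where "p = [:c:]" by (metis degree_eq_zeroE neq0_conv)
    thus False using less.prems by auto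
  qed
  then obtain y where y: "y \<in> k" "poly p y = 0" using k_closed less.prems by blast
  obtain q where q: "q \<in> polys k" "p = [:- y, 1:] * q"
    using polys_linear_factor[OF k_ring less.prems(1) y] by blast
  show ?case
  proof (cases "x = y")
    case False
    have "q \<noteq> 0" using q less.prems by auto
    moreover from this have "degree q < degree p" unfolding q(2) by (subst degree_mult_eq) auto
    moreover have "poly q x = 0" using less.prems(3) False unfolding q(2) by simp
    ultimately show ?thesis using less.hyps q(1) by blast
  qed (use y in simp)
qed

text \<open>If \<open>k\<close> were finite, one plus the product of all X - x would have no root in
  \<open>k\<close>. Infinity of \<open>k\<close> lets polynomial identities be checked at points of
  \<open>k\<close>.\<close>

lemma infinite_k: "infinite k"
proof
  assume fin: "finite k"
  define p where "p = (\<Prod>x\<in>k. [:- x, 1:])"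
  have p: "p \<in> polys k"
  proof -
    have "(\<Prod>x\<in>A. [:- x, 1:]) \<in> polys k" if "A \<subseteq> k" for A
      using that by (induction A rule: infinite_finite_induct)
        (auto simp: polys_1[OF k_ring] polys_pCons_iff[OF k_ring] polys_0[OF k_ring] k_simps
          simp del: mult_pCons_left intro!: polys_mult[OF k_ring])
    thus ?thesis by (simp add: p_def)
  qed
  have "degree p = card k" unfolding p_def by (subst degree_prod_eq_sum_degree) auto
  moreover have "card k > 0" using fin k_simps(1) by (auto simp: card_gt_0_iff)
  ultimately have "degree (p + 1) > 0" using degree_add_eq_left[of 1 p] by simp
  then obtain x where x: "x \<in> k" "poly (p + 1) x = 0"
    using k_closed[of "p + 1"] p by (auto simp: polys_closed[OF k_ring])
  have "poly p x = 0" unfolding p_def poly_prod using fin x(1) by (auto intro: prod_zero)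
  thus False using x(2) by simp
qed

lemma t_notin_k: "t \<notin> k"
proof
  assume "t \<in> k"
  hence "[:- t, 1:] \<in> polys k" by (simp add: polys_pCons_iff[OF k_ring] polys_0[OF k_ring] k_simps)
  thus False using t_transcendental[of "[:- t, 1:]"] by simp
qed

lemma poly_F_poly: "poly (F_poly m s a b) x = x ^ m - s * (x - a) - b"
  by (simp add: F_poly_def poly_monom algebra_simps)

lemma F_poly_altdef: "F_poly m s a b = monom 1 m + [:s * a - b, - s:]"
  by (rule poly_eqI) (auto simp: F_poly_def coeff_pCons split: nat.splits)

lemma degree_F_poly: "degree (F_poly m s a b) = m" and lead_coeff_F_poly: "lead_coeff (F_poly m s a b) = 1"
proof -
  have "degree [:s * a - b, - s:] < m"
    using m(1) degree_pCons_le[of "s * a - b" "[:- s:]"] by (auto intro: le_less_trans)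
  hence *: "degree [:s * a - b, - s:] < degree (monom (1 :: 'a) m)" by (simp add: degree_monom_eq)
  show "degree (F_poly m s a b) = m"
    unfolding F_poly_altdef using degree_add_eq_left[OF *] by (simp add: degree_monom_eq)
  thus "lead_coeff (F_poly m s a b) = 1"
    unfolding F_poly_altdef using \<open>degree [:s * a - b, - s:] < m\<close> by (simp add: coeff_eq_0)
qed

lemma F_nz: "F_poly m s a b \<noteq> 0"
  using degree_F_poly[of s] m(1) by auto

lemma poly_pderiv_F_poly: "poly (pderiv (F_poly m s a b)) x = of_nat m * x ^ (m - 1) - s"
  unfolding F_poly_altdef by (simp add: pderiv_add pderiv_monom poly_monom pderiv_pCons)

lemma F_poly_polys:
  assumes R: "subring_set R" and "k \<subseteq> R" "s \<in> R"
  shows "F_poly m s a b \<in> polys R"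
proof -
  have "a \<in> R" "b \<in> R" using assms(2) ab by auto
  thus ?thesis
    unfolding F_poly_def using assms(3)
    by (simp add: polys_closed[OF R] polys_pCons_iff[OF R] subring_closed[OF R])
qed

lemma K_field: "subfield_set K"
  unfolding K_def by (rule subfield_fractions[OF kt_ring])

lemma kt_subset_K: "adjoin k t \<subseteq> K"
  unfolding K_def by (rule fractions_superset[OF kt_ring])

lemma k_subset_K: "k \<subseteq> K" and t_in_K: "t \<in> K"
  using kt_subset_K adjoin_superset[OF k_ring, of t] adjoin_self[OF k_ring, of t] by auto

lemma K_least:
  assumes "subfield_set E" "k \<subseteq> E" "t \<in> E"
  shows "K \<subseteq> E"
  unfolding K_def
  by (rule fractions_least[OF assms(1) adjoin_least[OF subfield_subring[OF assms(1)] assms(2,3)]])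

lemma F_polys: "F \<in> polys K"
  by (rule F_poly_polys[OF subfield_subring[OF K_field] k_subset_K t_in_K])

lemma F_at_a: "poly (F_poly m s a b) a \<noteq> 0"
  using ab by (simp add: poly_F_poly)

lemma root_t_eq:
  assumes "poly F x = 0"
  shows "x \<noteq> a" "t = (x ^ m - b) / (x - a)"
proof -
  show "x \<noteq> a" using assms F_at_a by auto
  thus "t = (x ^ m - b) / (x - a)" using assms by (simp add: poly_F_poly field_simps)
qed

lemma root_notin_k: "poly F x = 0 \<Longrightarrow> x \<notin> k"
  using root_t_eq[of x] t_notin_k ab subfield_divide[OF k, of "x ^ m - b" "x - a"] by (auto simp: k_simps)

lemma root_transcendental: "poly F x = 0 \<Longrightarrow> p \<in> polys k \<Longrightarrow> poly p x = 0 \<Longrightarrow> p = 0"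
  using root_notin_k k_root_mem by blast

text \<open>Eliminating \<open>t\<close> between \<open>F\<close> and its derivative leaves a
  polynomial over \<open>k\<close> with leading coefficient -(m - 1), which is nonzero. A double
  root would then lie in \<open>k\<close>, and so would \<open>t\<close>.\<close>

lemma F_separable: "separable_poly F"
  unfolding separable_poly_def
proof (intro conjI allI impI notI)
  show "F = 0 \<Longrightarrow> False" using F_nz by simp
  fix x assume x: "poly F x = 0" "poly (pderiv F) x = 0"
  hence t: "t = of_nat m * x ^ (m - 1)" by (simp add: poly_pderiv_F_poly)
  define p where "p = monom 1 m - smult (of_nat m) (monom 1 (m - 1) * [:- a, 1:]) - [:b:]"
  have "p \<in> polys k"
    unfolding p_def using ab
    by (simp add: polys_closed[OF k_ring] polys_pCons_iff[OF k_ring] k_simps del: mult_pCons_right)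
  moreover have "poly p x = 0"
    using x(1) unfolding p_def t by (simp add: poly_F_poly poly_monom algebra_simps)
  moreover have "coeff p m = 1 - of_nat m"
    using m(1) unfolding p_def by (auto simp: coeff_monom_mult coeff_pCons split: nat.splits)
  hence "coeff p m = - of_nat (m - 1)" using m(1) by (simp add: of_nat_diff)
  hence "p \<noteq> 0" using m(3) by auto
  ultimately have "x \<in> k" using k_root_mem by blast
  thus False using root_notin_k x(1) by blast
qed

definition xs where "xs = (SOME xs. set xs = {x. poly F x = 0})"

sublocale root_field K F xs
proof
  have "\<exists>xs. set xs = {x. poly F x = 0}"
    by (rule finite_list[OF poly_roots_finite[OF F_nz]])
  thus "set xs = {x. poly F x = 0}" unfolding xs_def by (rule someI_ex)
qed (rule K_field F_polys F_nz)+

lemma card_roots: "card {x. poly F x = 0} = m"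
  using separable_poly_split[OF F_separable] degree_F_poly by simp

lemma k_subset_L: "k \<subseteq> L" and t_in_L: "t \<in> L"
  using k_subset_K t_in_K K_subset_L by auto

section \<open>The rational function field generated by one root\<close>

context
  fixes x assumes x: "poly F x = 0"
begin

definition E where "E = fractions (adjoin k x)"

lemma kx_ring: "subring_set (adjoin k x)"
  by (rule subring_adjoin[OF k_ring])

lemma E_field: "subfield_set E"
  unfolding E_def by (rule subfield_fractions[OF kx_ring])

lemma kx_subset_E: "adjoin k x \<subseteq> E"
  unfolding E_def by (rule fractions_superset[OF kx_ring])

lemma k_subset_E: "k \<subseteq> E" and x_in_E: "x \<in> E"
  using kx_subset_E adjoin_superset[OF k_ring, of x] adjoin_self[OF k_ring, of x] by auto

lemma K_subset_E: "K \<subseteq> E"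
proof (rule K_least[OF E_field k_subset_E])
  note E_ring = subfield_subring[OF E_field]
  show "t \<in> E"
    unfolding root_t_eq(2)[OF x] using x_in_E ab k_subset_E
    by (intro subfield_divide[OF E_field]) (auto simp: subring_closed[OF E_ring])
qed

lemma E_subset_L: "E \<subseteq> L"
  unfolding E_def using x roots_subset_L
  by (intro fractions_least[OF subfield_L] adjoin_least[OF subring_L k_subset_L]) auto

text \<open>As \<open>x\<close> is transcendental over \<open>k\<close>, it may be sent to any
  element. The target is another root for transitivity and \<open>a\<close> for the Eisenstein
  argument.\<close>

lemma hom_from_kx:
  obtains \<phi> where "hom_on (adjoin k x) \<phi>" "\<And>c. c \<in> k \<Longrightarrow> \<phi> c = c" "\<phi> x = y"
    "\<And>p. p \<in> polys k \<Longrightarrow> \<phi> (poly p x) = poly p y"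
proof -
  have "poly (map_poly (\<lambda>c. c) p) y = 0" if "p \<in> polys k" "poly p x = 0" for p
    using root_transcendental[OF x that] by simp
  then obtain \<phi> where \<phi>: "hom_on (adjoin k x) \<phi>" "\<And>c. c \<in> k \<Longrightarrow> \<phi> c = c" "\<phi> x = y"
    using hom_extend_adjoin[OF k_ring hom_on_id] by blast
  have "\<phi> (poly p x) = poly p y" if "p \<in> polys k" for p
    using hom_poly[OF kx_ring \<phi>(1), of p x] that polys_mono[OF adjoin_superset[OF k_ring, of x]]
      adjoin_self[OF k_ring, of x] map_poly_fixed[OF that \<phi>(2)] \<phi>(3) by auto
  thus ?thesis using that \<phi> by blast
qed

text \<open>Both roots are transcendental over \<open>k\<close>, so sending \<open>x\<close> to
  \<open>y\<close> is injective on k[x] and extends to k(x). It fixes \<open>t\<close>, which is the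
  same rational function of either root, and hence fixes all of \<open>K\<close>.\<close>

lemma gal_transitive:
  assumes y: "poly F y = 0"
  obtains \<sigma> where "\<sigma> \<in> gal K L" "\<sigma> x = y"
proof -
  obtain \<phi> where \<phi>: "hom_on (adjoin k x) \<phi>" "\<And>c. c \<in> k \<Longrightarrow> \<phi> c = c" "\<phi> x = y"
    "\<And>p. p \<in> polys k \<Longrightarrow> \<phi> (poly p x) = poly p y"
    using hom_from_kx by blast
  have "u = 0" if u: "u \<in> adjoin k x" "\<phi> u = 0" for u
  proof -
    obtain p where p: "p \<in> polys k" "u = poly p x" using u(1) by (auto simp: adjoin_def)
    hence "p = 0" using \<phi>(4)[OF p(1)] u(2) root_transcendental[OF y p(1)] by simp
    thus ?thesis using p by simp
  qed
  then obtain \<psi> where \<psi>: "hom_on E \<psi>" "\<And>u. u \<in> adjoin k x \<Longrightarrow> \<psi> u = \<phi> u"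
    using hom_extend_fractions[OF kx_ring \<phi>(1)] unfolding E_def by blast
  have \<psi>k: "\<psi> c = c" if "c \<in> k" for c
    using that \<psi>(2) \<phi>(2) adjoin_superset[OF k_ring, of x] by auto
  have \<psi>x: "\<psi> x = y" using \<psi>(2) \<phi>(3) adjoin_self[OF k_ring, of x] by auto
  note E_ring = subfield_subring[OF E_field]
  have mem: "a \<in> E" "b \<in> E" "x \<in> E" using ab k_subset_E x_in_E by auto
  have "\<psi> ((x ^ m - b) / (x - a)) = (y ^ m - b) / (y - a)"
    using mem ab \<psi>k \<psi>x
    by (simp add: hom_subfield_divide[OF E_field \<psi>(1)] hom_simps[OF E_ring \<psi>(1)] subring_closed[OF E_ring])
  hence "\<psi> t = t" using root_t_eq(2)[OF x] root_t_eq(2)[OF y] by simp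
  hence "K \<subseteq> {z \<in> E. \<psi> z = z}"
    using k_subset_E K_subset_E t_in_K \<psi>k
    by (intro K_least subfield_fixed_points[OF E_field \<psi>(1)]) auto
  then obtain \<sigma> where "\<sigma> \<in> gal K L" "\<And>c. c \<in> E \<Longrightarrow> \<sigma> c = \<psi> c"
    using gal_extend[OF E_field K_subset_E E_subset_L \<psi>(1)] by blast
  thus ?thesis using that \<psi>x x_in_E by auto
qed

text \<open>Eisenstein's criterion for \<open>1 / (y - a)\<close> over k[x] at the prime
  \<open>x - a\<close>. The polynomial \<open>\<gamma>\<close> witnesses that \<open>r\<close> is
  nonzero, and its degree is the measure for removing common factors \<open>x - a\<close> from the
  coefficients.\<close>

lemma no_low_degree_relation_aux:
  assumes y: "poly F y = 0" "y \<noteq> x" and r: "r \<in> polys (adjoin k x)" "degree r < m - 1" "poly r (inverse (y - a)) = 0"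
    and \<gamma>: "\<gamma> \<in> polys k" "\<gamma> \<noteq> 0" "coeff r j = poly \<gamma> x"
  shows False
proof -
  define \<pi> where "\<pi> = x - a"
  define z where "z = inverse (y - a)"
  have \<pi>0: "\<pi> \<noteq> 0" and ya: "y - a \<noteq> 0" using root_t_eq(1) x y by (auto simp: \<pi>_def)
  hence z0: "z \<noteq> 0" by (simp add: z_def)
  \<comment> \<open>In the variable \<open>v = X - a\<close>, the root equation reads
    \<open>t * v = poly A v\<close>. \<open>A0\<close> is the constant term of \<open>A\<close>, and
    \<open>C\<close> is \<open>A - A0\<close> divided by the variable.\<close>
  define A where "A = pcompose (monom 1 m - [:b:]) [:a, 1:]"
  define C where "C = synthetic_div A 0"
  define A0 where "A0 = a ^ m - b"
  have pA: "poly A v = (v + a) ^ m - b" for v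
    by (simp add: A_def poly_pcompose poly_monom algebra_simps)
  have Apoly: "A \<in> polys k"
    unfolding A_def using ab
    by (intro polys_pcompose[OF k_ring]) (auto simp: polys_closed[OF k_ring] polys_pCons_iff[OF k_ring] k_simps)
  have "lead_coeff (monom 1 m - [:b:]) = 1 \<and> degree (monom 1 m - [:b:]) = m"
  proof -
    have "degree (monom 1 m + [:- b:]) = m"
      using m(1) degree_add_eq_left[of "[:- b:]" "monom 1 m"] by (simp add: degree_monom_eq)
    moreover have "monom 1 m + [:- b:] = monom 1 m - [:b:]" by simp
    ultimately have "degree (monom 1 m - [:b:]) = m" by simp
    thus ?thesis using m(1) by (simp add: coeff_pCons split: nat.splits)
  qed
  hence dA: "degree A = m" "lead_coeff A = 1"
    unfolding A_def using lead_coeff_comp[of "[:a, 1:]" "monom 1 m - [:b:]"] by (auto simp: degree_pcompose)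
  have Aeq: "A = pCons A0 C"
    using synthetic_div_correct'[of 0 A] pA[of 0] by (simp add: C_def A0_def)
  have dC: "degree C = m - 1" "lead_coeff C = 1"
  proof -
    show d: "degree C = m - 1" using dA(1) by (simp add: C_def degree_synthetic_div)
    have "C \<noteq> 0" using d m(1) by auto
    thus "lead_coeff C = 1" using dA(2) Aeq by simp
  qed
  have Cpoly: "C \<in> polys k" using Apoly Aeq polys_pCons_iff[OF k_ring] by auto
  \<comment> \<open>The divided difference of \<open>C\<close> at \<open>\<pi>\<close>; it appears
    when the equations of \<open>x\<close> and \<open>y\<close> are subtracted and
    \<open>(y - a) - \<pi>\<close> is cancelled.\<close>
  define W where "W = synthetic_div C \<pi>"
  have Weq: "C = [:- \<pi>, 1:] * W + [:poly C \<pi>:]"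
    unfolding W_def by (rule synthetic_div_correct'[symmetric])
  have dW: "degree W = m - 2" by (simp add: W_def degree_synthetic_div dC)
  have lW: "lead_coeff W = 1"
  proof -
    obtain n where n: "m = Suc (Suc n)" using m(1) by (metis add_2_eq_Suc le_Suc_ex)
    have "coeff C (Suc n) = coeff ([:- \<pi>, 1:] * W + [:poly C \<pi>:]) (Suc n)"
      by (rule arg_cong[OF Weq])
    also have "\<dots> = coeff W n" using dW n by (simp add: coeff_eq_0)
    finally show ?thesis using dC dW n by simp
  qed
  have \<pi>mem: "\<pi> \<in> adjoin k x"
    unfolding \<pi>_def using adjoin_self[OF k_ring, of x] adjoin_superset[OF k_ring, of x] ab
    by (intro subring_diff[OF kx_ring]) auto
  have Wpoly: "W \<in> polys (adjoin k x)"
    unfolding W_def using Cpoly polys_mono[OF adjoin_superset[OF k_ring, of x]] \<pi>mem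
    by (intro polys_synthetic_div[OF kx_ring]) auto
  \<comment> \<open>Reversing \<open>W\<close> rewrites a relation in \<open>y - a\<close> as one in
    its inverse \<open>z\<close>.\<close>
  define Wr where "Wr = reflect_poly W"
  have Wrpoly: "Wr \<in> polys (adjoin k x)" unfolding Wr_def by (rule polys_reflect[OF kx_ring Wpoly])
  \<comment> \<open>Eliminates \<open>t\<close> between the equations of \<open>x\<close> and
    \<open>y\<close>, then divides by the nonzero difference of the roots.\<close>
  have rel: "A0 = \<pi> * (y - a) * poly W (y - a)"
  proof -
    have "t * \<pi> = poly A \<pi>" "t * (y - a) = poly A (y - a)"
      using x y by (simp_all add: pA \<pi>_def poly_F_poly algebra_simps)
    moreover have "\<pi> * (t * (y - a)) = (y - a) * (t * \<pi>)" by simp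
    ultimately have "\<pi> * poly A (y - a) = (y - a) * poly A \<pi>" by simp
    hence "\<pi> * (A0 + (y - a) * poly C (y - a)) = (y - a) * (A0 + \<pi> * poly C \<pi>)" by (simp add: Aeq)
    hence "A0 * ((y - a) - \<pi>) = \<pi> * (y - a) * (poly C (y - a) - poly C \<pi>)" by (simp add: algebra_simps)
    also have "poly C (y - a) - poly C \<pi> = ((y - a) - \<pi>) * poly W (y - a)"
      by (subst Weq) (simp add: algebra_simps)
    finally have "((y - a) - \<pi>) * A0 = ((y - a) - \<pi>) * (\<pi> * (y - a) * poly W (y - a))" by (simp only: mult_ac)
    moreover have "(y - a) - \<pi> \<noteq> 0" using y(2) by (simp add: \<pi>_def)
    ultimately show ?thesis by simp
  qed
  have rel': "A0 * z ^ (m - 1) = \<pi> * poly Wr z"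
  proof -
    have "poly Wr z = z ^ (m - 2) * poly W (y - a)"
      unfolding Wr_def using z0 by (simp add: poly_reflect_poly_nz dW z_def)
    moreover have "(y - a) * z ^ (m - 1) = z ^ (m - 2)"
    proof -
      have "m - 1 = Suc (m - 2)" using m(1) by simp
      thus ?thesis using ya by (simp add: z_def)
    qed
    ultimately show ?thesis using rel by (simp add: mult_ac)
  qed
  have A0: "A0 \<noteq> 0" "A0 \<in> k" using ab by (auto simp: A0_def k_simps)
  obtain \<phi> where \<phi>: "hom_on (adjoin k x) \<phi>" "\<And>c. c \<in> k \<Longrightarrow> \<phi> c = c" "\<phi> x = a"
    "\<And>p. p \<in> polys k \<Longrightarrow> \<phi> (poly p x) = poly p a"
    using hom_from_kx by blast
  have \<phi>\<pi>: "\<phi> \<pi> = 0"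
    unfolding \<pi>_def using \<phi>(2)[OF ab(1)] \<phi>(3) adjoin_self[OF k_ring, of x] adjoin_superset[OF k_ring, of x] ab
    by (subst hom_diff[OF kx_ring \<phi>(1)]) auto
  have img: "\<phi> ` adjoin k x = k"
  proof
    show "\<phi> ` adjoin k x \<subseteq> k"
      using \<phi>(4) poly_closed[OF k_ring] ab by (auto simp: adjoin_def)
    show "k \<subseteq> \<phi> ` adjoin k x" using \<phi>(2) adjoin_superset[OF k_ring, of x] by force
  qed
  \<comment> \<open>\<open>f\<close> vanishes at \<open>z\<close>, and its leading coefficient
    \<open>A0\<close> is a nonzero constant, so the place \<open>x = a\<close> extends to
    \<open>z\<close>. That \<open>A0\<close> is nonzero is the hypothesis
    \<open>b \<noteq> a ^ m\<close>.\<close>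
  define f where "f = monom A0 (m - 1) - smult \<pi> Wr"
  have A0': "A0 \<in> adjoin k x" using A0 adjoin_superset[OF k_ring, of x] by auto
  have fpoly: "f \<in> polys (adjoin k x)"
    unfolding f_def using A0' \<pi>mem Wrpoly by (simp add: polys_closed[OF kx_ring])
  have "degree (smult \<pi> Wr) < degree (monom A0 (m - 1))"
    using degree_reflect_poly_le[of W] dW m(1) A0(1) \<pi>0 by (simp add: Wr_def degree_monom_eq)
  hence "lead_coeff f = A0"
    unfolding f_def using lead_coeff_add_le[of "- smult \<pi> Wr" "monom A0 (m - 1)"]
    by (simp add: degree_monom_eq A0(1) degree_add_eq_left coeff_eq_0 diff_conv_add_uminus del: add_uminus_conv_diff)
  hence lf: "\<phi> (lead_coeff f) \<noteq> 0" using A0 \<phi>(2) by simp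
  have fz: "poly f z = 0" unfolding f_def using rel' by (simp add: poly_monom)
  obtain v where v: "\<And>p. p \<in> polys (adjoin k x) \<Longrightarrow> poly p z = 0 \<Longrightarrow> poly (map_poly \<phi> p) v = 0"
    using exists_compatible_value[OF kx_ring \<phi>(1) _ fpoly lf fz] k img by auto
  define B where "B = adjoin (adjoin k x) z"
  obtain \<psi> where \<psi>: "hom_on B \<psi>" "\<And>c. c \<in> adjoin k x \<Longrightarrow> \<psi> c = \<phi> c" "\<psi> z = v"
    using hom_extend_adjoin[OF kx_ring \<phi>(1) v] unfolding B_def by blast
  have B: "subring_set B" unfolding B_def by (rule subring_adjoin[OF kx_ring])
  have sub: "adjoin k x \<subseteq> B" and zB: "z \<in> B"
    unfolding B_def using adjoin_superset[OF kx_ring, of z] adjoin_self[OF kx_ring, of z] by auto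
  have wB: "poly Wr z \<in> B" using Wrpoly polys_mono[OF sub] zB by (intro poly_closed[OF B]) auto
  have \<pi>B: "\<pi> \<in> B" and A0B: "A0 \<in> B" using sub \<pi>mem A0' by auto
  \<comment> \<open>\<open>\<pi>\<close> reduces to 0 and \<open>A0\<close> to itself, so the value
    \<open>v\<close> of \<open>z\<close> has no choice but 0.\<close>
  have "\<psi> (A0 * z ^ (m - 1)) = 0"
    unfolding rel' using \<phi>\<pi> \<psi>(2)[OF \<pi>mem] wB \<pi>B by (simp add: hom_mult[OF B \<psi>(1)])
  moreover have "\<psi> A0 = A0" using \<psi>(2) A0' \<phi>(2) A0 by simp
  ultimately have "v ^ (m - 1) = 0"
    using A0 A0B zB \<psi>(3) by (simp add: hom_simps[OF B \<psi>(1)] subring_closed[OF B])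
  hence v0: "\<psi> z = 0" using \<psi>(3) by simp
  have "\<psi> (poly Wr z) = poly (map_poly \<psi> Wr) 0"
    using hom_poly[OF B \<psi>(1) _ zB, of Wr] Wrpoly polys_mono[OF sub] v0 by auto
  also have "\<dots> = \<psi> (coeff Wr 0)" by (simp add: poly_0_coeff_0 hom_coeff_map_poly[OF B \<psi>(1)])
  \<comment> \<open>The constant term of the reversal is the leading coefficient of
    \<open>W\<close>. So \<open>poly Wr z\<close> is a unit at the place, and \<open>rel'\<close>
    becomes the Eisenstein relation \<open>zw\<close>.\<close>
  also have "\<dots> = 1" by (simp add: Wr_def lW hom_one[OF B \<psi>(1)])
  finally have w: "\<psi> (poly Wr z) = 1" .
  have iA: "inverse A0 \<in> k" using subfield_inverse[OF k A0(2)] .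
  hence iA': "inverse A0 \<in> adjoin k x" using adjoin_superset[OF k_ring, of x] by auto
  define w where "w = inverse A0 * poly Wr z"
  have wB': "w \<in> B" unfolding w_def using iA' sub wB by (auto simp: subring_mult[OF B])
  have "\<psi> w = inverse A0"
    unfolding w_def using hom_mult[OF B \<psi>(1) _ wB, of "inverse A0"] iA' sub w \<psi>(2)[OF iA'] \<phi>(2)[OF iA] by auto
  hence w0: "\<psi> w \<noteq> 0" using A0 by simp
  have zw: "z ^ (m - 1) = \<pi> * w" unfolding w_def using rel' A0 by (simp add: field_simps)
  have divpi: "\<exists>q\<in>polys k. p = [:- a, 1:] * q \<and> poly p x = \<pi> * poly q x"
    if pk: "p \<in> polys k" "\<psi> (poly p x) = 0" for p
  proof -
    have "poly p a = 0" using \<psi>(2)[of "poly p x"] \<phi>(4)[of p] pk by (auto simp: adjoin_def)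
    then obtain q where q: "q \<in> polys k" "p = [:- a, 1:] * q"
      using polys_linear_factor[OF k_ring pk(1) ab(1)] by blast
    have "poly p x = \<pi> * poly q x" unfolding q(2) by (simp add: \<pi>_def algebra_simps)
    thus ?thesis using q by blast
  qed
  \<comment> \<open>If some coefficient of \<open>r\<close> survives at \<open>x = a\<close>,
    Eisenstein applies. Otherwise \<open>r\<close> can be divided by \<open>\<pi>\<close>, which
    replaces \<open>\<gamma>\<close> by its quotient by X - a; the degree of \<open>\<gamma>\<close>
    bounds the number of such divisions.\<close>
  show False
    using r \<gamma> unfolding z_def[symmetric]
  proof (induction "degree \<gamma>" arbitrary: r \<gamma> rule: less_induct)
    case less
    have coeff: "\<exists>p\<in>polys k. coeff r i = poly p x" for i
      using less.prems(1) by (auto simp: polys_def adjoin_def)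
    have div: "\<exists>d\<in>adjoin k x. coeff r i = \<pi> * d" if zero: "\<psi> (coeff r i) = 0" for i
    proof -
      obtain p where p: "p \<in> polys k" "coeff r i = poly p x" using coeff by blast
      have "\<psi> (poly p x) = 0" using zero p(2) by simp
      then obtain q where "q \<in> polys k" "poly p x = \<pi> * poly q x" using divpi[OF p(1)] by blast
      thus ?thesis using p by (auto simp: adjoin_def)
    qed
    show False
    proof (cases "\<exists>i. \<psi> (coeff r i) \<noteq> 0")
      case True
      then obtain i where i: "\<psi> (coeff r i) \<noteq> 0" by blast
      show False
      proof (rule eisenstein_no_relation[OF B \<psi>(1) \<pi>B zB wB' \<pi>0 v0 w0 zw _ less.prems(2,3) _ i])
        show "r \<in> polys B" using less.prems(1) polys_mono[OF sub] by blast
        show "\<exists>d\<in>B. coeff r i = \<pi> * d" if "\<psi> (coeff r i) = 0" for i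
          using div[OF that] sub by blast
      qed
    next
      case False
      have mem: "smult (inverse \<pi>) r \<in> polys (adjoin k x)"
        unfolding polys_def
      proof (intro CollectI allI)
        fix i
        obtain d where "d \<in> adjoin k x" "coeff r i = \<pi> * d" using div False by blast
        thus "coeff (smult (inverse \<pi>) r) i \<in> adjoin k x"
          using \<pi>0 by (simp flip: mult.assoc)
      qed
      have "\<psi> (poly \<gamma> x) = 0" using False by (simp flip: less.prems(6))
      then obtain q where q: "q \<in> polys k" "\<gamma> = [:- a, 1:] * q" "poly \<gamma> x = \<pi> * poly q x"
        using divpi[OF less.prems(4)] by blast
      have "q \<noteq> 0" using q(2) less.prems(5) by auto
      hence "degree q < degree \<gamma>" unfolding q(2) by (subst degree_mult_eq) auto
      moreover have "coeff (smult (inverse \<pi>) r) j = poly q x"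
        using q(3) less.prems(6) \<pi>0 by (simp flip: mult.assoc)
      ultimately show False
        using less.hyps[of q "smult (inverse \<pi>) r"] mem less.prems q(1) \<open>q \<noteq> 0\<close> \<pi>0 by simp
    qed
  qed
qed

text \<open>Shifting by \<open>a\<close>, reversing and clearing denominators turns \<open>r\<close>
  into a relation of \<open>1 / (y - a)\<close> over k[x]; none of these operations raises the
  degree.\<close>

lemma no_low_degree_relation:
  assumes y: "poly F y = 0" "y \<noteq> x" and r: "r \<in> polys E" "degree r < m - 1" "poly r y = 0"
  shows "r = 0"
proof (rule ccontr)
  assume "r \<noteq> 0"
  note E_ring = subfield_subring[OF E_field]
  define r1 where "r1 = pcompose r [:a, 1:]"
  define r2 where "r2 = reflect_poly r1"
  have ya: "y - a \<noteq> 0" using root_t_eq(1)[OF y(1)] by simp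
  have r1: "r1 \<in> polys E"
    unfolding r1_def using ab k_subset_E r(1)
    by (intro polys_pcompose[OF E_ring]) (auto simp: polys_pCons_iff[OF E_ring] polys_0[OF E_ring] subring_one[OF E_ring])
  have "degree r1 = degree r" unfolding r1_def by (simp add: degree_pcompose)
  have "r1 \<noteq> 0" unfolding r1_def using \<open>r \<noteq> 0\<close> pcompose_eq_0[of r "[:a, 1:]"] by auto
  have "poly r1 (y - a) = 0" unfolding r1_def using r(3) by (simp add: poly_pcompose)
  hence r2z: "poly r2 (inverse (y - a)) = 0"
    unfolding r2_def using ya by (subst poly_reflect_poly_nz) auto
  have r2: "r2 \<in> polys E" "degree r2 < m - 1" "r2 \<noteq> 0"
    unfolding r2_def using polys_reflect[OF E_ring r1] degree_reflect_poly_le[of r1] \<open>degree r1 = _\<close> r(2) \<open>r1 \<noteq> 0\<close> by auto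
  obtain d where d: "d \<noteq> 0" "smult d r2 \<in> polys (adjoin k x)"
    using polys_common_denominator[OF kx_ring] r2(1) unfolding E_def by blast
  have "smult d r2 \<noteq> 0" using d r2 by simp
  then obtain j where j: "coeff (smult d r2) j \<noteq> 0" by (metis leading_coeff_0_iff)
  obtain \<gamma> where \<gamma>: "\<gamma> \<in> polys k" "coeff (smult d r2) j = poly \<gamma> x"
    using d(2) by (auto simp: polys_def adjoin_def)
  show False
    by (rule no_low_degree_relation_aux[OF y d(2) _ _ \<gamma>(1) _ \<gamma>(2)]) (use r2 r2z d \<gamma> j in auto)
qed

text \<open>The cofactor \<open>H\<close> of X - x has degree m - 1, so by the previous lemma every
  polynomial over \<open>E\<close> vanishing at \<open>y\<close> is a multiple of \<open>H\<close>
  and vanishes at \<open>y'\<close> as well. Sending \<open>y\<close> to \<open>y'\<close> is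
  therefore well defined over \<open>E\<close>.\<close>

lemma gal_stabilizer_transitive:
  assumes y: "poly F y = 0" "y \<noteq> x" and y': "poly F y' = 0" "y' \<noteq> x"
  obtains \<sigma> where "\<sigma> \<in> gal K L" "\<sigma> x = x" "\<sigma> y = y'"
proof -
  note E_ring = subfield_subring[OF E_field]
  have FE: "F \<in> polys E" using F_polys polys_mono[OF K_subset_E] by auto
  obtain H where H: "H \<in> polys E" "F = [:- x, 1:] * H"
    using polys_linear_factor[OF E_ring FE x_in_E x] by blast
  have "H \<noteq> 0" using H(2) F_nz by auto
  hence dH: "degree H = m - 1"
    using degree_mult_eq[of "[:- x, 1:]" H] degree_F_poly[of t] unfolding H(2) by simp
  have H0: "poly H y = 0" "poly H y' = 0"
    using y y' unfolding H(2) by (auto simp del: mult_pCons_left)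
  have "poly (map_poly (\<lambda>c. c) p) y' = 0" if p: "p \<in> polys E" "poly p y = 0" for p
  proof -
    obtain q r where qr: "q \<in> polys E" "r \<in> polys E" "p = H * q + r" "r = 0 \<or> degree r < degree H"
      using polys_division[OF E_field H(1) \<open>H \<noteq> 0\<close> p(1)] by blast
    have "poly r y = 0" using p(2) qr(3) H0 by simp
    hence "r = 0" using no_low_degree_relation[OF y qr(2)] qr(4) dH by auto
    thus ?thesis using qr(3) H0 by simp
  qed
  then obtain \<tau> where \<tau>: "hom_on (adjoin E y) \<tau>" "\<And>c. c \<in> E \<Longrightarrow> \<tau> c = c" "\<tau> y = y'"
    using hom_extend_adjoin[OF E_ring hom_on_id] by blast
  obtain \<sigma> where \<sigma>: "\<sigma> \<in> gal K L" "\<And>c. c \<in> adjoin E y \<Longrightarrow> \<sigma> c = \<tau> c"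
  proof (rule gal_extend[OF _ _ _ \<tau>(1)])
    show "subfield_set (adjoin E y)" by (rule subfield_adjoin[OF E_field FE F_nz y(1)])
    show "K \<subseteq> adjoin E y" using K_subset_E adjoin_superset[OF E_ring, of y] by auto
    show "adjoin E y \<subseteq> L" using y roots_subset_L by (intro adjoin_least[OF subring_L E_subset_L]) auto
  qed (use K_subset_E \<tau>(2) in auto)
  have "\<sigma> x = x" "\<sigma> y = y'"
    using \<sigma>(2) \<tau>(2,3) x_in_E adjoin_superset[OF E_ring, of y] adjoin_self[OF E_ring, of y] by auto
  thus ?thesis using that \<sigma>(1) by blast
qed

end

end

subsection \<open>A transposition from a critical value\<close>

text \<open>With the parameter chosen to make the derivative vanish at \<open>c\<close>, the root
  condition becomes \<open>poly p c = 0\<close>. The leading coefficient m - 1 provides a root, and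
  the constant term \<open>b\<close> keeps it away from 0.\<close>

lemma (in trinomial) critical_point:
  obtains c where "c \<in> k" "c \<noteq> 0" "poly (F_poly m (of_nat m * c ^ (m - 1)) a b) c = 0"
proof -
  define p where "p = smult (of_nat (m - 1)) (monom 1 m) - smult (of_nat m * a) (monom 1 (m - 1)) + [:b:]"
  have "p \<in> polys k"
    unfolding p_def using ab
    by (simp add: polys_closed[OF k_ring] polys_pCons_iff[OF k_ring] k_simps del: smult_monom)
  moreover have "coeff p m = of_nat (m - 1)"
    using m(1) unfolding p_def by (auto simp: coeff_pCons split: nat.splits)
  hence "degree p > 0" using m le_degree[of p m] by auto
  ultimately obtain c where c: "c \<in> k" "poly p c = 0" using k_closed by blast
  have "c \<noteq> 0"
  proof
    assume "c = 0"
    hence "poly p c = b" using m(1) by (simp add: p_def poly_monom zero_power)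
    thus False using c ab by simp
  qed
  have cm: "c ^ m = c * c ^ (m - 1)" using m(1) by (cases m) auto
  have m1: "of_nat (m - 1) = (of_nat m - 1 :: 'a)" using m(1) by (simp add: of_nat_diff)
  have "poly (F_poly m (of_nat m * c ^ (m - 1)) a b) c + poly p c = 0"
    unfolding p_def m1 poly_F_poly by (simp add: poly_monom cm algebra_simps)
  hence "poly (F_poly m (of_nat m * c ^ (m - 1)) a b) c = 0" using c by simp
  thus ?thesis using that c \<open>c \<noteq> 0\<close> by blast
qed

locale trinomial_critical = trinomial +
  fixes c t0
  assumes c: "c \<in> k" "c \<noteq> 0" and t0_eq: "t0 = of_nat m * c ^ (m - 1)"
    and F0_c: "poly (F_poly m t0 a b) c = 0"
begin

abbreviation "F0 \<equiv> F_poly m t0 a b"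
abbreviation "rootsF \<equiv> {x. poly F x = 0}"

lemma t0_in_k: "t0 \<in> k"
  unfolding t0_eq using c by (simp add: k_simps)

lemma finite_X: "finite rootsF"
  by (rule poly_roots_finite[OF F_nz])

text \<open>Vanishing derivatives give \<open>v ^ (m - 1) = c ^ (m - 1)\<close>. With this power
  held fixed, \<open>F0\<close> is affine in the remaining variable with slope -(m - 1) c^(m-1),
  which is nonzero, so it has one zero.\<close>

lemma double_root_unique:
  assumes v: "poly F0 v = 0" "poly (pderiv F0) v = 0"
  shows "v = c"
proof -
  have m1: "of_nat (m - 1) = (of_nat m - 1 :: 'a)" using m(1) by (simp add: of_nat_diff)
  have "of_nat m * v ^ (m - 1) = of_nat m * c ^ (m - 1)"
    using v(2) by (simp add: poly_pderiv_F_poly t0_eq)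
  hence e: "v ^ (m - 1) = c ^ (m - 1)" using m(2) by simp
  have pw: "u ^ m = u * u ^ (m - 1)" for u :: 'a using m(1) by (cases m) auto
  have "0 = poly F0 c - poly F0 v" using v F0_c by simp
  also have "\<dots> = (v - c) * (c ^ (m - 1) * of_nat (m - 1))"
    unfolding poly_F_poly pw e t0_eq m1 by (simp add: algebra_simps)
  finally show ?thesis using c m by simp
qed

lemma pderiv2_F0_c: "poly (pderiv (pderiv F0)) c \<noteq> 0"
proof -
  have "poly (pderiv (pderiv F0)) c = of_nat m * (of_nat (m - 1) * c ^ (m - 2))"
    unfolding F_poly_altdef
    by (simp add: pderiv_add pderiv_monom poly_monom pderiv_pCons numeral_2_eq_2)
  thus ?thesis using m c by simp
qed

lemma pderiv_F0_c: "poly (pderiv F0) c = 0"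
  by (simp add: poly_pderiv_F_poly t0_eq)

text \<open>Built over k[t] and not over \<open>K\<close>, because sending \<open>t\<close> to
  \<open>t0\<close> is defined on k[t] only.\<close>

definition B where "B = adjoin_list (adjoin k t) xs"

lemma B_ring: "subring_set B"
  unfolding B_def by (rule subring_adjoin_list[OF kt_ring])

lemma kt_subset_B: "adjoin k t \<subseteq> B"
  unfolding B_def by (rule adjoin_list_superset[OF kt_ring])

lemma k_subset_B: "k \<subseteq> B" and t_in_B: "t \<in> B"
  using kt_subset_B adjoin_superset[OF k_ring, of t] adjoin_self[OF k_ring, of t] by auto

lemma roots_subset_B: "rootsF \<subseteq> B"
  unfolding B_def using adjoin_list_mem[OF kt_ring, of xs] xs by auto

lemma B_least: "subring_set S \<Longrightarrow> k \<subseteq> S \<Longrightarrow> t \<in> S \<Longrightarrow> rootsF \<subseteq> S \<Longrightarrow> B \<subseteq> S"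
  unfolding B_def using xs by (intro adjoin_list_least adjoin_least) auto

lemma B_subset_L: "B \<subseteq> L"
  by (rule B_least[OF subring_L k_subset_L t_in_L roots_subset_L])

lemma gal_mem_B:
  assumes \<sigma>: "\<sigma> \<in> gal K L" and z: "z \<in> B"
  shows "\<sigma> z \<in> B"
proof -
  have "subring_set {z \<in> L. \<sigma> z \<in> B}"
    unfolding subring_set_def
    by (auto simp: subring_closed[OF subring_L] subring_closed[OF B_ring] hom_simps[OF subring_L gal_hom[OF \<sigma>]])
  moreover have "\<sigma> x \<in> rootsF" if "x \<in> rootsF" for x using bij_betw_apply[OF gal_bij_roots[OF \<sigma>] that] .
  moreover have "\<sigma> z = z" if "z \<in> k" for z using gal_fix[OF \<sigma>] k_subset_K that by blast
  ultimately have "B \<subseteq> {z \<in> L. \<sigma> z \<in> B}"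
    using k_subset_L t_in_L roots_subset_L k_subset_B t_in_B roots_subset_B gal_fix[OF \<sigma> t_in_K]
    by (intro B_least) auto
  thus ?thesis using z by auto
qed

text \<open>\<open>F\<close> is monic over k[t], so the specialization at \<open>t0\<close> extends
  to all its roots. Their values are roots of \<open>F0\<close>, hence in \<open>k\<close>, and the
  residue field does not grow.\<close>

lemma specialization_exists:
  obtains \<phi> where "hom_on B \<phi>" "\<And>x. x \<in> k \<Longrightarrow> \<phi> x = x" "\<phi> t = t0" "\<And>z. z \<in> B \<Longrightarrow> \<phi> z \<in> k"
proof -
  have "poly (map_poly (\<lambda>c. c) p) t0 = 0" if "p \<in> polys k" "poly p t = 0" for p
    using t_transcendental[OF that] by simp
  then obtain \<phi>0 where \<phi>0: "hom_on (adjoin k t) \<phi>0" "\<And>c. c \<in> k \<Longrightarrow> \<phi>0 c = c" "\<phi>0 t = t0"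
    using hom_extend_adjoin[OF k_ring hom_on_id] by blast
  have "\<phi>0 ` k = k" using \<phi>0(2) by force
  hence "\<phi>0 ` adjoin k t = adjoin k t0" using hom_image_adjoin[OF k_ring \<phi>0(1)] \<phi>0(3) by simp
  also have "\<dots> = k" using adjoin_least[OF k_ring subset_refl t0_in_k] adjoin_superset[OF k_ring, of t0] by auto
  finally have img: "\<phi>0 ` adjoin k t = k" .
  have "F \<in> polys (adjoin k t)"
    using adjoin_superset[OF k_ring, of t] adjoin_self[OF k_ring, of t] by (rule F_poly_polys[OF kt_ring])
  hence "\<exists>f\<in>polys (adjoin k t). \<phi>0 (lead_coeff f) \<noteq> 0 \<and> poly f x = 0" if "x \<in> set xs" for x
    using that xs lead_coeff_F_poly[of t] hom_one[OF kt_ring \<phi>0(1)] by (intro bexI[of _ F]) auto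
  then obtain \<phi> where \<phi>: "hom_on B \<phi>" "\<And>z. z \<in> adjoin k t \<Longrightarrow> \<phi> z = \<phi>0 z"
    using hom_extend_adjoin_list[OF kt_ring \<phi>0(1)] k unfolding img B_def by blast
  have \<phi>k: "\<phi> x = x" if "x \<in> k" for x using \<phi>(2) \<phi>0(2) that adjoin_superset[OF k_ring, of t] by auto
  have \<phi>t: "\<phi> t = t0" using \<phi>(2) \<phi>0(3) adjoin_self[OF k_ring, of t] by auto
  have root: "\<phi> x \<in> k" if x: "poly F x = 0" for x
  proof -
    have "x \<in> B" "a \<in> B" "b \<in> B" using x roots_subset_B ab k_subset_B by auto
    hence "\<phi> (poly F x) = poly F0 (\<phi> x)"
      using ab by (simp add: poly_F_poly hom_simps[OF B_ring \<phi>(1)] subring_closed[OF B_ring] t_in_B \<phi>k \<phi>t)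
    hence "poly F0 (\<phi> x) = 0" using x hom_zero[OF B_ring \<phi>(1)] by simp
    thus ?thesis using k_root_mem F_poly_polys[OF k_ring subset_refl t0_in_k] F_nz by blast
  qed
  have "subring_set {z \<in> B. \<phi> z \<in> k}"
    unfolding subring_set_def
    by (auto simp: subring_closed[OF B_ring] k_simps hom_simps[OF B_ring \<phi>(1)])
  hence "B \<subseteq> {z \<in> B. \<phi> z \<in> k}"
    using k_subset_B t_in_B roots_subset_B \<phi>k \<phi>t t0_in_k root by (intro B_least) auto
  thus ?thesis using that[of \<phi>] \<phi>(1) \<phi>k \<phi>t by auto
qed

section \<open>Inertia at a place above the critical value\<close>

context
  fixes \<phi>
  assumes \<phi>: "hom_on B \<phi>" and \<phi>k: "\<And>x. x \<in> k \<Longrightarrow> \<phi> x = x" and \<phi>t: "\<phi> t = t0"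
    and \<phi>B: "\<And>z. z \<in> B \<Longrightarrow> \<phi> z \<in> k"
begin

lemmas \<phi>_simps = hom_simps[OF B_ring \<phi>]
lemmas B_simps = subring_closed[OF B_ring]

text \<open>The reduction of the splitting of \<open>F\<close>, verified by evaluating both sides at
  the infinitely many points of \<open>k\<close>, which \<phi> fixes.\<close>

lemma F0_factorization: "F0 = (\<Prod>x\<in>rootsF. [:- \<phi> x, 1:])"
proof (rule ccontr)
  assume "F0 \<noteq> (\<Prod>x\<in>rootsF. [:- \<phi> x, 1:])"
  hence nz: "F0 - (\<Prod>x\<in>rootsF. [:- \<phi> x, 1:]) \<noteq> 0" by simp
  have "poly (F0 - (\<Prod>x\<in>rootsF. [:- \<phi> x, 1:])) v = 0" if v: "v \<in> k" for v
  proof -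
    have mem: "v \<in> B" "a \<in> B" "b \<in> B" using v ab k_subset_B by auto
    have "F = (\<Prod>x\<in>rootsF. [:- x, 1:])"
      using separable_poly_split[OF F_separable] lead_coeff_F_poly[of t] by simp
    hence "poly F v = poly (\<Prod>x\<in>rootsF. [:- x, 1:]) v" by (rule arg_cong)
    also have "\<dots> = (\<Prod>x\<in>rootsF. v - x)" by (simp add: poly_prod)
    finally have "poly F v = (\<Prod>x\<in>rootsF. v - x)" .
    hence "\<phi> (v ^ m - t * (v - a) - b) = \<phi> (\<Prod>x\<in>rootsF. v - x)" unfolding poly_F_poly by (rule arg_cong)
    also have "\<dots> = (\<Prod>x\<in>rootsF. \<phi> (v - x))"
      using mem roots_subset_B by (intro hom_prod[OF B_ring \<phi>]) (auto simp: B_simps)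
    also have "\<dots> = (\<Prod>x\<in>rootsF. v - \<phi> x)"
      using mem roots_subset_B v by (intro prod.cong) (auto simp: \<phi>_simps \<phi>k)
    also have "\<phi> (v ^ m - t * (v - a) - b) = poly F0 v"
      using mem v ab by (simp add: \<phi>_simps B_simps t_in_B \<phi>k \<phi>t poly_F_poly)
    finally show ?thesis by (simp add: poly_prod)
  qed
  hence "k \<subseteq> {v. poly (F0 - (\<Prod>x\<in>rootsF. [:- \<phi> x, 1:])) v = 0}" by auto
  thus False using poly_roots_finite[OF nz] infinite_k finite_subset by blast
qed

lemma F0_factor_pair:
  assumes "x \<in> rootsF" "y \<in> rootsF" "x \<noteq> y"
  shows "F0 = [:- \<phi> x, 1:] * ([:- \<phi> y, 1:] * (\<Prod>z\<in>rootsF - {x, y}. [:- \<phi> z, 1:]))"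
proof -
  have "F0 = [:- \<phi> x, 1:] * (\<Prod>z\<in>rootsF - {x}. [:- \<phi> z, 1:])"
    unfolding F0_factorization by (rule prod.remove[OF finite_X assms(1)])
  also have "(\<Prod>z\<in>rootsF - {x}. [:- \<phi> z, 1:]) = [:- \<phi> y, 1:] * (\<Prod>z\<in>rootsF - {x} - {y}. [:- \<phi> z, 1:])"
    by (rule prod.remove) (use finite_X assms in auto)
  also have "rootsF - {x} - {y} = rootsF - {x, y}" by auto
  finally show ?thesis .
qed

lemma collision_at_c:
  assumes "x \<in> rootsF" "y \<in> rootsF" "x \<noteq> y" "\<phi> x = \<phi> y"
  shows "\<phi> x = c"
proof (rule double_root_unique)
  define P where "P = (\<Prod>z\<in>rootsF - {x, y}. [:- \<phi> z, 1:])"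
  have F0: "F0 = [:- \<phi> x, 1:] * ([:- \<phi> x, 1:] * P)"
    using F0_factor_pair[OF assms(1-3)] assms(4) by (simp add: P_def)
  show "poly F0 (\<phi> x) = 0" "poly (pderiv F0) (\<phi> x) = 0"
    unfolding F0 by (simp_all only: pderiv_mult poly_mult poly_add) simp_all
qed

text \<open>\<open>F0\<close> and its derivative vanish at \<open>c\<close>, which yields two roots
  of \<open>F\<close> above \<open>c\<close>; a third would make the second derivative vanish there
  too.\<close>

lemma collision_pair:
  obtains x y where "x \<in> rootsF" "y \<in> rootsF" "x \<noteq> y" "\<phi> x = c" "\<phi> y = c"
    "\<And>z. z \<in> rootsF \<Longrightarrow> \<phi> z = c \<Longrightarrow> z = x \<or> z = y"
proof -
  have "(\<Prod>z\<in>rootsF. c - \<phi> z) = 0" using F0_c unfolding F0_factorization by (simp add: poly_prod)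
  then obtain x where x: "x \<in> rootsF" "\<phi> x = c" using finite_X by (auto simp: prod_zero_iff)
  define P where "P = (\<Prod>z\<in>rootsF - {x}. [:- \<phi> z, 1:])"
  have F0: "F0 = [:- c, 1:] * P"
    unfolding F0_factorization P_def using prod.remove[OF finite_X x(1), of "\<lambda>z. [:- \<phi> z, 1:]"] x(2) by simp
  have "poly (pderiv F0) c = poly P c"
    unfolding F0 by (simp only: pderiv_mult poly_mult poly_add) (simp add: pderiv_pCons)
  hence "(\<Prod>z\<in>rootsF - {x}. c - \<phi> z) = 0" using pderiv_F0_c by (simp add: P_def poly_prod)
  then obtain y where y: "y \<in> rootsF" "y \<noteq> x" "\<phi> y = c" using finite_X by (auto simp: prod_zero_iff)
  have "z = x \<or> z = y" if z: "z \<in> rootsF" "\<phi> z = c" for z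
  proof (rule ccontr)
    assume "\<not> (z = x \<or> z = y)"
    hence "z \<in> rootsF - {x, y}" using z by auto
    define Q where "Q = (\<Prod>u\<in>rootsF - {x, y} - {z}. [:- \<phi> u, 1:])"
    have "(\<Prod>u\<in>rootsF - {x, y}. [:- \<phi> u, 1:]) = [:- c, 1:] * Q"
      unfolding Q_def using finite_X z(2)
      by (subst prod.remove[OF _ \<open>z \<in> rootsF - {x, y}\<close>]) auto
    hence F0: "F0 = [:- c, 1:] * ([:- c, 1:] * ([:- c, 1:] * Q))"
      using F0_factor_pair[OF x(1) y(1)] x y by auto
    have "poly (pderiv (pderiv F0)) c = 0"
      unfolding F0 by (simp only: pderiv_mult poly_mult poly_add pderiv_add) simp
    thus False using pderiv2_F0_c by simp
  qed
  thus ?thesis using that x y by blast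
qed

text \<open>\<open>vanishes_to_first_order z\<close> says that \<open>z\<close> is a multiple of \<open>t - t0\<close> in the localization
  of \<open>B\<close> at the kernel of \<open>\<phi>\<close>.\<close>

definition vanishes_to_first_order :: "'a \<Rightarrow> bool" where
  "vanishes_to_first_order z \<longleftrightarrow> (\<exists>u\<in>B. \<exists>r\<in>B. \<phi> u \<noteq> 0 \<and> u * z = (t - t0) * r)"

lemma vanishes_diff:
  assumes "vanishes_to_first_order y" "vanishes_to_first_order z"
  shows "vanishes_to_first_order (y - z)"
proof -
  obtain u r v s where *: "u \<in> B" "r \<in> B" "\<phi> u \<noteq> 0" "u * y = (t - t0) * r"
    "v \<in> B" "s \<in> B" "\<phi> v \<noteq> 0" "v * z = (t - t0) * s"
    using assms by (auto simp: vanishes_to_first_order_def)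
  have "u * v * (y - z) = v * (u * y) - u * (v * z)" by (simp add: algebra_simps)
  also have "\<dots> = (t - t0) * (v * r - u * s)" unfolding *(4,8) by (simp add: algebra_simps)
  finally show ?thesis
    unfolding vanishes_to_first_order_def using *
    by (intro bexI[of _ "u * v"] bexI[of _ "v * r - u * s"]) (auto simp: B_simps \<phi>_simps)
qed

lemma vanishes_cancel:
  assumes "vanishes_to_first_order (e * z)" "e \<in> B" "\<phi> e \<noteq> 0"
  shows "vanishes_to_first_order z"
proof -
  obtain u r where *: "u \<in> B" "r \<in> B" "\<phi> u \<noteq> 0" "u * (e * z) = (t - t0) * r"
    using assms by (auto simp: vanishes_to_first_order_def)
  thus ?thesis
    unfolding vanishes_to_first_order_def using assms
    by (intro bexI[of _ "u * e"] bexI[of _ r]) (auto simp: B_simps \<phi>_simps mult.assoc)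
qed

lemma t_neq_t0: "t \<noteq> t0"
  using t_notin_k t0_in_k by auto

text \<open>In a fraction of polynomials in \<open>t\<close>, the denominator may vanish at
  \<open>t0\<close> although the element lies in \<open>B\<close>. The numerator then vanishes too,
  so the common factor \<open>t - t0\<close> is cancelled until the denominator survives
  reduction.\<close>

lemma vanishes_in_K:
  assumes z: "z \<in> K" "z \<in> B" "\<phi> z = 0"
  shows "vanishes_to_first_order z"
proof -
  have val: "poly p t \<in> B" "\<phi> (poly p t) = poly p t0" if p: "p \<in> polys k" for p
  proof -
    show "poly p t \<in> B" using p polys_mono[OF k_subset_B] t_in_B by (intro poly_closed[OF B_ring]) auto
    show "\<phi> (poly p t) = poly p t0"
      using hom_poly[OF B_ring \<phi> _ t_in_B, of p] p polys_mono[OF k_subset_B] map_poly_fixed[OF p \<phi>k] \<phi>t by auto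
  qed
  obtain p q where "p \<in> polys k" "q \<in> polys k" "poly q t \<noteq> 0" "z = poly p t / poly q t"
    using z(1) by (auto simp: K_def fractions_def adjoin_def)
  hence "q \<noteq> 0" "poly q t * z = poly p t" by auto
  thus ?thesis
    using \<open>p \<in> polys k\<close> \<open>q \<in> polys k\<close>
  proof (induction "degree q" arbitrary: p q rule: less_induct)
    case less
    note p = val[OF less.prems(3)] and q = val[OF less.prems(4)]
    have "poly p t0 = 0"
      using arg_cong[OF less.prems(2), of \<phi>] p q z by (simp add: \<phi>_simps)
    then obtain p' where p': "p' \<in> polys k" "p = [:- t0, 1:] * p'"
      using polys_linear_factor[OF k_ring less.prems(3) t0_in_k] by blast
    have pt: "poly p t = (t - t0) * poly p' t" unfolding p'(2) by (simp add: algebra_simps)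
    show ?case
    proof (cases "poly q t0 = 0")
      case True
      then obtain q' where q': "q' \<in> polys k" "q = [:- t0, 1:] * q'"
        using polys_linear_factor[OF k_ring less.prems(4) t0_in_k] by blast
      have qt: "poly q t = (t - t0) * poly q' t" unfolding q'(2) by (simp add: algebra_simps)
      have "q' \<noteq> 0" using q'(2) less.prems(1) by auto
      moreover from this have "degree q' < degree q" unfolding q'(2) by (subst degree_mult_eq) auto
      moreover have "poly q' t * z = poly p' t"
        using less.prems(2) t_neq_t0 unfolding pt qt by simp
      ultimately show ?thesis using less.hyps p'(1) q'(1) by blast
    next
      case False
      thus ?thesis
        unfolding vanishes_to_first_order_def using less.prems(2) pt q val(1)[OF p'(1)]
        by (intro bexI[of _ "poly q t"] bexI[of _ "poly p' t"]) auto
    qed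
  qed
qed

abbreviation "ident \<equiv> restrict (\<lambda>x. x) L"

text \<open>The norm of \<open>w\<close> is \<open>w\<close> times the product \<open>M\<close> of
  its other conjugates. It lies in \<open>K\<close> and reduces to 0, so
  \<open>vanishes_in_K\<close> applies to it, and \<open>M\<close> can be cancelled because its
  reduction is nonzero.\<close>

lemma vanishes_if_conjugates_do_not:
  assumes w: "w \<in> B" "\<phi> w = 0" and conj: "\<And>\<sigma>. \<sigma> \<in> gal K L - {ident} \<Longrightarrow> \<phi> (\<sigma> w) \<noteq> 0"
  shows "vanishes_to_first_order w"
proof -
  define M where "M = (\<Prod>\<sigma>\<in>gal K L - {ident}. \<sigma> w)"
  have wL: "w \<in> L" using w B_subset_L by auto
  have MB: "M \<in> B" unfolding M_def using w gal_mem_B by (intro subring_prod[OF B_ring]) auto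
  have "(\<Prod>\<sigma>\<in>gal K L. \<sigma> w) = ident w * M"
    unfolding M_def by (rule prod.remove[OF finite_gal gal_identity])
  hence N: "(\<Prod>\<sigma>\<in>gal K L. \<sigma> w) = M * w" using wL by simp
  have "vanishes_to_first_order (M * w)"
  proof (rule vanishes_in_K)
    show "M * w \<in> K" using gal_norm_in_K[OF F_separable wL] N by simp
  qed (use MB w in \<open>auto simp: B_simps \<phi>_simps\<close>)
  moreover have "\<phi> M = (\<Prod>\<sigma>\<in>gal K L - {ident}. \<phi> (\<sigma> w))"
    unfolding M_def using w gal_mem_B by (intro hom_prod[OF B_ring \<phi>]) auto
  hence "\<phi> M \<noteq> 0" using conj finite_gal by (simp add: prod_zero_iff)
  ultimately show ?thesis using vanishes_cancel MB by blast
qed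

text \<open>If no nontrivial automorphism preserved \<open>\<phi>\<close> on the roots, then \<open>t - t0\<close> would be a
  uniformizer at the kernel of \<open>\<phi>\<close>, although the equation of the double root
  \<open>x\<close> reads \<open>(x - c)\<^sup>2 \<cdot> unit = (t - t0) \<cdot> unit\<close>.\<close>

lemma exists_inertia:
  obtains \<sigma> where "\<sigma> \<in> gal K L" "\<sigma> \<noteq> ident" "\<And>x. x \<in> rootsF \<Longrightarrow> \<phi> (\<sigma> x) = \<phi> x"
proof (rule ccontr)
  assume "\<not> thesis"
  hence "\<forall>\<sigma>\<in>gal K L - {ident}. \<exists>x\<in>rootsF. \<phi> (\<sigma> x) \<noteq> \<phi> x" using that by blast
  \<comment> \<open>\<open>\<xi> \<sigma>\<close> is a root whose reduction is changed by \<sigma>;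
    the constant \<open>d \<sigma>\<close> below is the reduction of its image.\<close>
  then obtain \<xi> where \<xi>: "\<And>\<sigma>. \<sigma> \<in> gal K L - {ident} \<Longrightarrow> \<xi> \<sigma> \<in> rootsF \<and> \<phi> (\<sigma> (\<xi> \<sigma>)) \<noteq> \<phi> (\<xi> \<sigma>)"
    by metis
  define d where "d \<sigma> = \<phi> (\<sigma> (\<xi> \<sigma>))" for \<sigma>
  have \<xi>B: "\<xi> \<sigma> \<in> B" and dk: "d \<sigma> \<in> k" and dB: "d \<sigma> \<in> B" if "\<sigma> \<in> gal K L - {ident}" for \<sigma>
  proof -
    show "\<xi> \<sigma> \<in> B" using \<xi>[OF that] roots_subset_B by auto
    thus "d \<sigma> \<in> k" unfolding d_def using \<phi>B gal_mem_B that by auto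
    thus "d \<sigma> \<in> B" using k_subset_B by auto
  qed
  \<comment> \<open>Each factor has nonzero reduction, but applying its own \<sigma> makes it reduce
    to 0. After rescaling, \<open>e\<close> reduces to 1 and all its nontrivial conjugates reduce to
    0.\<close>
  define e0 where "e0 = (\<Prod>\<sigma>\<in>gal K L - {ident}. \<xi> \<sigma> - d \<sigma>)"
  have e0B: "e0 \<in> B" unfolding e0_def using \<xi>B dB by (intro subring_prod[OF B_ring] subring_diff[OF B_ring]) auto
  have "\<phi> e0 = (\<Prod>\<sigma>\<in>gal K L - {ident}. \<phi> (\<xi> \<sigma>) - d \<sigma>)"
    unfolding e0_def using \<xi>B dB dk by (subst hom_prod[OF B_ring \<phi>]) (auto simp: B_simps \<phi>_simps \<phi>k)
  moreover have "\<phi> (\<xi> \<sigma>) - d \<sigma> \<noteq> 0" if "\<sigma> \<in> gal K L - {ident}" for \<sigma>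
    using \<xi>[OF that] by (auto simp: d_def)
  ultimately have e0: "\<phi> e0 \<noteq> 0" using finite_gal by (simp add: prod_zero_iff)
  have "inverse (\<phi> e0) \<in> k" by (rule subfield_inverse[OF k \<phi>B[OF e0B]])
  define e where "e = inverse (\<phi> e0) * e0"
  have iB: "inverse (\<phi> e0) \<in> B" using \<open>inverse (\<phi> e0) \<in> k\<close> k_subset_B by auto
  have eB: "e \<in> B" unfolding e_def by (rule subring_mult[OF B_ring iB e0B])
  have \<phi>e: "\<phi> e = 1" unfolding e_def using iB e0B e0 \<open>inverse (\<phi> e0) \<in> k\<close> by (simp add: \<phi>_simps \<phi>k)
  have \<sigma>e: "\<phi> (\<sigma> e) = 0" if \<sigma>: "\<sigma> \<in> gal K L - {ident}" for \<sigma>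
  proof -
    have hom: "hom_on L \<sigma>" using \<sigma> gal_hom by auto
    note \<sigma>_simps = hom_simps[OF subring_L hom]
    have fixed: "\<sigma> z = z" if "z \<in> k" for z using gal_fix[of \<sigma> K L z] \<sigma> that k_subset_K by auto
    define R where "R = (\<Prod>\<tau>\<in>gal K L - {ident} - {\<sigma>}. \<xi> \<tau> - d \<tau>)"
    have RB: "R \<in> B" unfolding R_def using \<xi>B dB by (intro subring_prod[OF B_ring] subring_diff[OF B_ring]) auto
    have "e0 = (\<xi> \<sigma> - d \<sigma>) * R" unfolding e0_def R_def using \<sigma> finite_gal by (intro prod.remove) auto
    hence "e = inverse (\<phi> e0) * ((\<xi> \<sigma> - d \<sigma>) * R)" by (simp add: e_def)
    moreover have L: "inverse (\<phi> e0) \<in> L" "\<xi> \<sigma> \<in> L" "d \<sigma> \<in> L" "R \<in> L"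
      using iB \<xi>B[OF \<sigma>] dB[OF \<sigma>] RB B_subset_L by auto
    ultimately have "\<sigma> e = inverse (\<phi> e0) * ((\<sigma> (\<xi> \<sigma>) - d \<sigma>) * \<sigma> R)"
      using fixed[OF \<open>inverse (\<phi> e0) \<in> k\<close>] fixed[OF dk[OF \<sigma>]]
      by (simp add: \<sigma>_simps subring_closed[OF subring_L])
    moreover have "\<sigma> (\<xi> \<sigma>) \<in> B" "\<sigma> R \<in> B" using gal_mem_B \<sigma> \<xi>B[OF \<sigma>] RB by auto
    ultimately show ?thesis
      using iB dB[OF \<sigma>] \<phi>k[OF dk[OF \<sigma>]] by (simp add: \<phi>_simps B_simps) (simp add: d_def)
  qed
  \<comment> \<open>\<open>e * z - 1\<close> reduces to 0, while each nontrivial conjugate reduces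
    to -1; this is exactly what the norm argument requires.\<close>
  have vanish: "vanishes_to_first_order (e * z - 1)" if z: "z \<in> B" "\<phi> z = 1" for z
  proof (rule vanishes_if_conjugates_do_not)
    show "e * z - 1 \<in> B" using eB z by (simp add: B_simps)
    show "\<phi> (e * z - 1) = 0" using eB z \<phi>e by (simp add: \<phi>_simps B_simps)
    fix \<sigma> assume \<sigma>: "\<sigma> \<in> gal K L - {ident}"
    hence hom: "hom_on L \<sigma>" using gal_hom by auto
    have "e \<in> L" "z \<in> L" using eB z B_subset_L by auto
    hence "\<sigma> (e * z - 1) = \<sigma> e * \<sigma> z - 1"
      by (simp add: hom_simps[OF subring_L hom] subring_closed[OF subring_L])
    moreover have "\<sigma> e \<in> B" "\<sigma> z \<in> B" using gal_mem_B \<sigma> eB z by auto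
    ultimately show "\<phi> (\<sigma> (e * z - 1)) \<noteq> 0" using \<sigma>e[OF \<sigma>] by (simp add: \<phi>_simps B_simps)
  qed
  obtain x y where xy: "x \<in> rootsF" "y \<in> rootsF" "x \<noteq> y" "\<phi> x = c" "\<phi> y = c"
    using collision_pair by blast
  have xB: "x \<in> B" and cB: "c \<in> B" and aB: "a \<in> B" and t0B: "t0 \<in> B"
    using xy(1) roots_subset_B c(1) ab(1) t0_in_k k_subset_B by auto
  \<comment> \<open>\<open>vanish\<close> is applied to \<open>x - c + 1\<close> and to 1, both of
    which reduce to 1; the difference is \<open>e * (x - c)\<close>.\<close>
  have "vanishes_to_first_order ((e * (x - c + 1) - 1) - (e * 1 - 1))"
    using xB cB xy(4) \<phi>k[OF c(1)] by (intro vanishes_diff vanish) (auto simp: \<phi>_simps B_simps)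
  hence "vanishes_to_first_order (e * (x - c))" by (simp add: algebra_simps)
  hence "vanishes_to_first_order (x - c)" using vanishes_cancel eB \<phi>e by simp
  then obtain u r where u: "u \<in> B" "r \<in> B" "\<phi> u \<noteq> 0" "u * (x - c) = (t - t0) * r"
    by (auto simp: vanishes_to_first_order_def)
  define g where "g = poly (\<Prod>z\<in>rootsF - {x, y}. [:- \<phi> z, 1:]) x"
  have gB: "g \<in> B"
    unfolding g_def poly_prod using xB \<phi>B roots_subset_B k_subset_B
    by (intro subring_prod[OF B_ring]) (auto simp: intro!: subring_diff[OF B_ring])
  have "poly F0 x = (x - c) ^ 2 * g"
    unfolding F0_factor_pair[OF xy(1-3)] xy(4,5) g_def by (simp add: power2_eq_square algebra_simps)
  moreover have "poly F0 x = (t - t0) * (x - a)" using xy(1) by (simp add: poly_F_poly algebra_simps)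
  ultimately have "u ^ 2 * ((t - t0) * (x - a)) = (u * (x - c)) ^ 2 * g" by (simp add: power_mult_distrib)
  also have "\<dots> = (t - t0) * ((t - t0) * (r ^ 2 * g))" unfolding u(4) by (simp add: power2_eq_square)
  finally have "(t - t0) * (u ^ 2 * (x - a)) = (t - t0) * ((t - t0) * (r ^ 2 * g))" by (simp only: mult_ac)
  \<comment> \<open>One factor \<open>t - t0\<close> is cancelled and another remains on the right,
    so the left side reduces to 0. Its actual reduction is \<open>\<phi> u ^ 2 * (c - a)\<close>,
    which is nonzero.\<close>
  hence "u ^ 2 * (x - a) = (t - t0) * (r ^ 2 * g)" using t_neq_t0 by simp
  hence "\<phi> (u ^ 2 * (x - a)) = 0"
    using u gB t_in_B t0B \<phi>t \<phi>k[OF t0_in_k] by (simp add: \<phi>_simps B_simps)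
  hence "\<phi> u ^ 2 * (c - a) = 0" using u xB aB xy(4) \<phi>k[OF ab(1)] by (simp add: \<phi>_simps B_simps)
  moreover have "c \<noteq> a" using F0_c F_at_a by auto
  ultimately show False using u(3) by simp
qed

text \<open>An inertia element can move a root only to one with the same reduction. Only the two
  roots above \<open>c\<close> share a reduction, so being nontrivial it must swap them.\<close>

lemma exists_transposition_aux:
  obtains \<tau> x y where "\<tau> \<in> gal K L" "x \<in> rootsF" "y \<in> rootsF" "x \<noteq> y" "\<tau> x = y" "\<tau> y = x"
    "\<And>z. z \<in> rootsF \<Longrightarrow> z \<noteq> x \<Longrightarrow> z \<noteq> y \<Longrightarrow> \<tau> z = z"
proof -
  obtain \<sigma> where \<sigma>: "\<sigma> \<in> gal K L" "\<sigma> \<noteq> ident" "\<And>x. x \<in> rootsF \<Longrightarrow> \<phi> (\<sigma> x) = \<phi> x"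
    using exists_inertia by blast
  obtain x y where xy: "x \<in> rootsF" "y \<in> rootsF" "x \<noteq> y" "\<phi> x = c" "\<phi> y = c"
    "\<And>z. z \<in> rootsF \<Longrightarrow> \<phi> z = c \<Longrightarrow> z = x \<or> z = y"
    using collision_pair by blast
  have bij: "bij_betw \<sigma> rootsF rootsF" by (rule gal_bij_roots[OF \<sigma>(1)])
  have mem: "\<sigma> z \<in> rootsF" if "z \<in> rootsF" for z using bij_betw_apply[OF bij that] .
  have inj: "\<sigma> u = \<sigma> v \<Longrightarrow> u = v" if "u \<in> rootsF" "v \<in> rootsF" for u v
    using bij that by (auto simp: bij_betw_def dest: inj_onD)
  have other: "\<sigma> z = z" if z: "z \<in> rootsF" "z \<noteq> x" "z \<noteq> y" for z
  proof (rule ccontr)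
    assume "\<sigma> z \<noteq> z"
    hence "\<phi> (\<sigma> z) = c" using collision_at_c[OF mem[OF z(1)] z(1)] \<sigma>(3)[OF z(1)] by simp
    thus False using xy(6)[OF z(1)] \<sigma>(3)[OF z(1)] z by auto
  qed
  have sx: "\<sigma> x = x \<or> \<sigma> x = y" and sy: "\<sigma> y = x \<or> \<sigma> y = y"
    using xy(6) mem \<sigma>(3) xy(1,2,4,5) by auto
  have "\<sigma> x \<noteq> x"
  proof
    assume "\<sigma> x = x"
    hence "\<sigma> y = y" using sy inj[OF xy(1,2)] xy(3) by auto
    hence "\<sigma> z = ident z" if "poly F z = 0" for z
      using other[of z] that \<open>\<sigma> x = x\<close> roots_subset_L by auto
    hence "\<sigma> = ident" by (rule gal_eqI[OF \<sigma>(1) gal_identity])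
    thus False using \<sigma>(2) by simp
  qed
  hence "\<sigma> x = y" using sx by simp
  moreover from this have "\<sigma> y = x" using sy inj[OF xy(1,2)] xy(3) by auto
  ultimately show ?thesis using that[OF \<sigma>(1) xy(1-3)] other by blast
qed

end

end

context trinomial
begin

lemma exists_transposition:
  obtains \<tau> x y where "\<tau> \<in> gal K L" "poly F x = 0" "poly F y = 0" "x \<noteq> y" "\<tau> x = y" "\<tau> y = x"
    "\<And>z. poly F z = 0 \<Longrightarrow> z \<noteq> x \<Longrightarrow> z \<noteq> y \<Longrightarrow> \<tau> z = z"
proof -
  obtain c where c: "c \<in> k" "c \<noteq> 0" "poly (F_poly m (of_nat m * c ^ (m - 1)) a b) c = 0"
    using critical_point by blast
  interpret crit: trinomial_critical k t a b m c "of_nat m * c ^ (m - 1)"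
    by unfold_locales (use c in auto)
  obtain \<phi> where "hom_on crit.B \<phi>" "\<And>x. x \<in> k \<Longrightarrow> \<phi> x = x" "\<phi> t = of_nat m * c ^ (m - 1)"
    "\<And>z. z \<in> crit.B \<Longrightarrow> \<phi> z \<in> k"
    using crit.specialization_exists by blast
  from crit.exists_transposition_aux[OF this] obtain \<tau> x y where
    "\<tau> \<in> gal K L" "x \<in> crit.rootsF" "y \<in> crit.rootsF" "x \<noteq> y" "\<tau> x = y" "\<tau> y = x"
    "\<And>z. z \<in> crit.rootsF \<Longrightarrow> z \<noteq> x \<Longrightarrow> z \<noteq> y \<Longrightarrow> \<tau> z = z"
    by blast
  thus ?thesis by (intro that[of \<tau> x y]) auto
qed

text \<open>One automorphism moves \<open>x\<close> to \<open>u\<close>; a second one, in the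
  stabilizer of \<open>u\<close>, corrects the image of \<open>y\<close>.\<close>

lemma gal_two_transitive:
  assumes "poly F x = 0" "poly F y = 0" "x \<noteq> y" "poly F u = 0" "poly F v = 0" "u \<noteq> v"
  obtains \<sigma> where "\<sigma> \<in> gal K L" "\<sigma> x = u" "\<sigma> y = v"
proof -
  obtain \<sigma>1 where \<sigma>1: "\<sigma>1 \<in> gal K L" "\<sigma>1 x = u" using gal_transitive[OF assms(1,4)] by blast
  note bij = gal_bij_roots[OF \<sigma>1(1)]
  have y1: "poly F (\<sigma>1 y) = 0" using bij_betw_apply[OF bij] assms(2) by auto
  have "\<sigma>1 y \<noteq> u"
    using bij_betw_imp_inj_on[OF bij] assms(1-3) \<sigma>1(2) by (auto simp: inj_on_def)
  then obtain \<sigma>2 where \<sigma>2: "\<sigma>2 \<in> gal K L" "\<sigma>2 u = u" "\<sigma>2 (\<sigma>1 y) = v"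
    using gal_stabilizer_transitive[OF assms(4) y1 _ assms(5)] assms(6) by metis
  have "x \<in> L" "y \<in> L" using assms roots_subset_L by auto
  thus ?thesis
    using that[OF gal_compose[OF subring_L K_subset_L \<sigma>2(1) \<sigma>1(1)]] \<sigma>1(2) \<sigma>2(2,3)
    by (simp add: compose_def)
qed

end

subsection \<open>Generating the symmetric group\<close>

lemma permutes_transpositions_induct:
  assumes "finite S" "p permutes S"
    and id: "P id" and comp: "\<And>q r. P q \<Longrightarrow> P r \<Longrightarrow> P (q \<circ> r)"
    and transp: "\<And>x y. x \<in> S \<Longrightarrow> y \<in> S \<Longrightarrow> x \<noteq> y \<Longrightarrow> P (transpose x y)"
  shows "P p"
  \<comment> \<open>\<open>transp\<close> is carried through the induction because it refers to the
    shrinking set.\<close>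
  using assms(1,2) transp
proof (induction S arbitrary: p rule: finite_induct)
  case empty
  thus ?case using id by (simp add: id_def)
next
  case (insert x S)
  define q where "q = transpose x (p x) \<circ> p"
  have "q permutes S" unfolding q_def by (rule permutes_insert_lemma[OF insert.prems(1)])
  hence "P q" using insert.IH insert.prems(2) by blast
  have p: "p = transpose x (p x) \<circ> q" by (simp add: q_def fun_eq_iff)
  show ?case
  proof (cases "p x = x")
    case True
    thus ?thesis using p \<open>P q\<close> by simp
  next
    case False
    have "p x \<in> insert x S" using permutes_in_image[OF insert.prems(1)] by simp
    hence "P (transpose x (p x))" using insert.prems(2)[of x "p x"] False by simp
    thus ?thesis using comp \<open>P q\<close> p by metis
  qed
qed

context trinomial
begin

text \<open>By double transitivity, every transposition of roots is a conjugate of the one that was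
  found.\<close>

lemma gal_transposition:
  assumes u: "poly F u = 0" and v: "poly F v = 0" and "u \<noteq> v"
  obtains \<sigma> where "\<sigma> \<in> gal K L" "\<And>z. poly F z = 0 \<Longrightarrow> \<sigma> z = transpose u v z"
proof -
  obtain \<tau> x y where \<tau>: "\<tau> \<in> gal K L" "poly F x = 0" "poly F y = 0" "x \<noteq> y" "\<tau> x = y" "\<tau> y = x"
    "\<And>z. poly F z = 0 \<Longrightarrow> z \<noteq> x \<Longrightarrow> z \<noteq> y \<Longrightarrow> \<tau> z = z"
    using exists_transposition by blast
  obtain \<rho> where \<rho>: "\<rho> \<in> gal K L" "\<rho> x = u" "\<rho> y = v"
    using gal_two_transitive[OF \<tau>(2-4) assms] by blast
  obtain \<rho>' where \<rho>': "\<rho>' \<in> gal K L" "\<And>z. z \<in> L \<Longrightarrow> \<rho>' (\<rho> z) = z" "\<And>z. z \<in> L \<Longrightarrow> \<rho> (\<rho>' z) = z"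
    using gal_inverse[OF subfield_L K_subset_L \<rho>(1)] by blast
  have xyL: "x \<in> L" "y \<in> L" using \<tau> roots_subset_L by auto
  have inv: "\<rho>' u = x" "\<rho>' v = y" using \<rho>'(2)[OF xyL(1)] \<rho>'(2)[OF xyL(2)] \<rho> by auto
  show ?thesis
  proof
    show "compose L \<rho> (compose L \<tau> \<rho>') \<in> gal K L"
      by (intro gal_compose[OF subring_L K_subset_L] \<rho> \<tau> \<rho>')
    fix z assume z: "poly F z = 0"
    have zL: "z \<in> L" using z roots_subset_L by auto
    have z': "poly F (\<rho>' z) = 0" using bij_betw_apply[OF gal_bij_roots[OF \<rho>'(1)]] z by auto
    have eq: "compose L \<rho> (compose L \<tau> \<rho>') z = \<rho> (\<tau> (\<rho>' z))"
      using zL by (simp add: compose_def)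
    consider "z = u" | "z = v" | "z \<noteq> u" "z \<noteq> v" by blast
    hence "\<rho> (\<tau> (\<rho>' z)) = transpose u v z"
    proof cases
      case 3
      have "\<rho>' z \<noteq> x" "\<rho>' z \<noteq> y" using \<rho>'(3)[OF zL] \<rho>(2,3) 3 by auto
      hence "\<tau> (\<rho>' z) = \<rho>' z" by (rule \<tau>(7)[OF z'])
      thus ?thesis using \<rho>'(3)[OF zL] 3 by (simp add: transpose_apply_other)
    qed (simp_all only: inv \<tau>(5,6) \<rho>(2,3) transpose_apply_first transpose_apply_second)
    thus "compose L \<rho> (compose L \<tau> \<rho>') z = transpose u v z" using eq by simp
  qed
qed

lemma gal_full:
  assumes "p permutes {x. poly F x = 0}"
  shows "\<exists>\<sigma>\<in>gal K L. \<forall>x. poly F x = 0 \<longrightarrow> \<sigma> x = p x"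
proof -
  let ?X = "{x. poly F x = 0}"
  \<comment> \<open>The predicate includes \<open>p permutes ?X\<close> so that in a composite the
    inner permutation is known to return a root.\<close>
  have "p permutes ?X \<and> (\<exists>\<sigma>\<in>gal K L. \<forall>x. poly F x = 0 \<longrightarrow> \<sigma> x = p x)"
  proof (rule permutes_transpositions_induct[OF poly_roots_finite[OF F_nz] assms])
    show "id permutes ?X \<and> (\<exists>\<sigma>\<in>gal K L. \<forall>x. poly F x = 0 \<longrightarrow> \<sigma> x = id x)"
      using roots_subset_L by (intro conjI permutes_id bexI[OF _ gal_identity]) auto
  next
    fix q r
    assume q: "q permutes ?X \<and> (\<exists>\<sigma>\<in>gal K L. \<forall>x. poly F x = 0 \<longrightarrow> \<sigma> x = q x)"
      and r: "r permutes ?X \<and> (\<exists>\<sigma>\<in>gal K L. \<forall>x. poly F x = 0 \<longrightarrow> \<sigma> x = r x)"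
    obtain \<sigma> where \<sigma>: "\<sigma> \<in> gal K L" "\<And>x. poly F x = 0 \<Longrightarrow> \<sigma> x = q x" using q by blast
    obtain \<tau> where \<tau>: "\<tau> \<in> gal K L" "\<And>x. poly F x = 0 \<Longrightarrow> \<tau> x = r x" using r by blast
    have "compose L \<sigma> \<tau> x = (q \<circ> r) x" if x: "poly F x = 0" for x
    proof -
      have "poly F (r x) = 0" using permutes_in_image[of r ?X x] r x by auto
      moreover have "x \<in> L" using x roots_subset_L by auto
      ultimately show ?thesis using \<sigma>(2) \<tau>(2) x by (simp add: compose_def)
    qed
    thus "q \<circ> r permutes ?X \<and> (\<exists>\<sigma>\<in>gal K L. \<forall>x. poly F x = 0 \<longrightarrow> \<sigma> x = (q \<circ> r) x)"
      using q r gal_compose[OF subring_L K_subset_L \<sigma>(1) \<tau>(1)] permutes_compose by blast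
  next
    fix u v assume "u \<in> ?X" "v \<in> ?X" "u \<noteq> v"
    thus "transpose u v permutes ?X \<and> (\<exists>\<sigma>\<in>gal K L. \<forall>x. poly F x = 0 \<longrightarrow> \<sigma> x = transpose u v x)"
      using gal_transposition[of u v] permutes_swap_id[of u ?X v] by blast
  qed
  thus ?thesis by blast
qed

end

subsection \<open>The Galois groups as HOL-Algebra groups\<close>

lemma ambient_simps [simp]:
  "carrier \<Omega> = UNIV" "x \<otimes>\<^bsub>\<Omega>\<^esub> y = x * y" "x \<oplus>\<^bsub>\<Omega>\<^esub> y = x + y" "\<one>\<^bsub>\<Omega>\<^esub> = 1" "\<zero>\<^bsub>\<Omega>\<^esub> = 0"
  by (simp_all add: ring_of_type_algebra_def)

lemma ambient_field: "field (\<Omega> :: 'a::alg_closed_field ring)"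
  by (rule field_from_type_algebra)

lemma ambient_uminus [simp]: "\<ominus>\<^bsub>\<Omega>\<^esub> x = - x" for x :: "'a::alg_closed_field"
proof -
  interpret ambient: field "\<Omega> :: 'a ring" by (rule ambient_field)
  show ?thesis using ambient.minus_equality[of "- x" x] by simp
qed

lemma ambient_inverse: "x \<noteq> 0 \<Longrightarrow> inv\<^bsub>\<Omega>\<^esub> x = inverse x" for x :: "'a::alg_closed_field"
proof -
  interpret ambient: field "\<Omega> :: 'a ring" by (rule ambient_field)
  show "x \<noteq> 0 \<Longrightarrow> inv\<^bsub>\<Omega>\<^esub> x = inverse x" using ambient.comm_inv_char[of x "inverse x"] by simp
qed

lemma subfield_ambient_imp_subfield_set:
  fixes S :: "'a::alg_closed_field set"
  assumes "subfield S \<Omega>"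
  shows "subfield_set S"
proof -
  interpret ambient: field "\<Omega> :: 'a ring" by (rule ambient_field)
  note R = subringE[OF subfieldE(1)[OF assms]]
  have "x - y \<in> S" if "x \<in> S" "y \<in> S" for x y
    using R(7)[of x "- y"] R(5)[of y] that by simp
  moreover have "inverse x \<in> S" if "x \<in> S" for x
    using ambient.subfield_m_inv(1)[OF assms, of x] ambient_inverse[of x] R(2) that
    by (cases "x = 0") auto
  ultimately show ?thesis
    using R(3,6) by (auto simp: subfield_set_def subring_set_def)
qed

lemma subfield_set_generate_field:
  fixes H :: "'a::alg_closed_field set"
  shows "subfield_set (generate_field \<Omega> H)"
  by (rule subfield_ambient_imp_subfield_set[OF field.generate_field_is_subfield[OF ambient_field]]) simp

lemma generate_field_least:
  fixes S :: "'a::alg_closed_field set"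
  assumes S: "subfield_set S" and H: "H \<subseteq> S"
  shows "generate_field \<Omega> H \<subseteq> S"
proof
  note R = subfield_subring[OF S]
  fix x assume "x \<in> generate_field \<Omega> H"
  thus "x \<in> S"
    by induction (use H in \<open>auto simp: subring_closed[OF R] ambient_inverse subfield_inverse[OF S]\<close>)
qed

lemma generate_field_superset: "H \<subseteq> generate_field \<Omega> H"
  by (auto intro: generate_field.incl)

text \<open>\<open>L\<close> is built with ring operations only, but is a field since the roots are
  algebraic; field generation adds nothing.\<close>

lemma (in root_field) splitting_field_eq: "splitting_field K f = L"
proof
  show "splitting_field K f \<subseteq> L"
    unfolding splitting_field_def root_set_def
    using K_subset_L roots_subset_L by (intro generate_field_least[OF subfield_L]) auto
  show "L \<subseteq> splitting_field K f"
    unfolding splitting_field_def root_set_def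
    using generate_field_superset[of "K \<union> {x. poly f x = 0}"]
    by (intro L_least subfield_subring[OF subfield_set_generate_field]) auto
qed

lemma (in root_field) carrier_Gal: "carrier (Gal f K) = gal K L"
proof -
  have "\<sigma> \<in> Bij L \<and> \<sigma> \<in> ring_iso (subfield_ring L) (subfield_ring L) \<longleftrightarrow>
      \<sigma> \<in> extensional L \<and> hom_on L \<sigma> \<and> \<sigma> ` L = L" for \<sigma>
    using hom_subfield_inj_on[OF subfield_L, of \<sigma>]
    by (auto simp: Bij_def ring_iso_def ring_hom_def bij_betw_def hom_on_def)
  thus ?thesis by (auto simp: Gal_def Let_def splitting_field_eq gal_def)
qed

lemma (in root_field) Gal_mult:
  "\<sigma> \<in> gal K L \<Longrightarrow> \<tau> \<in> gal K L \<Longrightarrow> \<sigma> \<otimes>\<^bsub>Gal f K\<^esub> \<tau> = compose L \<sigma> \<tau>"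
proof -
  have "gal K L \<subseteq> Bij L"
    using hom_subfield_inj_on[OF subfield_L] by (auto simp: gal_def Bij_def bij_betw_def)
  thus "\<sigma> \<in> gal K L \<Longrightarrow> \<tau> \<in> gal K L \<Longrightarrow> \<sigma> \<otimes>\<^bsub>Gal f K\<^esub> \<tau> = compose L \<sigma> \<tau>"
    by (auto simp: Gal_def Let_def splitting_field_eq BijGroup_def)
qed

lemma BijGroup_iso_sym_group:
  assumes "finite S" "card S = n"
  shows "BijGroup S \<cong> sym_group n"
proof -
  let ?I = "{1..n}"
  obtain \<beta> where \<beta>: "bij_betw \<beta> ?I S"
    using ex_bij_betw_nat_finite_1[OF assms(1)] assms(2) by auto
  define \<gamma> where "\<gamma> = inv_into ?I \<beta>"
  have \<gamma>: "bij_betw \<gamma> S ?I" unfolding \<gamma>_def by (rule bij_betw_inv_into[OF \<beta>])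
  have \<beta>\<gamma>: "\<beta> (\<gamma> x) = x" if "x \<in> S" for x
    unfolding \<gamma>_def using bij_betw_inv_into_right[OF \<beta> that] .
  have \<gamma>\<beta>: "\<gamma> (\<beta> i) = i" if "i \<in> ?I" for i
    unfolding \<gamma>_def using bij_betw_inv_into_left[OF \<beta> that] .
  have mem: "\<beta> i \<in> S" if "i \<in> ?I" for i using bij_betw_apply[OF \<beta> that] .
  have mem': "\<gamma> x \<in> ?I" if "x \<in> S" for x using bij_betw_apply[OF \<gamma> that] .
  \<comment> \<open>The two groups use different defaults: elements of \<open>Bij S\<close> are
    undefined outside \<open>S\<close>, permutations of \<open>{1..n}\<close> are the identity
    outside. \<open>restrict_id\<close> converts between them.\<close>
  define h where "h p = restrict_id (\<gamma> \<circ> p \<circ> \<beta>) ?I" for p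
  have h_perm: "h p permutes ?I" if "p \<in> Bij S" for p
    unfolding h_def using that \<beta> \<gamma>
    by (intro permutes_restrict_id bij_betw_trans[of _ _ S]) (auto simp: Bij_def intro: bij_betw_trans)
  have "h \<in> iso (BijGroup S) (sym_group n)"
  proof (rule isoI)
    show "h \<in> hom (BijGroup S) (sym_group n)"
    proof (rule homI)
      fix p assume "p \<in> carrier (BijGroup S)"
      thus "h p \<in> carrier (sym_group n)" using h_perm by (simp add: BijGroup_def sym_group_carrier)
    next
      fix p q assume "p \<in> carrier (BijGroup S)" "q \<in> carrier (BijGroup S)"
      hence pq: "p \<in> Bij S" "q \<in> Bij S" by (auto simp: BijGroup_def)
      have "h (compose S p q) i = (h p \<circ> h q) i" for i
      proof (cases "i \<in> ?I")
        case True
        have "q (\<beta> i) \<in> S" using Bij_imp_funcset[OF pq(2)] mem[OF True] by auto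
        thus ?thesis using True mem[OF True] mem' \<beta>\<gamma> by (simp add: h_def compose_def)
      qed (simp add: h_def)
      thus "h (p \<otimes>\<^bsub>BijGroup S\<^esub> q) = h p \<otimes>\<^bsub>sym_group n\<^esub> h q"
        using pq by (auto simp: BijGroup_def sym_group_mult fun_eq_iff)
    qed
    show "bij_betw h (carrier (BijGroup S)) (carrier (sym_group n))"
    proof (rule bij_betwI')
      fix p q assume "p \<in> carrier (BijGroup S)" "q \<in> carrier (BijGroup S)"
      hence pq: "p \<in> Bij S" "q \<in> Bij S" by (auto simp: BijGroup_def)
      show "h p = h q \<longleftrightarrow> p = q"
      proof
        assume eq: "h p = h q"
        show "p = q"
        proof (rule extensionalityI[of _ S])
          fix x assume x: "x \<in> S"
          have "\<gamma> (p x) = \<gamma> (q x)"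
            using fun_cong[OF eq, of "\<gamma> x"] mem'[OF x] \<beta>\<gamma>[OF x] by (simp add: h_def)
          moreover have "p x \<in> S" "q x \<in> S"
            using Bij_imp_funcset[OF pq(1)] Bij_imp_funcset[OF pq(2)] x by auto
          ultimately show "p x = q x" using \<beta>\<gamma> by metis
        qed (use pq in \<open>auto simp: Bij_def\<close>)
      qed simp
    next
      fix p assume "p \<in> carrier (BijGroup S)"
      thus "h p \<in> carrier (sym_group n)" using h_perm by (simp add: BijGroup_def sym_group_carrier)
    next
      fix q assume "q \<in> carrier (sym_group n)"
      hence q: "q permutes ?I" by (simp add: sym_group_carrier)
      define p where "p = restrict (\<beta> \<circ> q \<circ> \<gamma>) S"
      have "bij_betw (\<beta> \<circ> q \<circ> \<gamma>) S S"
        using bij_betw_trans[OF bij_betw_trans[OF \<gamma> permutes_imp_bij[OF q]] \<beta>] by (simp add: comp_assoc)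
      hence "p \<in> Bij S" by (simp add: p_def Bij_def bij_betw_restrict_eq)
      moreover have "q i = h p i" for i
      proof (cases "i \<in> ?I")
        case True
        moreover have "q i \<in> ?I" using permutes_in_image[OF q] True by simp
        ultimately show ?thesis using mem \<gamma>\<beta> by (simp add: h_def p_def)
      next
        case False
        thus ?thesis using permutes_not_in[OF q False] by (simp add: h_def)
      qed
      ultimately show "\<exists>p\<in>carrier (BijGroup S). q = h p" by (auto simp: BijGroup_def fun_eq_iff)
    qed
  qed
  thus ?thesis by (rule is_isoI)
qed

context root_field
begin

lemma Gal_full_imp:
  assumes full: "\<And>p. p permutes {x. poly f x = 0} \<Longrightarrow> \<exists>\<sigma>\<in>gal K L. \<forall>x. poly f x = 0 \<longrightarrow> \<sigma> x = p x"
  shows "Gal_on_roots f K = BijGroup (root_set f)"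
    and "card (root_set f) = n \<Longrightarrow> Gal f K \<cong> sym_group n"
proof -
  let ?X = "root_set f"
  have X: "?X = {x. poly f x = 0}" by (simp add: root_set_def)
  have fin: "finite ?X" unfolding X by (rule poly_roots_finite[OF f(2)])
  have XL: "?X \<subseteq> L" using roots_subset_L X by simp
  have img: "(\<lambda>\<sigma>. restrict \<sigma> ?X) ` gal K L = Bij ?X"
  proof
    show "(\<lambda>\<sigma>. restrict \<sigma> ?X) ` gal K L \<subseteq> Bij ?X"
      using gal_bij_roots by (auto simp: Bij_def X)
    show "Bij ?X \<subseteq> (\<lambda>\<sigma>. restrict \<sigma> ?X) ` gal K L"
    proof
      fix p assume p: "p \<in> Bij ?X"
      hence "restrict_id p ?X permutes ?X" by (intro permutes_restrict_id) (simp add: Bij_def)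
      then obtain \<sigma> where "\<sigma> \<in> gal K L" "\<And>x. poly f x = 0 \<Longrightarrow> \<sigma> x = restrict_id p ?X x"
        using full X by metis
      moreover from this have "restrict \<sigma> ?X = p"
        using p by (intro extensionalityI[of _ ?X]) (auto simp: Bij_def X)
      ultimately show "p \<in> (\<lambda>\<sigma>. restrict \<sigma> ?X) ` gal K L" by blast
    qed
  qed
  show "Gal_on_roots f K = BijGroup ?X"
    unfolding Gal_on_roots_def carrier_Gal img by (simp add: BijGroup_def)
  show "Gal f K \<cong> sym_group n" if "card ?X = n"
  proof (rule iso_trans[OF is_isoI BijGroup_iso_sym_group[OF fin that]])
    show "(\<lambda>\<sigma>. restrict \<sigma> ?X) \<in> iso (Gal f K) (BijGroup ?X)"
    proof (rule isoI)
      show "(\<lambda>\<sigma>. restrict \<sigma> ?X) \<in> hom (Gal f K) (BijGroup ?X)"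
      proof (rule homI; unfold carrier_Gal)
        fix \<sigma> assume "\<sigma> \<in> gal K L"
        thus "restrict \<sigma> ?X \<in> carrier (BijGroup ?X)" using img by (auto simp: BijGroup_def)
      next
        fix \<sigma> \<tau> assume s: "\<sigma> \<in> gal K L" "\<tau> \<in> gal K L"
        have "restrict \<sigma> ?X \<in> Bij ?X" "restrict \<tau> ?X \<in> Bij ?X" using img s by auto
        moreover have "restrict (compose L \<sigma> \<tau>) ?X = compose ?X (restrict \<sigma> ?X) (restrict \<tau> ?X)"
          using XL bij_betw_apply[OF gal_bij_roots[OF s(2)]]
          by (auto simp: compose_def restrict_def fun_eq_iff X)
        ultimately show "restrict (\<sigma> \<otimes>\<^bsub>Gal f K\<^esub> \<tau>) ?X = restrict \<sigma> ?X \<otimes>\<^bsub>BijGroup ?X\<^esub> restrict \<tau> ?X"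
          using Gal_mult[OF s] by (simp add: BijGroup_def)
      qed
      have "inj_on (\<lambda>\<sigma>. restrict \<sigma> ?X) (gal K L)"
      proof (rule inj_onI)
        fix \<sigma> \<tau> assume *: "\<sigma> \<in> gal K L" "\<tau> \<in> gal K L" "restrict \<sigma> ?X = restrict \<tau> ?X"
        have "\<sigma> x = \<tau> x" if "poly f x = 0" for x
          using fun_cong[OF *(3), of x] that by (simp add: X)
        thus "\<sigma> = \<tau>" by (rule gal_eqI[OF *(1,2)])
      qed
      thus "bij_betw (\<lambda>\<sigma>. restrict \<sigma> ?X) (carrier (Gal f K)) (carrier (BijGroup ?X))"
        using img by (simp add: bij_betw_def carrier_Gal BijGroup_def)
    qed
  qed
qed

end

subsection \<open>Algebraic closures of finite fields\<close>

text \<open>Translation by 1 permutes \<open>S\<close>; comparing the sum of all elements before and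
  after leaves the cardinality equal to 0.\<close>

lemma of_nat_card_eq_0:
  fixes S :: "'a::comm_ring_1 set"
  assumes "subring_set S" "finite S"
  shows "of_nat (card S) = (0 :: 'a)"
proof -
  have "bij_betw (\<lambda>x. x + 1) S S"
    by (rule bij_betwI[of _ _ _ "\<lambda>x. x - 1"]) (auto simp: subring_closed[OF assms(1)])
  hence "(\<Sum>x\<in>S. x) = (\<Sum>x\<in>S. x + 1)" by (rule sum.reindex_bij_betw[symmetric])
  thus ?thesis by (simp add: sum.distrib)
qed

lemma subfield_ring_UNIV: "subfield_ring UNIV = \<Omega>"
  by (simp add: ring_of_type_algebra_def)

text \<open>Polynomials of \<open>HOL-Algebra\<close> are lists with the leading coefficient first,
  whereas \<open>Poly\<close> expects the constant term first.\<close>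

lemma eval_subfield_ring:
  fixes S :: "'a::alg_closed_field set"
  assumes "ring (subfield_ring S)"
  shows "ring.eval (subfield_ring S) xs x = poly (Poly (rev xs)) x"
proof -
  interpret S: ring "subfield_ring S" by (rule assms)
  have pow: "x [^]\<^bsub>subfield_ring S\<^esub> n = x ^ n" for n :: nat
    by (induction n) (simp_all add: mult.commute)
  show ?thesis
    by (induction xs) (simp_all add: pow Poly_append poly_monom mult.commute add.commute)
qed

lemma set_coeffs_polys:
  assumes "p \<in> polys S"
  shows "set (coeffs p) \<subseteq> S"
proof
  fix c assume "c \<in> set (coeffs p)"
  hence "c \<in> range (coeff p)" by (simp add: range_coeff)
  thus "c \<in> S" using assms by (auto simp: polys_def)
qed

lemma rev_coeffs_carrier:
  fixes S :: "'a::alg_closed_field set"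
  assumes "p \<in> polys S"
  shows "rev (coeffs p) \<in> carrier (S[X]\<^bsub>\<Omega>\<^esub>)" and "rev (coeffs p) \<in> carrier (poly_ring (subfield_ring S))"
proof -
  have "set (coeffs p) \<subseteq> S" by (rule set_coeffs_polys[OF assms])
  moreover have "hd (rev (coeffs p)) \<noteq> 0" if "p \<noteq> 0"
    using that by (simp add: hd_rev last_coeffs_eq_coeff_degree)
  ultimately show "rev (coeffs p) \<in> carrier (S[X]\<^bsub>\<Omega>\<^esub>)"
    and "rev (coeffs p) \<in> carrier (poly_ring (subfield_ring S))"
    by (auto simp: polynomial_def simp flip: univ_poly_carrier)
qed

context
  fixes Fq Fqbar :: "'a::alg_closed_field set"
  assumes Fq: "subfield Fq \<Omega>" and Fqbar: "subfield Fqbar \<Omega>"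
    and closure: "algebraic_closure (subfield_ring Fqbar) Fq"
begin

lemma algebraic_closure_has_root:
  assumes p: "p \<in> polys Fqbar" "degree p > 0"
  shows "\<exists>x\<in>Fqbar. poly p x = 0"
proof -
  interpret C: algebraic_closure "subfield_ring Fqbar" Fq by (rule closure)
  note mem = rev_coeffs_carrier(2)[OF p(1)]
  have "p \<noteq> 0" using p(2) by auto
  hence "length (coeffs p) - 1 > 0" using p(2) by (simp add: degree_eq_length_coeffs)
  hence "C.roots (rev (coeffs p)) \<noteq> {#}"
    using C.roots_over_carrier[OF mem] by (auto simp: C.splitted_def)
  then obtain x where "x \<in># C.roots (rev (coeffs p))" by blast
  hence "C.is_root (rev (coeffs p)) x" using C.roots_mem_iff_is_root[OF mem] by simp
  thus ?thesis
    by (auto simp: C.is_root_def eval_subfield_ring[OF C.ring_axioms])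
qed

lemma Fq_subset_closure: "Fq \<subseteq> Fqbar"
proof -
  interpret C: algebraic_closure "subfield_ring Fqbar" Fq by (rule closure)
  show ?thesis using C.subset by simp
qed

text \<open>A relation of \<open>t\<close> over the closure has its coefficients in a finite
  extension of \<open>Fq\<close>. The tower law would then make \<open>t\<close> algebraic over
  \<open>Fq\<close>.\<close>

lemma transcendental_over_closure:
  assumes t: "ring.transcendental \<Omega> Fq t" and p: "p \<in> polys Fqbar" "poly p t = 0"
  shows "p = 0"
proof (rule ccontr)
  assume "p \<noteq> 0"
  interpret C: algebraic_closure "subfield_ring Fqbar" Fq by (rule closure)
  interpret ambient: field "\<Omega> :: 'a ring" by (rule ambient_field)
  have alg: "(ambient.algebraic over Fq) x" if "x \<in> Fqbar" for x
    using C.algebraic_extension[of x] that ambient.algebraic_consistent[OF subfieldE(1)[OF Fqbar]] by simp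
  define P where "P = rev (coeffs p)"
  define E where "E = ambient.finite_extension Fq P"
  have setP: "set P \<subseteq> Fqbar" unfolding P_def using set_coeffs_polys[OF p(1)] by simp
  have algP: "(ambient.algebraic over Fq) x" if "x \<in> set P" for x using alg setP that by auto
  have E: "subfield E \<Omega>"
    unfolding E_def by (rule ambient.finite_extension_is_subfield[OF Fq]) (simp_all add: algP)
  have dimE: "ambient.finite_dimension Fq E"
    unfolding E_def by (rule ambient.finite_extension_finite_dimension(1)[OF Fq]) (simp_all add: algP)
  have "set P \<subseteq> E" unfolding E_def by (rule ambient.finite_extension_mem[OF subfieldE(1)[OF Fq]]) simp
  moreover have "P \<noteq> []" "hd P \<noteq> 0"
    using \<open>p \<noteq> 0\<close> by (simp_all add: P_def hd_rev last_coeffs_eq_coeff_degree)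
  ultimately have "P \<in> carrier (E[X]\<^bsub>\<Omega>\<^esub>)"
    by (simp add: polynomial_def flip: univ_poly_carrier)
  moreover have "ambient.eval P t = 0"
    using eval_subfield_ring[of UNIV P t] ambient.ring_axioms p(2) by (simp add: P_def subfield_ring_UNIV)
  ultimately have "(ambient.algebraic over E) t"
    using \<open>P \<noteq> []\<close> by (intro ambient.algebraicI) auto
  hence "ambient.finite_dimension E (ambient.simple_extension E t)"
    using ambient.finite_dimension_simple_extension[OF E] by simp
  hence "ambient.finite_dimension Fq (ambient.simple_extension E t)"
    by (rule ambient.telescopic_base_dim(1)[OF Fq E dimE])
  hence "(ambient.algebraic over Fq) t"
    using ambient.finite_dimension_imp_algebraic[OF Fq ambient.simple_extension_is_subring[OF subfieldE(1)[OF E]]]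
      ambient.simple_extension_mem[OF subfieldE(1)[OF E]] by simp
  thus False using t by (simp add: over_def)
qed

end

subsection \<open>Base change\<close>

lemma (in trinomial) simple_field_ext_eq: "k\<langle>t\<rangle> = K"
proof
  show "k\<langle>t\<rangle> \<subseteq> K"
    unfolding simple_field_ext_def using k_subset_K t_in_K by (intro generate_field_least[OF K_field]) auto
  show "K \<subseteq> k\<langle>t\<rangle>"
    unfolding simple_field_ext_def using generate_field_superset[of "insert t k"]
    by (intro K_least[OF subfield_set_generate_field]) auto
qed

text \<open>Restriction embeds the geometric Galois group into the arithmetic one, so the latter is full
  as soon as the former is.\<close>

lemma (in trinomial) Gal_full_over_subfield:
  assumes K0: "subfield_set K0" "K0 \<subseteq> K" "F \<in> polys K0"
  shows "Gal_on_roots F K0 = BijGroup (root_set F)" "Gal F K0 \<cong> sym_group m"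
proof -
  interpret sub: root_field K0 F xs by unfold_locales (use K0 F_nz xs in auto)
  have sL: "sub.L \<subseteq> L"
    using K0(2) K_subset_L roots_subset_L by (intro sub.L_least[OF subring_L]) auto
  have full: "\<exists>\<sigma>\<in>gal K0 sub.L. \<forall>x. poly F x = 0 \<longrightarrow> \<sigma> x = p x" if p: "p permutes {x. poly F x = 0}" for p
  proof -
    obtain \<sigma> where \<sigma>: "\<sigma> \<in> gal K L" "\<And>x. poly F x = 0 \<Longrightarrow> \<sigma> x = p x" using gal_full[OF p] by blast
    let ?\<sigma> = "restrict \<sigma> sub.L"
    have hom: "hom_on sub.L ?\<sigma>"
      using hom_on_cong[OF sub.subring_L, of ?\<sigma> \<sigma>] hom_on_subset[OF gal_hom[OF \<sigma>(1)] sL] by simp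
    have fixed: "?\<sigma> c = c" if "c \<in> K0" for c
      using that sub.K_subset_L K0(2) gal_fix[OF \<sigma>(1), of c] by auto
    have "?\<sigma> \<in> gal K0 sub.L"
      unfolding gal_def using hom fixed sub.hom_onto(1)[OF hom fixed] by simp
    moreover have "?\<sigma> x = p x" if "poly F x = 0" for x
      using that \<sigma>(2) sub.roots_subset_L by auto
    ultimately show ?thesis by blast
  qed
  show "Gal_on_roots F K0 = BijGroup (root_set F)"
    by (rule sub.Gal_full_imp(1)) (rule full)
  have "card (root_set F) = m" unfolding root_set_def by (rule card_roots)
  thus "Gal F K0 \<cong> sym_group m"
    by (rule sub.Gal_full_imp(2)[rotated]) (rule full)
qed

text \<open>The groups over the two base fields consist of maps on two splitting fields that may
  differ, so their equality is stated for the induced permutations of the common root set. That this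
  set has \<open>m\<close> elements identifies its bijection group with the symmetric group on
  \<open>m\<close> letters.\<close>

theorem theorem3p3:
  fixes p h q m :: nat
    and Fq Fqbar :: "'a::alg_closed_field set"
    and t a b :: 'a
  assumes "prime p" and "h > 0" and "q = p ^ h"
    and "m > 0" and "\<not> p dvd m * (m - 1)"
    and "subfield Fq \<Omega>" and "card Fq = q"
    and "subfield Fqbar \<Omega>" and "algebraic_closure (subfield_ring Fqbar) Fq"
    and "ring.transcendental \<Omega> Fq t"
    and "a \<in> Fq" and "b \<in> Fq" and "b \<noteq> 0" and "b \<noteq> a ^ m"
  shows "card (root_set (F_poly m t a b)) = m \<and>
    Gal_on_roots (F_poly m t a b) (Fq\<langle>t\<rangle>) = Gal_on_roots (F_poly m t a b) (Fqbar\<langle>t\<rangle>) \<and>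
    Gal_on_roots (F_poly m t a b) (Fqbar\<langle>t\<rangle>) = BijGroup (root_set (F_poly m t a b)) \<and>
    Gal (F_poly m t a b) (Fq\<langle>t\<rangle>) \<cong> sym_group m \<and>
    Gal (F_poly m t a b) (Fqbar\<langle>t\<rangle>) \<cong> sym_group m"
proof -
  note Fq = subfield_ambient_imp_subfield_set[OF assms(6)]
  note Fqbar = subfield_ambient_imp_subfield_set[OF assms(8)]
  note sub = Fq_subset_closure[OF assms(6,8,9)]
  \<comment> \<open>\<open>card\<close> is 0 on infinite sets, so a positive cardinality forces
    finiteness.\<close>
  have "finite Fq"
    using assms(1,3,7) prime_gt_0_nat[of p] by (intro card_ge_0_finite) simp
  hence "of_nat (p ^ h) = (0 :: 'a)"
    using of_nat_card_eq_0[OF subfield_subring[OF Fq]] assms(3,7) by simp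
  hence p0: "of_nat p = (0 :: 'a)" by simp
  have "CHAR('a) dvd p" using p0 by (simp add: of_nat_eq_0_iff_char_dvd)
  moreover have "CHAR('a) \<noteq> 1" by simp
  ultimately have char: "CHAR('a) = p" using assms(1) by (auto simp: prime_nat_iff)
  have "\<not> p dvd m" "\<not> p dvd (m - 1)" using assms(5) by auto
  hence nz: "of_nat m \<noteq> (0 :: 'a)" "of_nat (m - 1) \<noteq> (0 :: 'a)"
    by (simp_all only: of_nat_eq_0_iff_char_dvd char not_False_eq_True)
  \<comment> \<open>For \<open>m = 1\<close> the factor \<open>m - 1\<close> is 0, which every prime
    divides.\<close>
  have m2: "m \<ge> 2" using assms(4) \<open>\<not> p dvd (m - 1)\<close> by (cases "m = 1") auto
  interpret trinomial Fqbar t a b m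
  proof
    show "p = 0" if "p \<in> polys Fqbar" "poly p t = 0" for p
      by (rule transcendental_over_closure[OF assms(6,8,9,10) that])
    show "\<exists>x\<in>Fqbar. poly p x = 0" if "p \<in> polys Fqbar" "degree p > 0" for p
      by (rule algebraic_closure_has_root[OF assms(6,8,9) that])
  qed (use Fqbar assms sub nz m2 in auto)
  have K: "Fqbar\<langle>t\<rangle> = K" by (rule simple_field_ext_eq)
  have K0: "subfield_set (Fq\<langle>t\<rangle>)" unfolding simple_field_ext_def by (rule subfield_set_generate_field)
  have K0K: "Fq\<langle>t\<rangle> \<subseteq> K"
    unfolding simple_field_ext_def using sub k_subset_K t_in_K
    by (intro generate_field_least[OF K_field]) auto
  have "F \<in> polys (Fq\<langle>t\<rangle>)"
  proof -
    have mem: "t \<in> Fq\<langle>t\<rangle>" "a \<in> Fq\<langle>t\<rangle>" "b \<in> Fq\<langle>t\<rangle>"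
      unfolding simple_field_ext_def using assms(11,12) by (auto intro: generate_field.incl)
    note R = subfield_subring[OF K0]
    show ?thesis
      unfolding F_poly_def using mem
      by (simp add: polys_closed[OF R] polys_pCons_iff[OF R] subring_closed[OF R])
  qed
  note arith = Gal_full_over_subfield[OF K0 K0K this]
  note geom = Gal_full_over_subfield[OF K_field subset_refl F_polys]
  show ?thesis
    using arith geom card_roots by (simp add: K root_set_def)
qed

end
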